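(* Let $\varphi_1,\dots,\varphi_n,\varphi$ be formulae whose free variables are among $\vec x=x_1,\dots,x_\ell$ and $\vec X=X_1,\dots,X_p$. From an $\mathsf{SMSO}$-derivation $\mathcal D$ of $\varphi_1,\dots,\varphi_n\vdash\varphi$ one can compute a finite-state synchronous function \[F_{\mathcal D}:\ \{0,1\}^\ell\times\{0,1\}^p\times\mathbf 1^\ell\times M(\varphi_1)\times\cdots\times M(\varphi_n)\ \to\ M(\varphi)\] such that $\varphi_1,\dots,\varphi_n\Vdash_{\vec x,\vec X}F_{\mathcal D}:\varphi$, i.e. for all $\vec k\in\mathbb N^\ell$, all $\vec\sigma\in(\{0,1\}^\omega)^p$ and all runs $R_i\Vdash\mathcal I[\varphi_i](\vec k,\vec\sigma)$ ($i=1,\dots,n$), we have $F_{\mathcal D}(\vec k,\vec\sigma,\vec\ast,R_1,\dots,R_n)\Vdash\mathcal I[\varphi](\vec k,\vec\sigma)$.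
   Context: \emph{Formulae and $\mathsf{SMSO}$.} Two-sorted language with individual variables $x,y,z$ and predicate variables $X,Y$; atoms $x\doteq y$, $x\leq y$, $\mathsf S(x,y)$, $\mathsf{Zero}(x)$, $x\in X$, $\top,\bot$; deterministic formulae $\delta::=\alpha\mid\delta\wedge\delta'\mid\lnot\varphi$; formulae $\varphi::=\delta\mid\varphi\wedge\psi\mid\exists x\varphi\mid\exists X\varphi$. $\mathsf{SMSO}$ is the intuitionistic sequent system with: axiom, cut, $\lnot$-intro/elim into $\bot$, $\wedge$-rules, $\exists$-intro/elim for both sorts (eigenvariable conditions); arithmetic rules ($\doteq$ reflexive with substitution of equals; $\leq$ reflexive, transitive, antisymmetric; $\vdash\exists y\mathsf{Zero}(y)$; uniqueness of $\mathsf{Zero}$; $\vdash\exists y\mathsf S(x,y)$; $\mathsf S$ functional and injective; $\mathsf S(x,y),\mathsf{Zero}(y)\vdash\bot$; $\mathsf S(x,y)\vdash x\leq y$; from $\mathsf S(y,y'),x\leq y',\lnot(x\doteq y')$ infer $x\leq y$); negative comprehension (from $\vec\varphi\vdash\varphi[\psi[y]/X]$ infer $\vec\varphi\vdash\lnot\lnot\exists X\varphi$, where $\varphi[\psi[y]/X]$ replaces each atom $t\in X$ by $\psi[t/y]$); induction for deterministic formulae (from $\vec\varphi,\mathsf{Zero}(z)\vdash\delta[z/x]$ and $\vec\varphi,\mathsf S(y,z),\delta[y/x]\vdash\delta[z/x]$ infer $\vec\varphi\vdash\delta$, $y,z$ fresh); double negation elimination for deterministic formulae; synchronous comprehension (from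 $\vec\varphi\vdash\psi[\hat\varphi[y]/X]$ infer $\vec\varphi\vdash\exists X\psi$ when $\hat\varphi$ has the form $\chi|(u\leq y)[u]$ with $y$ its only free individual variable, where relativization $\chi|\theta[u]$ fixes atoms, commutes with $\wedge,\lnot,\exists X$ and sends $\exists x\chi$ to $\exists x(\theta[x/u]\wedge\chi|\theta[u])$). \emph{Synchronous functions.} For alphabets (finite nonempty sets), $F:\Sigma^\omega\to\Gamma^\omega$ is finite-state synchronous if induced by a deterministic Mealy machine (states $Q$, initial state, $\partial:Q\times\Sigma\to Q\times\Gamma$, output at step $n$ computed from the state after reading the first $n$ letters and the $n$-th letter). Products of alphabets are identified with tuples of streams; $\mathbf 1=\{\ast\}$. \emph{Uniform automata.} A uniform automaton over $\Sigma$ is $(Q,q_0,M,\partial,\Omega)$ with $Q$ finite, $M$ a finite nonempty set of moves, $\partial:Q\times\Sigma\times M\to Q$, $\Omega\subseteq Q^\omega$ $\omega$-regular. A run on $\sigma\in\Sigma^\omega$ is $R\in M^\omega$; it is accepting ($R\Vdash\mathcal A(\sigma)$) if the state sequence $q_{k+1}=\partial(q_k,\sigma(k),R(k))$ lies in $\Omega$; $\mathcal L(\mathcal A)$ is the set of accepted words. $\mathcal A$ is deterministic if $M$ is a singleton. \emph{Interpretation.} A natural number $k$ is identified with the stream in $\{0,1\}^\omega$ which is $1$ exactly at position $k$. For $\varphi$ with free variables among $\vec x,\vec X$, $\mathcal I[\varphi]=\mathcal I[\varphi]_{\vec x,\vec X}$ is a uniform automaton over $\{0,1\}^\ell\times\{0,1\}^p$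 with move set $M(\varphi)$, defined by: for an atom, a deterministic automaton (moves $\mathbf 1$) accepting, on inputs whose individual components are singletons $\vec k$, exactly those satisfying the atom in the standard model; $\mathcal I[\psi_1\wedge\psi_2]$ is the synchronous product (moves $M(\psi_1)\times M(\psi_2)$, states pairs, acceptance iff both components accept), so a pair of runs is accepting iff each is; $\mathcal I[\lnot\psi]$ is a deterministic uniform automaton (moves $\mathbf 1$) recognizing the complement of $\mathcal L(\mathcal I[\psi])$; $\mathcal I[\exists X\psi]$ is the projection of $\mathcal I[\psi]_{\vec x,\vec X,X}$ with moves $\{0,1\}\times M(\psi)$, a run $(\beta,R)$ on $(\vec k,\vec\sigma)$ being accepting iff $R\Vdash\mathcal I[\psi](\vec k,\vec\sigma,\beta)$; $\mathcal I[\exists x\psi]$ has moves $\{0,1\}\times(\mathbf 1\times M(\psi))$, a run $(\beta,(\ast,R))$ on $(\vec k,\vec\sigma)$ being accepting iff $\beta$ is a singleton stream $k$ and $R\Vdash\mathcal I[\psi]_{\vec x,x,\vec X}(\vec k,k,\vec\sigma)$. *)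

theory Defs
  imports Main "HOL-Library.Nat_Bijection"
begin

section \<open>Formulae\<close>

text \<open>
  Formulae up to renaming of bound variables, in de Bruijn style, with one index space for
  individual and one for predicate variables.  \<open>ExI\<close> binds the individual index 0 and \<open>ExP\<close> the
  predicate index 0 of its body.  \<open>Sc x y\<close> is the atom S(x,y) and \<open>Mem x X\<close> is the atom x \<in> X.
\<close>

datatype form =
    Eq nat nat
  | Le nat nat
  | Sc nat nat
  | Zero nat
  | Mem nat nat
  | Top
  | Bot
  | And form form
  | Neg form
  | ExI form
  | ExP form

primrec deterministic :: "form \<Rightarrow> bool" where
  "deterministic (Eq x y) = True"
| "deterministic (Le x y) = True"
| "deterministic (Sc x y) = True"
| "deterministic (Zero x) = True"
| "deterministic (Mem x X) = True"
| "deterministic Top = True"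
| "deterministic Bot = True"
| "deterministic (And \<phi> \<psi>) = (deterministic \<phi> \<and> deterministic \<psi>)"
| "deterministic (Neg \<phi>) = True"
| "deterministic (ExI \<phi>) = False"
| "deterministic (ExP \<phi>) = False"

primrec fvi :: "form \<Rightarrow> nat set" where
  "fvi (Eq x y) = {x, y}"
| "fvi (Le x y) = {x, y}"
| "fvi (Sc x y) = {x, y}"
| "fvi (Zero x) = {x}"
| "fvi (Mem x X) = {x}"
| "fvi Top = {}"
| "fvi Bot = {}"
| "fvi (And \<phi> \<psi>) = fvi \<phi> \<union> fvi \<psi>"
| "fvi (Neg \<phi>) = fvi \<phi>"
| "fvi (ExI \<phi>) = {x. Suc x \<in> fvi \<phi>}"
| "fvi (ExP \<phi>) = fvi \<phi>"

primrec fvp :: "form \<Rightarrow> nat set" where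
  "fvp (Eq x y) = {}"
| "fvp (Le x y) = {}"
| "fvp (Sc x y) = {}"
| "fvp (Zero x) = {}"
| "fvp (Mem x X) = {X}"
| "fvp Top = {}"
| "fvp Bot = {}"
| "fvp (And \<phi> \<psi>) = fvp \<phi> \<union> fvp \<psi>"
| "fvp (Neg \<phi>) = fvp \<phi>"
| "fvp (ExI \<phi>) = fvp \<phi>"
| "fvp (ExP \<phi>) = {X. Suc X \<in> fvp \<phi>}"

text \<open>Extension of a renaming under a binder.\<close>

definition up :: "(nat \<Rightarrow> nat) \<Rightarrow> nat \<Rightarrow> nat" where
  "up f = case_nat 0 (\<lambda>i. Suc (f i))"

primrec ren :: "(nat \<Rightarrow> nat) \<Rightarrow> (nat \<Rightarrow> nat) \<Rightarrow> form \<Rightarrow> form" where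
  "ren f g (Eq x y) = Eq (f x) (f y)"
| "ren f g (Le x y) = Le (f x) (f y)"
| "ren f g (Sc x y) = Sc (f x) (f y)"
| "ren f g (Zero x) = Zero (f x)"
| "ren f g (Mem x X) = Mem (f x) (g X)"
| "ren f g Top = Top"
| "ren f g Bot = Bot"
| "ren f g (And \<phi> \<psi>) = And (ren f g \<phi>) (ren f g \<psi>)"
| "ren f g (Neg \<phi>) = Neg (ren f g \<phi>)"
| "ren f g (ExI \<phi>) = ExI (ren (up f) g \<phi>)"
| "ren f g (ExP \<phi>) = ExP (ren f (up g) \<phi>)"

text \<open>
  \<open>substi x t \<phi>\<close> is \<phi>[t/x] for a free individual variable x.  \<open>insti t\<close> and \<open>instp Y\<close> act on the
  body of a quantifier: they replace the bound index 0 and lower the remaining indices by one.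
\<close>

definition substi :: "nat \<Rightarrow> nat \<Rightarrow> form \<Rightarrow> form" where
  "substi x t = ren (id(x := t)) id"

definition insti :: "nat \<Rightarrow> form \<Rightarrow> form" where
  "insti t = ren (case_nat t id) id"

definition instp :: "nat \<Rightarrow> form \<Rightarrow> form" where
  "instp Y = ren id (case_nat Y id)"

text \<open>
  \<open>substp X \<psi> \<phi>\<close> is \<phi>[\<psi>[y]/X], where \<psi> is given as a body whose individual index 0 is y.  The
  predicate variable X disappears, so that larger predicate indices are lowered by one.
  Shifting \<psi> under binders makes the substitution capture-avoiding.
\<close>

primrec substp :: "nat \<Rightarrow> form \<Rightarrow> form \<Rightarrow> form" where
  "substp X \<psi> (Eq x y) = Eq x y"
| "substp X \<psi> (Le x y) = Le x y"
| "substp X \<psi> (Sc x y) = Sc x y"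
| "substp X \<psi> (Zero x) = Zero x"
| "substp X \<psi> (Mem t Y) =
     (if Y = X then insti t \<psi> else if Y < X then Mem t Y else Mem t (Y - 1))"
| "substp X \<psi> Top = Top"
| "substp X \<psi> Bot = Bot"
| "substp X \<psi> (And \<phi>1 \<phi>2) = And (substp X \<psi> \<phi>1) (substp X \<psi> \<phi>2)"
| "substp X \<psi> (Neg \<phi>) = Neg (substp X \<psi> \<phi>)"
| "substp X \<psi> (ExI \<phi>) = ExI (substp X (ren (up Suc) id \<psi>) \<phi>)"
| "substp X \<psi> (ExP \<phi>) = ExP (substp (Suc X) (ren id Suc \<psi>) \<phi>)"

text \<open>
  \<open>relativize \<theta> \<chi>\<close> is \<chi>|\<theta>[u], where \<theta> is given as a body whose individual index 0 is u.  Hence \<theta>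
  itself, placed directly below \<open>ExI\<close>, is \<theta>[x/u] for the variable x bound there.
\<close>

primrec relativize :: "form \<Rightarrow> form \<Rightarrow> form" where
  "relativize \<theta> (Eq x y) = Eq x y"
| "relativize \<theta> (Le x y) = Le x y"
| "relativize \<theta> (Sc x y) = Sc x y"
| "relativize \<theta> (Zero x) = Zero x"
| "relativize \<theta> (Mem x X) = Mem x X"
| "relativize \<theta> Top = Top"
| "relativize \<theta> Bot = Bot"
| "relativize \<theta> (And \<chi>1 \<chi>2) = And (relativize \<theta> \<chi>1) (relativize \<theta> \<chi>2)"
| "relativize \<theta> (Neg \<chi>) = Neg (relativize \<theta> \<chi>)"
| "relativize \<theta> (ExI \<chi>) = ExI (And \<theta> (relativize (ren (up Suc) id \<theta>) \<chi>))"
| "relativize \<theta> (ExP \<chi>) = ExP (relativize (ren id Suc \<theta>) \<chi>)"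


section \<open>The deduction system SMSO\<close>

type_synonym sequent = "form list \<times> form"

text \<open>
  Names of inference rules, with the data of an instance that cannot be read off its conclusion
  and premises.
\<close>

datatype rule =
    Ax | Cut | NegI | NegE | AndI | AndE1 | AndE2
  | ExII nat | ExIE nat | ExPI nat | ExPE nat
  | EqRefl | EqSubst nat nat nat form
  | LeRefl | LeTrans | LeAntisym
  | ZeroEx | ZeroUnique
  | ScEx | ScFun | ScInj | ScZero | ScLe | LeSc
  | NegCompr form
  | Induct nat nat nat
  | DNE
  | SyncCompr form

definition fresh_i :: "nat \<Rightarrow> form list \<Rightarrow> bool" where
  "fresh_i z \<Gamma> \<longleftrightarrow> (\<forall>\<phi>\<in>set \<Gamma>. z \<notin> fvi \<phi>)"

definition fresh_p :: "nat \<Rightarrow> form list \<Rightarrow> bool" where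
  "fresh_p Z \<Gamma> \<longleftrightarrow> (\<forall>\<phi>\<in>set \<Gamma>. Z \<notin> fvp \<phi>)"

text \<open>
  In the existential eliminations, the induction rule and wherever bodies are instantiated, free
  variables are indices like any others; eigenvariable conditions are freshness conditions.
  In \<open>SyncCompr \<chi>\<close> the variable y is index 0 of \<chi>, and in the body \<open>Le 0 1\<close> of the
  relativization u is index 0 and y is index 1.
\<close>

inductive rule_instance :: "rule \<Rightarrow> sequent list \<Rightarrow> sequent \<Rightarrow> bool" where
  "\<phi> \<in> set \<Gamma> \<Longrightarrow> rule_instance Ax [] (\<Gamma>, \<phi>)"
| "rule_instance Cut [(\<Gamma>, \<phi>), (\<Gamma> @ [\<phi>], \<psi>)] (\<Gamma>, \<psi>)"
| "rule_instance NegI [(\<Gamma> @ [\<phi>], Bot)] (\<Gamma>, Neg \<phi>)"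
| "rule_instance NegE [(\<Gamma>, \<phi>), (\<Gamma>, Neg \<phi>)] (\<Gamma>, Bot)"
| "rule_instance AndI [(\<Gamma>, \<phi>), (\<Gamma>, \<psi>)] (\<Gamma>, And \<phi> \<psi>)"
| "rule_instance AndE1 [(\<Gamma>, And \<phi> \<psi>)] (\<Gamma>, \<phi>)"
| "rule_instance AndE2 [(\<Gamma>, And \<phi> \<psi>)] (\<Gamma>, \<psi>)"
| "rule_instance (ExII t) [(\<Gamma>, insti t \<phi>)] (\<Gamma>, ExI \<phi>)"
| "fresh_i z (ExI \<phi> # \<psi> # \<Gamma>) \<Longrightarrow>
     rule_instance (ExIE z) [(\<Gamma>, ExI \<phi>), (\<Gamma> @ [insti z \<phi>], \<psi>)] (\<Gamma>, \<psi>)"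
| "rule_instance (ExPI Y) [(\<Gamma>, instp Y \<phi>)] (\<Gamma>, ExP \<phi>)"
| "fresh_p Z (ExP \<phi> # \<psi> # \<Gamma>) \<Longrightarrow>
     rule_instance (ExPE Z) [(\<Gamma>, ExP \<phi>), (\<Gamma> @ [instp Z \<phi>], \<psi>)] (\<Gamma>, \<psi>)"
| "rule_instance EqRefl [] (\<Gamma>, Eq x x)"
| "rule_instance (EqSubst x y z \<phi>) [(\<Gamma>, substi x y \<phi>), (\<Gamma>, Eq y z)] (\<Gamma>, substi x z \<phi>)"
| "rule_instance LeRefl [] (\<Gamma>, Le x x)"
| "rule_instance LeTrans [(\<Gamma>, Le x y), (\<Gamma>, Le y z)] (\<Gamma>, Le x z)"
| "rule_instance LeAntisym [(\<Gamma>, Le x y), (\<Gamma>, Le y x)] (\<Gamma>, Eq x y)"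
| "rule_instance ZeroEx [] (\<Gamma>, ExI (Zero 0))"
| "rule_instance ZeroUnique [(\<Gamma>, Zero x), (\<Gamma>, Zero y)] (\<Gamma>, Eq x y)"
| "rule_instance ScEx [] (\<Gamma>, ExI (Sc (Suc x) 0))"
| "rule_instance ScFun [(\<Gamma>, Sc x y), (\<Gamma>, Sc x z)] (\<Gamma>, Eq y z)"
| "rule_instance ScInj [(\<Gamma>, Sc x z), (\<Gamma>, Sc y z)] (\<Gamma>, Eq x y)"
| "rule_instance ScZero [(\<Gamma>, Sc x y), (\<Gamma>, Zero y)] (\<Gamma>, Bot)"
| "rule_instance ScLe [(\<Gamma>, Sc x y)] (\<Gamma>, Le x y)"
| "rule_instance LeSc [(\<Gamma>, Sc y y'), (\<Gamma>, Le x y'), (\<Gamma>, Neg (Eq x y'))] (\<Gamma>, Le x y)"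
| "rule_instance (NegCompr \<psi>) [(\<Gamma>, substp 0 \<psi> \<phi>)] (\<Gamma>, Neg (Neg (ExP \<phi>)))"
| "deterministic \<delta> \<Longrightarrow> y \<noteq> z \<Longrightarrow> fresh_i y (\<delta> # \<Gamma>) \<Longrightarrow> fresh_i z (\<delta> # \<Gamma>) \<Longrightarrow>
     rule_instance (Induct x y z)
       [(\<Gamma> @ [Zero z], substi x z \<delta>), (\<Gamma> @ [Sc y z, substi x y \<delta>], substi x z \<delta>)] (\<Gamma>, \<delta>)"
| "deterministic \<delta> \<Longrightarrow> rule_instance DNE [(\<Gamma>, Neg (Neg \<delta>))] (\<Gamma>, \<delta>)"
| "fvi (relativize (Le 0 1) \<chi>) \<subseteq> {0} \<Longrightarrow>
     rule_instance (SyncCompr \<chi>) [(\<Gamma>, substp 0 (relativize (Le 0 1) \<chi>) \<psi>)] (\<Gamma>, ExP \<psi>)"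

datatype deriv = Infer rule sequent "deriv list"

primrec endsequent :: "deriv \<Rightarrow> sequent" where
  "endsequent (Infer r s ds) = s"

inductive smso_derivation :: "deriv \<Rightarrow> bool" where
  "(\<forall>d\<in>set ds. smso_derivation d) \<Longrightarrow> rule_instance r (map endsequent ds) s \<Longrightarrow>
     smso_derivation (Infer r s ds)"


section \<open>Uniform automata\<close>

text \<open>Omega-regular languages over the alphabet \<open>Q\<close>: nondeterministic Buchi automata.\<close>

definition omega_regular :: "'a set \<Rightarrow> (nat \<Rightarrow> 'a) set \<Rightarrow> bool" where
  "omega_regular Q L \<longleftrightarrow>
     (\<exists>(S :: nat set) I T F. finite S \<and> I \<subseteq> S \<and> T \<subseteq> S \<times> Q \<times> S \<and> F \<subseteq> S \<and>
        L = {w. range w \<subseteq> Q \<and>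
               (\<exists>\<rho>. \<rho> 0 \<in> I \<and> (\<forall>n. (\<rho> n, w n, \<rho> (Suc n)) \<in> T) \<and> infinite {n. \<rho> n \<in> F})})"

text \<open>Elements of the move sets, which are built from 1 and {0,1} by products.\<close>

datatype move = Star | Bit bool | MPair move move

record 'a uaut =
  states :: "nat set"
  init :: nat
  moves :: "move set"
  step :: "nat \<Rightarrow> 'a \<Rightarrow> move \<Rightarrow> nat"
  accepting :: "(nat \<Rightarrow> nat) set"

definition uniform_automaton :: "'a set \<Rightarrow> 'a uaut \<Rightarrow> bool" where
  "uniform_automaton \<Sigma> A \<longleftrightarrow>
     finite (states A) \<and> init A \<in> states A \<and> finite (moves A) \<and> moves A \<noteq> {} \<and>
     (\<forall>q\<in>states A. \<forall>a\<in>\<Sigma>. \<forall>m\<in>moves A. step A q a m \<in> states A) \<and>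
     omega_regular (states A) (accepting A)"

primrec state_seq :: "'a uaut \<Rightarrow> (nat \<Rightarrow> 'a) \<Rightarrow> (nat \<Rightarrow> move) \<Rightarrow> nat \<Rightarrow> nat" where
  "state_seq A w R 0 = init A"
| "state_seq A w R (Suc k) = step A (state_seq A w R k) (w k) (R k)"

definition accepting_run :: "(nat \<Rightarrow> move) \<Rightarrow> 'a uaut \<Rightarrow> (nat \<Rightarrow> 'a) \<Rightarrow> bool" where
  "accepting_run R A w \<longleftrightarrow> range R \<subseteq> moves A \<and> state_seq A w R \<in> accepting A"

definition language :: "'a set \<Rightarrow> 'a uaut \<Rightarrow> (nat \<Rightarrow> 'a) set" where
  "language \<Sigma> A = {w. range w \<subseteq> \<Sigma> \<and> (\<exists>R. accepting_run R A w)}"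

definition sync_product :: "'a uaut \<Rightarrow> 'a uaut \<Rightarrow> 'a uaut" where
  "sync_product A B =
     \<lparr> states = prod_encode ` (states A \<times> states B),
       init = prod_encode (init A, init B),
       moves = {MPair m m' | m m'. m \<in> moves A \<and> m' \<in> moves B},
       step = (\<lambda>q a m. case (prod_decode q, m) of
                  ((p, p'), MPair m1 m2) \<Rightarrow> prod_encode (step A p a m1, step B p' a m2)
                | _ \<Rightarrow> q),
       accepting = {\<rho>. (\<lambda>n. fst (prod_decode (\<rho> n))) \<in> accepting A \<and>
                       (\<lambda>n. snd (prod_decode (\<rho> n))) \<in> accepting B} \<rparr>"


section \<open>Interpretation of formulae\<close>

type_synonym letter = "bool list \<times> bool list"

definition alphabet :: "nat \<Rightarrow> nat \<Rightarrow> letter set" where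
  "alphabet l p = {(xs, Xs). length xs = l \<and> length Xs = p}"

text \<open>The tuple of streams (k, \<sigma>) as a stream of tuples; a number k is the stream which is 1
  exactly at position k.\<close>

definition word :: "nat list \<Rightarrow> (nat \<Rightarrow> bool) list \<Rightarrow> nat \<Rightarrow> letter" where
  "word ks \<sigma>s n = (map (\<lambda>k. n = k) ks, map (\<lambda>\<sigma>. \<sigma> n) \<sigma>s)"

definition project_ind :: "letter uaut \<Rightarrow> letter uaut" where
  "project_ind A =
     A \<lparr> moves := {MPair (Bit b) m | b m. m \<in> moves A},
         step := (\<lambda>q (xs, Xs) m. case m of
                     MPair (Bit b) m' \<Rightarrow> step A q (b # xs, Xs) m' | _ \<Rightarrow> q) \<rparr>"

definition project_pred :: "letter uaut \<Rightarrow> letter uaut" where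
  "project_pred A =
     A \<lparr> moves := {MPair (Bit b) m | b m. m \<in> moves A},
         step := (\<lambda>q (xs, Xs) m. case m of
                     MPair (Bit b) m' \<Rightarrow> step A q (xs, b # Xs) m' | _ \<Rightarrow> q) \<rparr>"

definition det_automaton :: "nat \<Rightarrow> nat \<Rightarrow> letter uaut \<Rightarrow> bool" where
  "det_automaton l p A \<longleftrightarrow> uniform_automaton (alphabet l p) A \<and> moves A = {Star}"

definition atom_automaton ::
  "nat \<Rightarrow> nat \<Rightarrow> (nat list \<Rightarrow> (nat \<Rightarrow> bool) list \<Rightarrow> bool) \<Rightarrow> letter uaut \<Rightarrow> bool" where
  "atom_automaton l p P A \<longleftrightarrow> det_automaton l p A \<and>
     (\<forall>ks \<sigma>s. length ks = l \<and> length \<sigma>s = p \<longrightarrow>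
        (word ks \<sigma>s \<in> language (alphabet l p) A \<longleftrightarrow> P ks \<sigma>s))"

definition singleton_automaton :: "nat \<Rightarrow> nat \<Rightarrow> letter uaut \<Rightarrow> bool" where
  "singleton_automaton l p A \<longleftrightarrow> det_automaton (Suc l) p A \<and>
     language (alphabet (Suc l) p) A =
       {w. range w \<subseteq> alphabet (Suc l) p \<and> (\<exists>k. \<forall>n. hd (fst (w n)) \<longleftrightarrow> n = k)}"

text \<open>
  \<open>interp \<phi> l p A\<close>: A is an automaton I[\<phi>] over {0,1}^l \<times> {0,1}^p.  The automata for atoms and
  negations are only specified up to the words they accept, so this is a relation.  Variables
  bound by a quantifier are added at the front of the context, as index 0.
\<close>

primrec interp :: "form \<Rightarrow> nat \<Rightarrow> nat \<Rightarrow> letter uaut \<Rightarrow> bool" where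
  "interp (Eq x y) l p A = atom_automaton l p (\<lambda>ks \<sigma>s. ks ! x = ks ! y) A"
| "interp (Le x y) l p A = atom_automaton l p (\<lambda>ks \<sigma>s. ks ! x \<le> ks ! y) A"
| "interp (Sc x y) l p A = atom_automaton l p (\<lambda>ks \<sigma>s. ks ! y = Suc (ks ! x)) A"
| "interp (Zero x) l p A = atom_automaton l p (\<lambda>ks \<sigma>s. ks ! x = 0) A"
| "interp (Mem x X) l p A = atom_automaton l p (\<lambda>ks \<sigma>s. (\<sigma>s ! X) (ks ! x)) A"
| "interp Top l p A = atom_automaton l p (\<lambda>ks \<sigma>s. True) A"
| "interp Bot l p A = atom_automaton l p (\<lambda>ks \<sigma>s. False) A"
| "interp (And \<phi> \<psi>) l p A = (\<exists>B C. interp \<phi> l p B \<and> interp \<psi> l p C \<and> A = sync_product B C)"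
| "interp (Neg \<phi>) l p A =
     (\<exists>B. interp \<phi> l p B \<and> det_automaton l p A \<and>
        language (alphabet l p) A =
          {w. range w \<subseteq> alphabet l p \<and> w \<notin> language (alphabet l p) B})"
| "interp (ExI \<phi>) l p A =
     (\<exists>S B. singleton_automaton l p S \<and> interp \<phi> (Suc l) p B \<and>
        A = project_ind (sync_product S B))"
| "interp (ExP \<phi>) l p A = (\<exists>B. interp \<phi> l (Suc p) B \<and> A = project_pred B)"

text \<open>The move set M(\<phi>).\<close>

primrec M :: "form \<Rightarrow> move set" where
  "M (Eq x y) = {Star}"
| "M (Le x y) = {Star}"
| "M (Sc x y) = {Star}"
| "M (Zero x) = {Star}"
| "M (Mem x X) = {Star}"
| "M Top = {Star}"
| "M Bot = {Star}"
| "M (And \<phi> \<psi>) = {MPair m m' | m m'. m \<in> M \<phi> \<and> m' \<in> M \<psi>}"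
| "M (Neg \<phi>) = {Star}"
| "M (ExI \<phi>) = {MPair (Bit b) (MPair Star m) | b m. m \<in> M \<phi>}"
| "M (ExP \<phi>) = {MPair (Bit b) m | b m. m \<in> M \<phi>}"


section \<open>Finite-state synchronous functions\<close>

text \<open>Deterministic Mealy machines as finite objects: the transition function is a finite table.\<close>

record ('a, 'b) mealy =
  mstates :: "nat list"
  minit :: nat
  mtable :: "((nat \<times> 'a) \<times> (nat \<times> 'b)) list"

definition mtrans :: "('a, 'b) mealy \<Rightarrow> nat \<Rightarrow> 'a \<Rightarrow> nat \<times> 'b" where
  "mtrans m q a = the (map_of (mtable m) (q, a))"

definition mealy_machine :: "'a set \<Rightarrow> 'b set \<Rightarrow> ('a, 'b) mealy \<Rightarrow> bool" where
  "mealy_machine \<Sigma> \<Gamma> m \<longleftrightarrow>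
     minit m \<in> set (mstates m) \<and>
     (\<forall>q\<in>set (mstates m). \<forall>a\<in>\<Sigma>.
        \<exists>q'\<in>set (mstates m). \<exists>b\<in>\<Gamma>. map_of (mtable m) (q, a) = Some (q', b))"

primrec mstate_seq :: "('a, 'b) mealy \<Rightarrow> (nat \<Rightarrow> 'a) \<Rightarrow> nat \<Rightarrow> nat" where
  "mstate_seq m w 0 = minit m"
| "mstate_seq m w (Suc n) = fst (mtrans m (mstate_seq m w n) (w n))"

definition mealy_fun :: "('a, 'b) mealy \<Rightarrow> (nat \<Rightarrow> 'a) \<Rightarrow> nat \<Rightarrow> 'b" where
  "mealy_fun m w n = snd (mtrans m (mstate_seq m w n) (w n))"


section \<open>Realizability\<close>

type_synonym input = "bool list \<times> bool list \<times> move list \<times> move list"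

text \<open>The alphabet {0,1}^l \<times> {0,1}^p \<times> 1^l \<times> M(\<phi>1) \<times> ... \<times> M(\<phi>n).\<close>

definition inputs :: "nat \<Rightarrow> nat \<Rightarrow> form list \<Rightarrow> input set" where
  "inputs l p \<Gamma> =
     {(xs, Xs, us, ms). length xs = l \<and> length Xs = p \<and> us = replicate l Star \<and>
        list_all2 (\<lambda>m \<phi>. m \<in> M \<phi>) ms \<Gamma>}"

definition input_stream ::
  "nat list \<Rightarrow> (nat \<Rightarrow> bool) list \<Rightarrow> (nat \<Rightarrow> move) list \<Rightarrow> nat \<Rightarrow> input" where
  "input_stream ks \<sigma>s Rs n =
     (map (\<lambda>k. n = k) ks, map (\<lambda>\<sigma>. \<sigma> n) \<sigma>s, replicate (length ks) Star, map (\<lambda>R. R n) Rs)"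

definition realizes ::
  "nat \<Rightarrow> nat \<Rightarrow> form list \<Rightarrow> ((nat \<Rightarrow> input) \<Rightarrow> nat \<Rightarrow> move) \<Rightarrow> form \<Rightarrow> bool" where
  "realizes l p \<Gamma> F \<phi> \<longleftrightarrow>
     (\<forall>As A. list_all2 (\<lambda>\<psi> B. interp \<psi> l p B) \<Gamma> As \<and> interp \<phi> l p A \<longrightarrow>
        (\<forall>ks \<sigma>s Rs. length ks = l \<and> length \<sigma>s = p \<and>
             list_all2 (\<lambda>R B. accepting_run R B (word ks \<sigma>s)) Rs As \<longrightarrow>
           accepting_run (F (input_stream ks \<sigma>s Rs)) A (word ks \<sigma>s)))"


section \<open>Computability\<close>

text \<open>Kleene's partial recursive functions and their graphs.\<close>

datatype recf =
    Zero_fn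
  | Suc_fn
  | Proj nat
  | Comp recf "recf list"
  | PrimRec recf recf
  | Mu recf

inductive computes :: "recf \<Rightarrow> nat list \<Rightarrow> nat \<Rightarrow> bool" where
  "computes Zero_fn xs 0"
| "computes Suc_fn [x] (Suc x)"
| "i < length xs \<Longrightarrow> computes (Proj i) xs (xs ! i)"
| "length ys = length gs \<Longrightarrow> (\<forall>i<length gs. computes (gs ! i) xs (ys ! i)) \<Longrightarrow>
     computes f ys z \<Longrightarrow> computes (Comp f gs) xs z"
| "computes f xs z \<Longrightarrow> computes (PrimRec f g) (0 # xs) z"
| "computes (PrimRec f g) (n # xs) y \<Longrightarrow> computes g (n # y # xs) z \<Longrightarrow>
     computes (PrimRec f g) (Suc n # xs) z"
| "computes f (n # xs) 0 \<Longrightarrow> (\<forall>i<n. \<exists>y. computes f (i # xs) (Suc y)) \<Longrightarrow>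
     computes (Mu f) xs n"

text \<open>Goedel numberings of derivations and of Mealy machines.\<close>

primrec code_form :: "form \<Rightarrow> nat" where
  "code_form (Eq x y) = list_encode [0, x, y]"
| "code_form (Le x y) = list_encode [1, x, y]"
| "code_form (Sc x y) = list_encode [2, x, y]"
| "code_form (Zero x) = list_encode [3, x]"
| "code_form (Mem x X) = list_encode [4, x, X]"
| "code_form Top = list_encode [5]"
| "code_form Bot = list_encode [6]"
| "code_form (And \<phi> \<psi>) = list_encode [7, code_form \<phi>, code_form \<psi>]"
| "code_form (Neg \<phi>) = list_encode [8, code_form \<phi>]"
| "code_form (ExI \<phi>) = list_encode [9, code_form \<phi>]"
| "code_form (ExP \<phi>) = list_encode [10, code_form \<phi>]"

primrec code_rule :: "rule \<Rightarrow> nat" where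
  "code_rule Ax = list_encode [0]"
| "code_rule Cut = list_encode [1]"
| "code_rule NegI = list_encode [2]"
| "code_rule NegE = list_encode [3]"
| "code_rule AndI = list_encode [4]"
| "code_rule AndE1 = list_encode [5]"
| "code_rule AndE2 = list_encode [6]"
| "code_rule (ExII t) = list_encode [7, t]"
| "code_rule (ExIE z) = list_encode [8, z]"
| "code_rule (ExPI Y) = list_encode [9, Y]"
| "code_rule (ExPE Z) = list_encode [10, Z]"
| "code_rule EqRefl = list_encode [11]"
| "code_rule (EqSubst x y z \<phi>) = list_encode [12, x, y, z, code_form \<phi>]"
| "code_rule LeRefl = list_encode [13]"
| "code_rule LeTrans = list_encode [14]"
| "code_rule LeAntisym = list_encode [15]"
| "code_rule ZeroEx = list_encode [16]"
| "code_rule ZeroUnique = list_encode [17]"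
| "code_rule ScEx = list_encode [18]"
| "code_rule ScFun = list_encode [19]"
| "code_rule ScInj = list_encode [20]"
| "code_rule ScZero = list_encode [21]"
| "code_rule ScLe = list_encode [22]"
| "code_rule LeSc = list_encode [23]"
| "code_rule (NegCompr \<psi>) = list_encode [24, code_form \<psi>]"
| "code_rule (Induct x y z) = list_encode [25, x, y, z]"
| "code_rule DNE = list_encode [26]"
| "code_rule (SyncCompr \<chi>) = list_encode [27, code_form \<chi>]"

definition code_sequent :: "sequent \<Rightarrow> nat" where
  "code_sequent s = list_encode [list_encode (map code_form (fst s)), code_form (snd s)]"

primrec code_deriv :: "deriv \<Rightarrow> nat" where
  "code_deriv (Infer r s ds) =
     list_encode [code_rule r, code_sequent s, list_encode (map code_deriv ds)]"

primrec code_move :: "move \<Rightarrow> nat" where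
  "code_move Star = list_encode [0]"
| "code_move (Bit b) = list_encode [1, of_bool b]"
| "code_move (MPair m m') = list_encode [2, code_move m, code_move m']"

fun code_input :: "input \<Rightarrow> nat" where
  "code_input (xs, Xs, us, ms) =
     list_encode [list_encode (map of_bool xs), list_encode (map of_bool Xs),
                  list_encode (map code_move us), list_encode (map code_move ms)]"

definition code_mealy :: "(input, move) mealy \<Rightarrow> nat" where
  "code_mealy m =
     list_encode [list_encode (mstates m), minit m,
       list_encode (map (\<lambda>((q, a), (q', b)). list_encode [q, code_input a, q', code_move b])
                        (mtable m))]"

end

theory Submission
  imports Defs "HOL-Library.More_List"
begin

text \<open>
  A derivation is turned into a Mealy machine by recursion: the rules of intuitionistic logic
  translate into composition, pairing and projection of machines.  The rules with a deterministic
  conclusion need no computation, since the runs of a deterministic formula carry no information: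
  there the validity of the rules in the standard model suffices.  The only rule that needs a
  genuine construction is synchronous comprehension.  There the witness is defined by a formula in
  which all individuals are bounded by the current position, so its value is computed by a finite
  automaton reading the word seen so far.

  Correctness does not mention automata on infinite words: whether a run of an interpretation of
  \<phi> is accepting depends only on a predicate defined by recursion on \<phi>, which says that the run
  contains true witnesses.

  For computability, a function on encoded data that is defined by recursion in terms of computable
  functions has as its graph the least fixed point of an enumeration operator, which is
  semidecidable by Kleene's first recursion theorem.
\<close>

section \<open>Recursive functions\<close>

definition recursive_nary :: "nat \<Rightarrow> (nat list \<Rightarrow> nat) \<Rightarrow> bool" where
  "recursive_nary k f \<longleftrightarrow> (\<exists>r. \<forall>xs. length xs = k \<longrightarrow> computes r xs (f xs))"

lemma recursive_naryI:
  assumes "\<And>xs. length xs = k \<Longrightarrow> computes r xs (f xs)"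
  shows "recursive_nary k f"
  using assms unfolding recursive_nary_def by blast

lemma recursive_naryE:
  assumes "recursive_nary k f"
  obtains r where "\<And>xs. length xs = k \<Longrightarrow> computes r xs (f xs)"
  using assms unfolding recursive_nary_def by blast

lemma recursive_nary_nth: "i < k \<Longrightarrow> recursive_nary k (\<lambda>xs. xs ! i)"
  by (rule recursive_naryI[where r = "Proj i"]) (simp add: computes.intros(3))

lemma recursive_nary_comp:
  assumes f: "recursive_nary (length gs) f" and gs: "\<And>g. g \<in> set gs \<Longrightarrow> recursive_nary k g"
  shows "recursive_nary k (\<lambda>xs. f (map (\<lambda>g. g xs) gs))"
proof -
  obtain r where r: "\<And>ys. length ys = length gs \<Longrightarrow> computes r ys (f ys)"
    using recursive_naryE[OF f] by blast
  have "\<forall>g\<in>set gs. \<exists>s. \<forall>xs. length xs = k \<longrightarrow> computes s xs (g xs)"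
    using gs unfolding recursive_nary_def by blast
  then obtain s where s: "\<And>g xs. g \<in> set gs \<Longrightarrow> length xs = k \<Longrightarrow> computes (s g) xs (g xs)"
    unfolding bchoice_iff by blast
  show ?thesis
  proof (rule recursive_naryI)
    fix xs :: "nat list"
    assume "length xs = k"
    then show "computes (Comp r (map s gs)) xs (f (map (\<lambda>g. g xs) gs))"
      by (intro computes.intros(4)[OF _ _ r]) (simp_all add: s)
  qed
qed

lemma recursive_nary_comp1:
  assumes "recursive_nary 1 (\<lambda>ys. f (ys ! 0))" "recursive_nary k g"
  shows "recursive_nary k (\<lambda>xs. f (g xs))"
  using recursive_nary_comp[of "[g]" "\<lambda>ys. f (ys ! 0)" k] assms by simp

lemma recursive_nary_comp2:
  assumes "recursive_nary 2 (\<lambda>ys. f (ys ! 0) (ys ! 1))" "recursive_nary k g" "recursive_nary k h"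
  shows "recursive_nary k (\<lambda>xs. f (g xs) (h xs))"
  using recursive_nary_comp[of "[g, h]" "\<lambda>ys. f (ys ! 0) (ys ! 1)" k] assms
  by (auto simp: numeral_2_eq_2)

lemma recursive_nary_Suc: "recursive_nary k f \<Longrightarrow> recursive_nary k (\<lambda>xs. Suc (f xs))"
proof (rule recursive_nary_comp1[where f = Suc])
  show "recursive_nary 1 (\<lambda>ys. Suc (ys ! 0))"
    by (rule recursive_naryI) (auto simp: length_Suc_conv intro: computes.intros(2))
qed

lemma recursive_nary_const: "recursive_nary k (\<lambda>xs. c)"
proof (induction c)
  case 0
  show ?case by (rule recursive_naryI) (rule computes.intros(1))
next
  case (Suc c)
  then show ?case by (rule recursive_nary_Suc)
qed

lemma recursive_nary_rec_nat:
  assumes f: "recursive_nary k f" and g: "recursive_nary (Suc (Suc k)) g"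
  shows "recursive_nary (Suc k) (\<lambda>xs. rec_nat (f (tl xs)) (\<lambda>n y. g (n # y # tl xs)) (xs ! 0))"
proof -
  obtain r s where r: "\<And>xs. length xs = k \<Longrightarrow> computes r xs (f xs)"
    and s: "\<And>xs. length xs = Suc (Suc k) \<Longrightarrow> computes s xs (g xs)"
    using recursive_naryE[OF f] recursive_naryE[OF g] by metis
  have "computes (PrimRec r s) (n # xs) (rec_nat (f xs) (\<lambda>n y. g (n # y # xs)) n)"
    if "length xs = k" for n xs
    using that
  proof (induction n)
    case 0
    then show ?case by (auto intro: computes.intros(5) r)
  next
    case (Suc n)
    then show ?case using computes.intros(6)[OF Suc.IH[OF Suc.prems] s] by simp
  qed
  then show ?thesis
    by (intro recursive_naryI[where r = "PrimRec r s"]) (auto simp: length_Suc_conv)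
qed

lemma recursive_nary_rec_nat_param:
  assumes "recursive_nary 1 (\<lambda>xs. f (xs ! 0))"
    and "recursive_nary 3 (\<lambda>xs. g (xs ! 0) (xs ! 1) (xs ! 2))"
    and "recursive_nary k n" and "recursive_nary k e"
  shows "recursive_nary k (\<lambda>xs. rec_nat (f (e xs)) (\<lambda>i y. g i y (e xs)) (n xs))"
proof (rule recursive_nary_comp2[where f = "\<lambda>n e. rec_nat (f e) (\<lambda>i y. g i y e) n"])
  have "rec_nat (f (tl xs ! 0)) (\<lambda>i y. g i y (tl xs ! 0)) (xs ! 0) =
      rec_nat (f (xs ! 1)) (\<lambda>i y. g i y (xs ! 1)) (xs ! 0)" if "length xs = 2" for xs
    using that by (auto simp: length_Suc_conv numeral_2_eq_2)
  then show "recursive_nary 2 (\<lambda>xs. rec_nat (f (xs ! 1)) (\<lambda>i y. g i y (xs ! 1)) (xs ! 0))"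
    using recursive_nary_rec_nat[OF assms(1), of "\<lambda>xs. g (xs ! 0) (xs ! 1) (xs ! 2)"] assms(2)
    by (simp add: recursive_nary_def numeral_2_eq_2 numeral_3_eq_3)
qed (use assms in auto)

lemma computes_Least:
  assumes r: "\<And>n. computes r (n # xs) (f n)" and zero: "f n = 0"
  shows "computes (Mu r) xs (LEAST n. f n = 0)"
proof (rule computes.intros(7))
  let ?n = "LEAST n. f n = 0"
  have "f ?n = 0" using zero by (rule LeastI)
  then show "computes r (?n # xs) 0" using r[of ?n] by simp
  show "\<forall>i<?n. \<exists>y. computes r (i # xs) (Suc y)"
  proof (intro allI impI)
    fix i
    assume "i < ?n"
    then have "f i \<noteq> 0" by (rule not_less_Least)
    then show "\<exists>y. computes r (i # xs) (Suc y)" using r[of i] by (auto simp: gr0_conv_Suc)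
  qed
qed

lemma recursive_nary_Least:
  assumes f: "recursive_nary (Suc k) f" and ex: "\<And>xs. length xs = k \<Longrightarrow> \<exists>n. f (n # xs) = 0"
  shows "recursive_nary k (\<lambda>xs. LEAST n. f (n # xs) = 0)"
proof -
  obtain r where r: "\<And>xs. length xs = Suc k \<Longrightarrow> computes r xs (f xs)"
    using recursive_naryE[OF f] by blast
  show ?thesis
  proof (rule recursive_naryI)
    fix xs :: "nat list"
    assume xs: "length xs = k"
    then obtain n where "f (n # xs) = 0" using ex by blast
    then show "computes (Mu r) xs (LEAST n. f (n # xs) = 0)"
      using r xs by (intro computes_Least) auto
  qed
qed

lemma recursive_nary_add:
  assumes "recursive_nary k f" "recursive_nary k g"
  shows "recursive_nary k (\<lambda>xs. f xs + g xs)"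
proof -
  have "recursive_nary k (\<lambda>xs. rec_nat (g xs) (\<lambda>i y. Suc y) (f xs))"
    using assms by (intro recursive_nary_rec_nat_param[where g = "\<lambda>i y e. Suc y"]
        recursive_nary_Suc recursive_nary_nth) auto
  moreover have "rec_nat n (\<lambda>i. Suc) m = m + n" for m n by (induction m) auto
  ultimately show ?thesis by simp
qed

lemma recursive_nary_pred:
  assumes "recursive_nary k f"
  shows "recursive_nary k (\<lambda>xs. f xs - 1)"
proof -
  have "recursive_nary k (\<lambda>xs. rec_nat 0 (\<lambda>i y. i) (f xs))"
    using assms by (intro recursive_nary_rec_nat_param[where f = "\<lambda>e. 0" and g = "\<lambda>i y e. i"]
        recursive_nary_const recursive_nary_nth) auto
  moreover have "rec_nat 0 (\<lambda>i y. i) m = m - 1" for m :: nat by (cases m) auto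
  ultimately show ?thesis by simp
qed

lemma recursive_nary_diff:
  assumes "recursive_nary k f" "recursive_nary k g"
  shows "recursive_nary k (\<lambda>xs. f xs - g xs)"
proof -
  have "recursive_nary k (\<lambda>xs. rec_nat (f xs) (\<lambda>i y. y - 1) (g xs))"
    using assms by (intro recursive_nary_rec_nat_param[where g = "\<lambda>i y e. y - 1"]
        recursive_nary_pred recursive_nary_nth) auto
  moreover have "rec_nat m (\<lambda>i y. y - 1) n = m - n" for m n :: nat by (induction n) auto
  ultimately show ?thesis by simp
qed

lemma recursive_nary_triangle:
  assumes "recursive_nary k f"
  shows "recursive_nary k (\<lambda>xs. triangle (f xs))"
proof -
  have "recursive_nary k (\<lambda>xs. rec_nat 0 (\<lambda>i y. y + Suc i) (f xs))"
    using assms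
    by (intro recursive_nary_rec_nat_param[where f = "\<lambda>e. 0" and g = "\<lambda>i y e. y + Suc i"]
        recursive_nary_const recursive_nary_add recursive_nary_Suc recursive_nary_nth) auto
  moreover have "rec_nat 0 (\<lambda>i y. y + Suc i) m = triangle m" for m by (induction m) auto
  ultimately show ?thesis by simp
qed

abbreviation pair_code :: "nat \<Rightarrow> nat \<Rightarrow> nat" ("\<langle>_,/ _\<rangle>") where
  "\<langle>a, b\<rangle> \<equiv> prod_encode (a, b)"

definition pfst :: "nat \<Rightarrow> nat" where "pfst n = fst (prod_decode n)"

definition psnd :: "nat \<Rightarrow> nat" where "psnd n = snd (prod_decode n)"

lemma pfst_pair [simp]: "pfst \<langle>a, b\<rangle> = a" by (simp add: pfst_def)

lemma psnd_pair [simp]: "psnd \<langle>a, b\<rangle> = b" by (simp add: psnd_def)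

lemma pair_pfst_psnd [simp]: "\<langle>pfst n, psnd n\<rangle> = n" by (simp add: pfst_def psnd_def)

lemma recursive_nary_pair:
  "recursive_nary k f \<Longrightarrow> recursive_nary k g \<Longrightarrow> recursive_nary k (\<lambda>xs. \<langle>f xs, g xs\<rangle>)"
  unfolding prod_encode_def by (simp add: recursive_nary_add recursive_nary_triangle)

lemma pfst_conv_triangle: "pfst n = n - triangle (pfst n + psnd n)"
proof -
  have "triangle (pfst n + psnd n) + pfst n = \<langle>pfst n, psnd n\<rangle>"
    by (simp only: prod_encode_def prod.case)
  then have "triangle (pfst n + psnd n) + pfst n = n" by simp
  then show ?thesis by linarith
qed

lemma diagonal_conv_Least: "pfst n + psnd n = (LEAST s. Suc n - triangle (Suc s) = 0)"
proof -
  obtain a b where n: "n = \<langle>a, b\<rangle>" by (metis pair_pfst_psnd)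
  have "a + b \<le> s" if "Suc n - triangle (Suc s) = 0" for s
  proof (rule ccontr)
    assume "\<not> a + b \<le> s"
    then have "triangle (Suc s) \<le> triangle (a + b)"
      unfolding triangle_def by (intro div_le_mono mult_le_mono) auto
    then show False using that by (simp add: n prod_encode_def)
  qed
  then show ?thesis
    by (intro Least_equality[symmetric]) (simp_all add: n, simp add: prod_encode_def)
qed

lemma recursive_nary_pfst_psnd:
  assumes "recursive_nary k f"
  shows "recursive_nary k (\<lambda>xs. pfst (f xs))" "recursive_nary k (\<lambda>xs. psnd (f xs))"
proof -
  have "recursive_nary 1 (\<lambda>xs. LEAST s. Suc ((s # xs) ! 1) - triangle (Suc ((s # xs) ! 0)) = 0)"
  proof (rule recursive_nary_Least)
    show "recursive_nary (Suc 1) (\<lambda>ys. Suc (ys ! 1) - triangle (Suc (ys ! 0)))"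
      by (intro recursive_nary_diff recursive_nary_Suc recursive_nary_triangle recursive_nary_nth)
        auto
    show "\<exists>s. Suc ((s # xs) ! 1) - triangle (Suc ((s # xs) ! 0)) = 0" for xs
      by (rule exI[of _ "xs ! 0"]) simp
  qed
  then have "recursive_nary 1 (\<lambda>xs. pfst (xs ! 0) + psnd (xs ! 0))"
    by (simp add: diagonal_conv_Least)
  from recursive_nary_comp1[OF this assms]
  have diagonal: "recursive_nary k (\<lambda>xs. pfst (f xs) + psnd (f xs))" .
  have "recursive_nary k (\<lambda>xs. f xs - triangle (pfst (f xs) + psnd (f xs)))"
    by (intro recursive_nary_diff recursive_nary_triangle diagonal assms)
  then show "recursive_nary k (\<lambda>xs. pfst (f xs))"
    by (simp flip: pfst_conv_triangle)
  from recursive_nary_diff[OF diagonal this]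
  show "recursive_nary k (\<lambda>xs. psnd (f xs))" by simp
qed

definition recursive :: "(nat \<Rightarrow> nat) \<Rightarrow> bool" where
  "recursive f \<longleftrightarrow> recursive_nary 1 (\<lambda>xs. f (xs ! 0))"

lemma recursive_id: "recursive (\<lambda>x. x)"
  by (simp add: recursive_def recursive_nary_nth)

lemma recursive_comp: "recursive f \<Longrightarrow> recursive g \<Longrightarrow> recursive (\<lambda>x. f (g x))"
  unfolding recursive_def by (rule recursive_nary_comp1)

lemma recursive_const: "recursive (\<lambda>x. c)"
  by (simp add: recursive_def recursive_nary_const)

lemma recursive_Suc: "recursive f \<Longrightarrow> recursive (\<lambda>x. Suc (f x))"
  by (simp add: recursive_def recursive_nary_Suc)

lemma recursive_add: "recursive f \<Longrightarrow> recursive g \<Longrightarrow> recursive (\<lambda>x. f x + g x)"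
  by (simp add: recursive_def recursive_nary_add)

lemma recursive_diff: "recursive f \<Longrightarrow> recursive g \<Longrightarrow> recursive (\<lambda>x. f x - g x)"
  by (simp add: recursive_def recursive_nary_diff)

lemma recursive_pair: "recursive f \<Longrightarrow> recursive g \<Longrightarrow> recursive (\<lambda>x. \<langle>f x, g x\<rangle>)"
  by (simp add: recursive_def recursive_nary_pair)

lemma recursive_pfst: "recursive f \<Longrightarrow> recursive (\<lambda>x. pfst (f x))"
  by (simp add: recursive_def recursive_nary_pfst_psnd)

lemma recursive_psnd: "recursive f \<Longrightarrow> recursive (\<lambda>x. psnd (f x))"
  by (simp add: recursive_def recursive_nary_pfst_psnd)

lemma recursive_rec_nat:
  assumes f: "recursive f" and g: "recursive (\<lambda>x. g (pfst x) (pfst (psnd x)) (psnd (psnd x)))"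
    and n: "recursive n" and e: "recursive e"
  shows "recursive (\<lambda>x. rec_nat (f (e x)) (\<lambda>i y. g i y (e x)) (n x))"
proof -
  have "recursive_nary 3 (\<lambda>xs. \<langle>xs ! 0, \<langle>xs ! 1, xs ! 2\<rangle>\<rangle>)"
    by (intro recursive_nary_pair recursive_nary_nth) auto
  from recursive_nary_comp1[OF g[unfolded recursive_def] this]
  have "recursive_nary 3 (\<lambda>xs. g (xs ! 0) (xs ! 1) (xs ! 2))" by simp
  then show ?thesis
    using assms unfolding recursive_def by (intro recursive_nary_rec_nat_param)
qed

lemmas recursive_intros = recursive_id recursive_const recursive_Suc recursive_add recursive_diff
  recursive_pair recursive_pfst recursive_psnd

subsection \<open>Decidable and semidecidable predicates\<close>

definition decidable :: "(nat \<Rightarrow> bool) \<Rightarrow> bool" where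
  "decidable P \<longleftrightarrow> recursive (\<lambda>x. of_bool (P x))"

lemma decidable_comp: "decidable P \<Longrightarrow> recursive f \<Longrightarrow> decidable (\<lambda>x. P (f x))"
  unfolding decidable_def by (rule recursive_comp)

lemma decidable_not: "decidable P \<Longrightarrow> decidable (\<lambda>x. \<not> P x)"
proof -
  assume "decidable P"
  then have "recursive (\<lambda>x. 1 - of_bool (P x))" unfolding decidable_def by (intro recursive_intros)
  moreover have "1 - of_bool (P x) = (of_bool (\<not> P x) :: nat)" for x by simp
  ultimately show ?thesis by (simp add: decidable_def)
qed

lemma decidable_conj: "decidable P \<Longrightarrow> decidable Q \<Longrightarrow> decidable (\<lambda>x. P x \<and> Q x)"
proof -
  assume "decidable P" "decidable Q"
  then have "recursive (\<lambda>x. of_bool (P x) + of_bool (Q x) - 1)"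
    unfolding decidable_def by (intro recursive_intros)
  moreover have "of_bool (P x) + of_bool (Q x) - 1 = (of_bool (P x \<and> Q x) :: nat)" for x by simp
  ultimately show ?thesis by (simp add: decidable_def)
qed

lemma decidable_disj: "decidable P \<Longrightarrow> decidable Q \<Longrightarrow> decidable (\<lambda>x. P x \<or> Q x)"
  using decidable_not[OF decidable_conj[OF decidable_not decidable_not], of P Q] by simp

lemma decidable_eq: "recursive f \<Longrightarrow> recursive g \<Longrightarrow> decidable (\<lambda>x. f x = g x)"
proof -
  assume "recursive f" "recursive g"
  then have "recursive (\<lambda>x. 1 - ((f x - g x) + (g x - f x)))" by (intro recursive_intros)
  moreover have "1 - ((f x - g x) + (g x - f x)) = of_bool (f x = g x)" for x by simp
  ultimately show ?thesis by (simp add: decidable_def)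
qed

lemma recursive_if:
  assumes "decidable c" "recursive f" "recursive g"
  shows "recursive (\<lambda>x. if c x then f x else g x)"
proof -
  have "recursive (\<lambda>x. rec_nat (psnd (\<langle>f x, g x\<rangle>)) (\<lambda>i y. pfst (\<langle>f x, g x\<rangle>)) (of_bool (c x)))"
    using assms unfolding decidable_def
    by (intro recursive_rec_nat[of psnd "\<lambda>i y e. pfst e"] recursive_intros)
  moreover have "rec_nat (psnd (\<langle>f x, g x\<rangle>)) (\<lambda>i y. pfst (\<langle>f x, g x\<rangle>)) (of_bool (c x)) =
      (if c x then f x else g x)" for x
    by simp
  ultimately show ?thesis by simp
qed

lemma decidable_Ex_less:
  assumes "decidable (\<lambda>z. P (pfst z) (psnd z))" "recursive b"
  shows "decidable (\<lambda>x. \<exists>i<b x. P i x)"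
proof -
  let ?search = "\<lambda>x. rec_nat 0 (\<lambda>i y. if P i x then 1 else y :: nat)"
  have "recursive (\<lambda>z. if P (pfst z) (psnd (psnd z)) then 1 else pfst (psnd z))"
    using decidable_comp[OF assms(1), of "\<lambda>z. \<langle>pfst z, psnd (psnd z)\<rangle>"]
    by (intro recursive_if recursive_intros) (simp add: recursive_intros)
  then have "recursive (\<lambda>x. ?search x (b x))"
    by (intro recursive_rec_nat[of "\<lambda>e. 0" "\<lambda>i y e. if P i e then 1 else y"]
        recursive_intros assms(2))
  moreover have "?search x n = of_bool (\<exists>i<n. P i x)" for x n
    by (induction n) (auto simp: less_Suc_eq)
  ultimately show ?thesis by (simp add: decidable_def)
qed

lemma decidable_All_less:
  assumes "decidable (\<lambda>z. P (pfst z) (psnd z))" "recursive b"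
  shows "decidable (\<lambda>x. \<forall>i<b x. P i x)"
  using decidable_not[OF decidable_Ex_less[OF decidable_not[OF assms(1)] assms(2)]] by simp

definition semidecidable :: "(nat \<Rightarrow> bool) \<Rightarrow> bool" where
  "semidecidable P \<longleftrightarrow> (\<exists>Q. decidable Q \<and> (\<forall>x. P x \<longleftrightarrow> (\<exists>n. Q \<langle>n, x\<rangle>)))"

lemma semidecidableI:
  assumes "decidable Q" "\<And>x. P x \<longleftrightarrow> (\<exists>n. Q \<langle>n, x\<rangle>)"
  shows "semidecidable P"
  using assms unfolding semidecidable_def by blast

lemma semidecidableE:
  assumes "semidecidable P"
  obtains Q where "decidable Q" "\<And>x. P x \<longleftrightarrow> (\<exists>n. Q \<langle>n, x\<rangle>)"
  using assms unfolding semidecidable_def by blast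

lemma decidable_imp_semidecidable: "decidable P \<Longrightarrow> semidecidable P"
  by (rule semidecidableI[of "\<lambda>z. P (psnd z)"]) (simp_all add: decidable_comp recursive_intros)

lemma semidecidable_comp:
  assumes "semidecidable P" "recursive f"
  shows "semidecidable (\<lambda>x. P (f x))"
proof (rule semidecidableE[OF assms(1)])
  fix Q
  assume Q: "decidable Q" "\<And>x. P x \<longleftrightarrow> (\<exists>n. Q \<langle>n, x\<rangle>)"
  show ?thesis
    by (rule semidecidableI[of "\<lambda>z. Q \<langle>pfst z, f (psnd z)\<rangle>"])
      (simp_all add: Q decidable_comp[OF Q(1)] recursive_comp[OF assms(2)] recursive_intros)
qed

lemma semidecidable_conj:
  assumes "semidecidable P" "semidecidable Q"
  shows "semidecidable (\<lambda>x. P x \<and> Q x)"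
proof -
  obtain P' Q' where P': "decidable P'" "\<And>x. P x \<longleftrightarrow> (\<exists>n. P' \<langle>n, x\<rangle>)"
    and Q': "decidable Q'" "\<And>x. Q x \<longleftrightarrow> (\<exists>n. Q' \<langle>n, x\<rangle>)"
    using semidecidableE[OF assms(1)] semidecidableE[OF assms(2)] by metis
  let ?R = "\<lambda>z. P' \<langle>pfst (pfst z), psnd z\<rangle> \<and> Q' \<langle>psnd (pfst z), psnd z\<rangle>"
  show ?thesis
  proof (rule semidecidableI[of ?R])
    show "decidable ?R"
      by (intro decidable_conj decidable_comp[OF P'(1)] decidable_comp[OF Q'(1)] recursive_intros)
    show "P x \<and> Q x \<longleftrightarrow> (\<exists>n. ?R \<langle>n, x\<rangle>)" for x
      unfolding P' Q' by (metis pfst_pair psnd_pair)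
  qed
qed

lemma semidecidable_disj:
  assumes "semidecidable P" "semidecidable Q"
  shows "semidecidable (\<lambda>x. P x \<or> Q x)"
proof -
  obtain P' Q' where P': "decidable P'" "\<And>x. P x \<longleftrightarrow> (\<exists>n. P' \<langle>n, x\<rangle>)"
    and Q': "decidable Q'" "\<And>x. Q x \<longleftrightarrow> (\<exists>n. Q' \<langle>n, x\<rangle>)"
    using semidecidableE[OF assms(1)] semidecidableE[OF assms(2)] by metis
  show ?thesis
    by (rule semidecidableI[of "\<lambda>z. P' z \<or> Q' z"])
      (auto simp: P' Q' intro: decidable_disj P'(1) Q'(1))
qed

lemma semidecidable_Ex:
  assumes "semidecidable (\<lambda>z. P (pfst z) (psnd z))"
  shows "semidecidable (\<lambda>x. \<exists>y. P y x)"
proof (rule semidecidableE[OF assms])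
  fix Q
  assume Q: "decidable Q" "\<And>z. P (pfst z) (psnd z) \<longleftrightarrow> (\<exists>n. Q \<langle>n, z\<rangle>)"
  let ?R = "\<lambda>z. Q \<langle>pfst (pfst z), \<langle>psnd (pfst z), psnd z\<rangle>\<rangle>"
  show ?thesis
  proof (rule semidecidableI[of ?R])
    show "decidable ?R" by (intro decidable_comp[OF Q(1)] recursive_intros)
    have "P y x \<longleftrightarrow> (\<exists>n. Q \<langle>n, \<langle>y, x\<rangle>\<rangle>)" for y x using Q(2)[of "\<langle>y, x\<rangle>"] by simp
    then show "(\<exists>y. P y x) \<longleftrightarrow> (\<exists>n. ?R \<langle>n, x\<rangle>)" for x by (metis pfst_pair psnd_pair)
  qed
qed

lemma semidecidable_All_less:
  assumes "semidecidable (\<lambda>z. P (pfst z) (psnd z))" "recursive b"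
  shows "semidecidable (\<lambda>x. \<forall>i<b x. P i x)"
proof (rule semidecidableE[OF assms(1)])
  fix Q
  assume Q: "decidable Q" "\<And>z. P (pfst z) (psnd z) \<longleftrightarrow> (\<exists>n. Q \<langle>n, z\<rangle>)"
  have P: "P i x \<longleftrightarrow> (\<exists>n. Q \<langle>n, \<langle>i, x\<rangle>\<rangle>)" for i x using Q(2)[of "\<langle>i, x\<rangle>"] by simp
  let ?R = "\<lambda>z. \<forall>i<b (psnd z). \<exists>n<pfst z. Q \<langle>n, \<langle>i, psnd z\<rangle>\<rangle>"
  show ?thesis
  proof (rule semidecidableI[of ?R])
    show "decidable ?R"
      by (intro decidable_All_less decidable_Ex_less decidable_comp[OF Q(1)]
          recursive_comp[OF assms(2)] recursive_intros)
    have "\<exists>N. \<forall>i<b x. \<exists>n<N. Q \<langle>n, \<langle>i, x\<rangle>\<rangle>" if "\<forall>i<b x. P i x" for x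
    proof -
      have "\<forall>i\<in>{..<b x}. \<exists>n. Q \<langle>n, \<langle>i, x\<rangle>\<rangle>" using that P by simp
      then obtain w where "\<And>i. i < b x \<Longrightarrow> Q \<langle>w i, \<langle>i, x\<rangle>\<rangle>" unfolding bchoice_iff by auto
      moreover have "w i < Suc (\<Sum>i<b x. w i)" if "i < b x" for i
        using that by (simp add: less_Suc_eq_le member_le_sum)
      ultimately show ?thesis by metis
    qed
    then show "(\<forall>i<b x. P i x) \<longleftrightarrow> (\<exists>N. ?R \<langle>N, x\<rangle>)" for x
      unfolding pfst_pair psnd_pair using P by metis
  qed
qed

lemma semidecidable_eq: "recursive f \<Longrightarrow> recursive g \<Longrightarrow> semidecidable (\<lambda>x. f x = g x)"
  by (intro decidable_imp_semidecidable decidable_eq)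

lemmas semidecidable_intros = semidecidable_conj semidecidable_disj semidecidable_Ex
  semidecidable_All_less semidecidable_eq

lemma semidecidable_graph_computes:
  assumes "semidecidable P"
  shows "\<exists>r. \<forall>x. \<forall>v. (\<forall>w. P \<langle>x, w\<rangle> \<longleftrightarrow> w = v) \<longrightarrow> computes r [x] v"
proof (rule semidecidableE[OF assms])
  fix Q
  assume Q: "decidable Q" "\<And>z. P z \<longleftrightarrow> (\<exists>n. Q \<langle>n, z\<rangle>)"
  let ?f = "\<lambda>s x. if Q \<langle>pfst s, \<langle>x, psnd s\<rangle>\<rangle> then 0 else 1 :: nat"
  have "recursive (\<lambda>z. ?f (pfst z) (psnd z))"
    using decidable_comp[OF Q(1), of "\<lambda>z. \<langle>pfst (pfst z), \<langle>psnd z, psnd (pfst z)\<rangle>\<rangle>"]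
    by (intro recursive_if recursive_intros) (simp add: recursive_intros)
  from recursive_nary_comp1[OF this[unfolded recursive_def] recursive_nary_pair, of 2]
  have "recursive_nary 2 (\<lambda>xs. ?f (xs ! 0) (xs ! 1))"
    by (simp add: recursive_nary_nth)
  then obtain r where r: "\<And>s x. computes r [s, x] (?f s x)"
    by (elim recursive_naryE) (metis One_nat_def length_Cons list.size(3) nth_Cons_0
        nth_Cons_Suc numeral_2_eq_2)
  obtain p where p: "\<And>xs. length xs = 1 \<Longrightarrow> computes p xs (psnd (xs ! 0))"
    using recursive_psnd[OF recursive_id] unfolding recursive_def by (elim recursive_naryE) blast
  have "computes (Comp p [Mu r]) [x] v" if v: "\<And>w. P \<langle>x, w\<rangle> \<longleftrightarrow> w = v" for x v
  proof -
    let ?s = "LEAST s. ?f s x = 0"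
    obtain n where "Q \<langle>n, \<langle>x, v\<rangle>\<rangle>" using v Q(2) by blast
    then have zero: "?f (\<langle>n, v\<rangle>) x = 0" by simp
    then have "?f ?s x = 0" by (rule LeastI)
    then have "Q \<langle>pfst ?s, \<langle>x, psnd ?s\<rangle>\<rangle>" by (rule contrapos_pp) simp
    then have "P \<langle>x, psnd ?s\<rangle>" unfolding Q(2) by blast
    then have "psnd ?s = v" using v by blast
    moreover have "computes (Mu r) [x] ?s" using computes_Least[OF r zero] .
    ultimately show ?thesis
      using p[of "[?s]"] by (intro computes.intros(4)[of "[?s]"]) auto
  qed
  then show ?thesis by blast
qed

subsection \<open>Coded lists\<close>

lemma length_le_list_encode: "length xs \<le> list_encode xs"
  by (induction xs) (auto intro: order_trans le_prod_encode_2)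

lemma length_list_decode_le: "length (list_decode n) \<le> n"
  using length_le_list_encode[of "list_decode n"] by simp

definition code_hd :: "nat \<Rightarrow> nat" where "code_hd n = pfst (n - 1)"

definition code_tl :: "nat \<Rightarrow> nat" where "code_tl n = psnd (n - 1)"

lemma list_decode_eq_Nil_iff [simp]: "list_decode n = [] \<longleftrightarrow> n = 0"
  by (cases n) (simp_all split: prod.splits)

lemma code_hd_list_encode [simp]: "code_hd (list_encode (x # xs)) = x"
  by (simp add: code_hd_def)

lemma code_tl_list_encode [simp]: "code_tl (list_encode xs) = list_encode (tl xs)"
proof (cases xs)
  case Nil
  have "psnd 0 = 0" by (simp add: psnd_def prod_decode_def prod_decode_aux.simps)
  with Nil show ?thesis by (simp add: code_tl_def)
qed (simp add: code_tl_def)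

lemma hd_list_decode: "n \<noteq> 0 \<Longrightarrow> hd (list_decode n) = code_hd n"
  by (cases n) (simp_all add: code_hd_def pfst_def split: prod.splits)

declare list_encode.simps(2) [simp del] list_decode.simps [simp del]

lemma list_decode_code_tl: "list_decode (code_tl n) = tl (list_decode n)"
  using code_tl_list_encode[of "list_decode n"] by simp

lemma list_decode_code_tl_funpow: "list_decode ((code_tl ^^ i) n) = drop i (list_decode n)"
  by (induction i) (simp_all add: list_decode_code_tl drop_Suc tl_drop)

lemma recursive_code_hd: "recursive f \<Longrightarrow> recursive (\<lambda>x. code_hd (f x))"
  unfolding code_hd_def by (intro recursive_intros)

lemma recursive_code_tl: "recursive f \<Longrightarrow> recursive (\<lambda>x. code_tl (f x))"
  unfolding code_tl_def by (intro recursive_intros)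

lemma recursive_code_tl_funpow:
  assumes "recursive n" "recursive f"
  shows "recursive (\<lambda>x. (code_tl ^^ n x) (f x))"
proof -
  have "recursive (\<lambda>x. rec_nat (f x) (\<lambda>i. code_tl) (n x))"
    using assms by (intro recursive_rec_nat[of "\<lambda>y. y" "\<lambda>i y e. code_tl y"]
        recursive_code_tl recursive_intros)
  moreover have "rec_nat a (\<lambda>i. code_tl) m = (code_tl ^^ m) a" for a m
    by (induction m) auto
  ultimately show ?thesis by simp
qed

lemmas recursive_code_intros = recursive_code_hd recursive_code_tl recursive_code_tl_funpow

lemma list_all2_iff_drop:
  assumes "length xs \<le> n" "length ys \<le> n"
  shows "list_all2 P xs ys \<longleftrightarrow> (\<forall>i<n. drop i xs = [] \<and> drop i ys = [] \<or>
    (drop i xs \<noteq> [] \<and> drop i ys \<noteq> [] \<and> P (hd (drop i xs)) (hd (drop i ys))))"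
proof
  assume "list_all2 P xs ys"
  then show "\<forall>i<n. drop i xs = [] \<and> drop i ys = [] \<or>
    (drop i xs \<noteq> [] \<and> drop i ys \<noteq> [] \<and> P (hd (drop i xs)) (hd (drop i ys)))"
    by (auto simp: list_all2_conv_all_nth hd_drop_conv_nth)
next
  assume drop: "\<forall>i<n. drop i xs = [] \<and> drop i ys = [] \<or>
    (drop i xs \<noteq> [] \<and> drop i ys \<noteq> [] \<and> P (hd (drop i xs)) (hd (drop i ys)))"
  have "length xs = length ys"
  proof (rule linorder_cases)
    assume "length xs < length ys"
    then show ?thesis using drop[rule_format, of "length xs"] assms by simp
  next
    assume "length ys < length xs"
    then show ?thesis using drop[rule_format, of "length ys"] assms by simp
  qed
  moreover have "P (xs ! i) (ys ! i)" if "i < length xs" "i < length ys" for i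
    using drop[rule_format, of i] that assms by (simp add: hd_drop_conv_nth)
  ultimately show "list_all2 P xs ys" by (simp add: list_all2_conv_all_nth)
qed

lemma semidecidable_list_all2:
  assumes P: "semidecidable (\<lambda>z. P (pfst z) (pfst (psnd z)) (psnd (psnd z)))"
    and f: "recursive f" and g: "recursive g"
  shows "semidecidable (\<lambda>x. list_all2 (P x) (list_decode (f x)) (list_decode (g x)))"
proof -
  let ?f = "\<lambda>i x. (code_tl ^^ i) (f x)" and ?g = "\<lambda>i x. (code_tl ^^ i) (g x)"
  have "recursive (\<lambda>z. \<langle>psnd z, \<langle>code_hd (?f (pfst z) (psnd z)), code_hd (?g (pfst z) (psnd z))\<rangle>\<rangle>)"
    by (intro recursive_intros recursive_code_intros recursive_comp[OF f] recursive_comp[OF g])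
  from semidecidable_comp[OF P this]
  have "semidecidable (\<lambda>z. P (psnd z) (code_hd (?f (pfst z) (psnd z)))
    (code_hd (?g (pfst z) (psnd z))))" by simp
  then have "semidecidable (\<lambda>x. \<forall>i<f x + g x. ?f i x = 0 \<and> ?g i x = 0 \<or>
      (\<not> ?f i x = 0 \<and> \<not> ?g i x = 0 \<and> P x (code_hd (?f i x)) (code_hd (?g i x))))"
    by (intro semidecidable_intros decidable_imp_semidecidable[OF decidable_not] decidable_eq
        recursive_intros recursive_code_intros f g recursive_comp[OF f] recursive_comp[OF g])
  moreover have "list_all2 (P x) (list_decode (f x)) (list_decode (g x)) \<longleftrightarrow>
    (\<forall>i<f x + g x. ?f i x = 0 \<and> ?g i x = 0 \<or>
      (\<not> ?f i x = 0 \<and> \<not> ?g i x = 0 \<and> P x (code_hd (?f i x)) (code_hd (?g i x))))" for x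
  proof -
    have "length (list_decode (f x)) \<le> f x + g x" "length (list_decode (g x)) \<le> f x + g x"
      using length_list_decode_le[of "f x"] length_list_decode_le[of "g x"] by auto
    from list_all2_iff_drop[OF this] show ?thesis
      by (auto simp: hd_list_decode simp flip: list_decode_code_tl_funpow)
  qed
  ultimately show ?thesis by simp
qed

lemma semidecidable_member:
  assumes "recursive f" "recursive g"
  shows "semidecidable (\<lambda>x. f x \<in> set (list_decode (g x)))"
proof -
  have "semidecidable (\<lambda>x. \<exists>i. \<not> (code_tl ^^ i) (g x) = 0 \<and> code_hd ((code_tl ^^ i) (g x)) = f x)"
    by (intro semidecidable_intros decidable_imp_semidecidable[OF decidable_not] decidable_eq
        recursive_intros recursive_code_intros recursive_comp[OF assms(1)]
        recursive_comp[OF assms(2)])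
  moreover have "a \<in> set (list_decode n) \<longleftrightarrow>
    (\<exists>i. \<not> (code_tl ^^ i) n = 0 \<and> code_hd ((code_tl ^^ i) n) = a)" for a n
  proof -
    have "a \<in> set (list_decode n) \<longleftrightarrow>
      (\<exists>i. drop i (list_decode n) \<noteq> [] \<and> hd (drop i (list_decode n)) = a)"
      by (auto simp: in_set_conv_nth hd_drop_conv_nth not_le)
    then show ?thesis by (auto simp: hd_list_decode simp flip: list_decode_code_tl_funpow)
  qed
  ultimately show ?thesis by simp
qed

subsection \<open>Enumeration operators\<close>

definition enumeration_operator :: "(nat set \<Rightarrow> nat \<Rightarrow> bool) \<Rightarrow> bool" where
  "enumeration_operator \<Phi> \<longleftrightarrow>
     (\<forall>S S' x. \<Phi> S x \<longrightarrow> S \<subseteq> S' \<longrightarrow> \<Phi> S' x) \<and>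
     (\<forall>S x. \<Phi> S x \<longrightarrow> (\<exists>D\<subseteq>S. finite D \<and> \<Phi> D x)) \<and>
     semidecidable (\<lambda>z. \<Phi> (set (list_decode (pfst z))) (psnd z))"

lemma enumeration_operatorI:
  assumes "\<And>S S' x. \<Phi> S x \<Longrightarrow> S \<subseteq> S' \<Longrightarrow> \<Phi> S' x"
    and "\<And>S x. \<Phi> S x \<Longrightarrow> \<exists>D\<subseteq>S. finite D \<and> \<Phi> D x"
    and "semidecidable (\<lambda>z. \<Phi> (set (list_decode (pfst z))) (psnd z))"
  shows "enumeration_operator \<Phi>"
  unfolding enumeration_operator_def using assms by simp

lemma enumeration_operator_mono:
  "enumeration_operator \<Phi> \<Longrightarrow> \<Phi> S x \<Longrightarrow> S \<subseteq> S' \<Longrightarrow> \<Phi> S' x"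
  by (simp add: enumeration_operator_def)

lemma enumeration_operator_finite:
  "enumeration_operator \<Phi> \<Longrightarrow> \<Phi> S x \<Longrightarrow> \<exists>D\<subseteq>S. finite D \<and> \<Phi> D x"
  by (simp add: enumeration_operator_def)

lemma enumeration_operator_semidecidable:
  assumes "enumeration_operator \<Phi>" "recursive f" "recursive g"
  shows "semidecidable (\<lambda>z. \<Phi> (set (list_decode (f z))) (g z))"
  using semidecidable_comp[OF _ recursive_pair[OF assms(2,3)]] assms(1)
  unfolding enumeration_operator_def by fastforce

lemma enumeration_operator_const: "semidecidable P \<Longrightarrow> enumeration_operator (\<lambda>S. P)"
  by (rule enumeration_operatorI) (auto simp: semidecidable_comp recursive_intros)

lemma enumeration_operator_eq:
  "recursive f \<Longrightarrow> recursive g \<Longrightarrow> enumeration_operator (\<lambda>S x. f x = g x)"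
  by (intro enumeration_operator_const semidecidable_eq)

lemma enumeration_operator_member:
  assumes "recursive f"
  shows "enumeration_operator (\<lambda>S x. f x \<in> S)"
proof (rule enumeration_operatorI)
  show "\<exists>D\<subseteq>S. finite D \<and> f x \<in> D" if "f x \<in> S" for S x
    using that by (intro exI[of _ "{f x}"]) simp
  show "semidecidable (\<lambda>z. f (psnd z) \<in> set (list_decode (pfst z)))"
    by (intro semidecidable_member recursive_comp[OF assms] recursive_intros)
qed auto

lemma enumeration_operator_comp:
  assumes "enumeration_operator \<Phi>" "recursive f"
  shows "enumeration_operator (\<lambda>S x. \<Phi> S (f x))"
proof (rule enumeration_operatorI)
  show "\<Phi> S' (f x)" if "\<Phi> S (f x)" "S \<subseteq> S'" for S S' x
    using enumeration_operator_mono[OF assms(1) that] .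
  show "\<exists>D\<subseteq>S. finite D \<and> \<Phi> D (f x)" if "\<Phi> S (f x)" for S x
    using enumeration_operator_finite[OF assms(1) that] .
  show "semidecidable (\<lambda>z. \<Phi> (set (list_decode (pfst z))) (f (psnd z)))"
    by (intro enumeration_operator_semidecidable[OF assms(1)] recursive_comp[OF assms(2)]
        recursive_intros)
qed

lemma enumeration_operator_conj:
  assumes \<Phi>: "enumeration_operator \<Phi>" and \<Psi>: "enumeration_operator \<Psi>"
  shows "enumeration_operator (\<lambda>S x. \<Phi> S x \<and> \<Psi> S x)"
proof (rule enumeration_operatorI)
  show "\<Phi> S' x \<and> \<Psi> S' x" if "\<Phi> S x \<and> \<Psi> S x" "S \<subseteq> S'" for S S' x
    using that enumeration_operator_mono[OF \<Phi>, of S x S'] enumeration_operator_mono[OF \<Psi>, of S x S']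
    by blast
  show "\<exists>D\<subseteq>S. finite D \<and> \<Phi> D x \<and> \<Psi> D x" if both: "\<Phi> S x \<and> \<Psi> S x" for S x
  proof -
    obtain D where "D \<subseteq> S" "finite D" "\<Phi> D x"
      using enumeration_operator_finite[OF \<Phi> conjunct1[OF both]] by blast
    moreover obtain E where "E \<subseteq> S" "finite E" "\<Psi> E x"
      using enumeration_operator_finite[OF \<Psi> conjunct2[OF both]] by blast
    ultimately show ?thesis
      using enumeration_operator_mono[OF \<Phi>, of D x "D \<union> E"]
        enumeration_operator_mono[OF \<Psi>, of E x "D \<union> E"]
      by (intro exI[of _ "D \<union> E"]) simp
  qed
qed (intro semidecidable_conj enumeration_operator_semidecidable assms recursive_intros)

lemma enumeration_operator_disj:
  assumes \<Phi>: "enumeration_operator \<Phi>" and \<Psi>: "enumeration_operator \<Psi>"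
  shows "enumeration_operator (\<lambda>S x. \<Phi> S x \<or> \<Psi> S x)"
proof (rule enumeration_operatorI)
  show "\<Phi> S' x \<or> \<Psi> S' x" if "\<Phi> S x \<or> \<Psi> S x" "S \<subseteq> S'" for S S' x
    using that enumeration_operator_mono[OF \<Phi>, of S x S'] enumeration_operator_mono[OF \<Psi>, of S x S']
    by blast
  show "\<exists>D\<subseteq>S. finite D \<and> (\<Phi> D x \<or> \<Psi> D x)" if "\<Phi> S x \<or> \<Psi> S x" for S x
    using that enumeration_operator_finite[OF \<Phi>, of S x] enumeration_operator_finite[OF \<Psi>, of S x]
    by blast
qed (intro semidecidable_disj enumeration_operator_semidecidable assms recursive_intros)

lemma enumeration_operator_Ex:
  assumes "enumeration_operator (\<lambda>S z. \<Phi> S (pfst z) (psnd z))"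
  shows "enumeration_operator (\<lambda>S x. \<exists>y. \<Phi> S y x)"
proof (rule enumeration_operatorI)
  have mono: "\<Phi> S y x \<Longrightarrow> S \<subseteq> S' \<Longrightarrow> \<Phi> S' y x" for S S' x y
    using enumeration_operator_mono[OF assms, of S "\<langle>y, x\<rangle>" S'] by simp
  show "\<exists>y. \<Phi> S' y x" if "\<exists>y. \<Phi> S y x" "S \<subseteq> S'" for S S' x
    using that(1) mono[OF _ that(2)] by blast
  have finitary: "\<exists>D\<subseteq>S. finite D \<and> \<Phi> D y x" if "\<Phi> S y x" for S x y
    using that enumeration_operator_finite[OF assms, of S "\<langle>y, x\<rangle>"] by simp
  show "\<exists>D\<subseteq>S. finite D \<and> (\<exists>y. \<Phi> D y x)" if "\<exists>y. \<Phi> S y x" for S x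
    using that by (elim exE) (drule finitary, blast)
  have "semidecidable (\<lambda>z. \<Phi> (set (list_decode (pfst (psnd z)))) (pfst z) (psnd (psnd z)))"
    using enumeration_operator_semidecidable[OF assms, of "\<lambda>z. pfst (psnd z)"
        "\<lambda>z. \<langle>pfst z, psnd (psnd z)\<rangle>"] by (simp add: recursive_intros)
  then show "semidecidable (\<lambda>z. \<exists>y. \<Phi> (set (list_decode (pfst z))) y (psnd z))"
    by (rule semidecidable_Ex)
qed

lemma enumeration_operator_list_all2:
  assumes \<Phi>: "enumeration_operator (\<lambda>S z. \<Phi> S (pfst z) (pfst (psnd z)) (psnd (psnd z)))"
    and "recursive f" "recursive g"
  shows "enumeration_operator (\<lambda>S x. list_all2 (\<Phi> S x) (list_decode (f x)) (list_decode (g x)))"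
proof (rule enumeration_operatorI)
  have mono: "\<Phi> S x a b \<Longrightarrow> S \<subseteq> S' \<Longrightarrow> \<Phi> S' x a b" for S S' x a b
    using enumeration_operator_mono[OF \<Phi>, of S "\<langle>x, \<langle>a, b\<rangle>\<rangle>" S'] by simp
  then show "list_all2 (\<Phi> S' x) (list_decode (f x)) (list_decode (g x))"
    if "list_all2 (\<Phi> S x) (list_decode (f x)) (list_decode (g x))" "S \<subseteq> S'" for S S' x
    using that by (blast intro: list_all2_mono)
  show "\<exists>D\<subseteq>S. finite D \<and> list_all2 (\<Phi> D x) (list_decode (f x)) (list_decode (g x))"
    if "list_all2 (\<Phi> S x) (list_decode (f x)) (list_decode (g x))" for S x
    using that
  proof (induction rule: list_all2_induct)
    case (Cons a as b bs)
    then obtain D E where "D \<subseteq> S" "finite D" "list_all2 (\<Phi> D x) as bs"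
      "E \<subseteq> S" "finite E" "\<Phi> E x a b"
      using enumeration_operator_finite[OF \<Phi>, of S "\<langle>x, \<langle>a, b\<rangle>\<rangle>"] by auto
    then show ?case
      using mono by (intro exI[of _ "D \<union> E"]) (auto intro: list_all2_mono)
  qed auto
  have "semidecidable (\<lambda>w. \<Phi> (set (list_decode (pfst (pfst w)))) (psnd (pfst w))
      (pfst (psnd w)) (psnd (psnd w)))"
    using enumeration_operator_semidecidable[OF \<Phi>, of "\<lambda>w. pfst (pfst w)"
        "\<lambda>w. \<langle>psnd (pfst w), psnd w\<rangle>"] by (simp add: recursive_intros)
  then show "semidecidable (\<lambda>z. list_all2 (\<Phi> (set (list_decode (pfst z))) (psnd z))
      (list_decode (f (psnd z))) (list_decode (g (psnd z))))"
    by (intro semidecidable_list_all2 recursive_comp[OF assms(2)] recursive_comp[OF assms(3)]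
        recursive_intros)
qed

lemmas enumeration_operator_intros = enumeration_operator_conj enumeration_operator_disj
  enumeration_operator_Ex enumeration_operator_eq enumeration_operator_member

fun trace :: "(nat set \<Rightarrow> nat \<Rightarrow> bool) \<Rightarrow> nat list \<Rightarrow> bool" where
  "trace \<Phi> [] \<longleftrightarrow> True"
| "trace \<Phi> (x # xs) \<longleftrightarrow> \<Phi> (set xs) x \<and> trace \<Phi> xs"

lemma trace_append:
  assumes "enumeration_operator \<Phi>"
  shows "trace \<Phi> xs \<Longrightarrow> trace \<Phi> ys \<Longrightarrow> trace \<Phi> (xs @ ys)"
  by (induction xs) (auto intro: enumeration_operator_mono[OF assms])

lemma trace_iff_drop:
  "length xs \<le> n \<Longrightarrow>
    trace \<Phi> xs \<longleftrightarrow> (\<forall>i<n. drop i xs = [] \<or> \<Phi> (set (tl (drop i xs))) (hd (drop i xs)))"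
proof (induction xs arbitrary: n)
  case (Cons x xs)
  then obtain k where "n = Suc k" "length xs \<le> k" by (cases n) auto
  then show ?case using Cons.IH by (simp add: All_less_Suc2)
qed simp

lemma semidecidable_trace:
  assumes "enumeration_operator \<Phi>" "recursive f"
  shows "semidecidable (\<lambda>x. trace \<Phi> (list_decode (f x)))"
proof -
  let ?t = "\<lambda>i x. (code_tl ^^ i) (f x)"
  have "semidecidable (\<lambda>x. \<forall>i<f x. ?t i x = 0 \<or>
      \<Phi> (set (list_decode (code_tl (?t i x)))) (code_hd (?t i x)))"
    by (intro semidecidable_intros enumeration_operator_semidecidable[OF assms(1)]
        recursive_intros recursive_code_intros recursive_comp[OF assms(2)] assms(2))
  moreover have "?t i x = 0 \<or> \<Phi> (set (list_decode (code_tl (?t i x)))) (code_hd (?t i x)) \<longleftrightarrow>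
      drop i (list_decode (f x)) = [] \<or>
      \<Phi> (set (tl (drop i (list_decode (f x))))) (hd (drop i (list_decode (f x))))" for i x
    unfolding list_decode_code_tl_funpow[symmetric]
    by (cases "?t i x = 0") (simp_all add: hd_list_decode list_decode_code_tl)
  ultimately show ?thesis
    by (simp only: trace_iff_drop[OF length_list_decode_le])
qed

lemma lfp_enumeration_operator:
  assumes "enumeration_operator \<Phi>"
  shows "x \<in> lfp (\<lambda>S. Collect (\<Phi> S)) \<longleftrightarrow> (\<exists>xs. trace \<Phi> xs \<and> x \<in> set xs)"
proof
  let ?L = "lfp (\<lambda>S. Collect (\<Phi> S))" and ?T = "{x. \<exists>xs. trace \<Phi> xs \<and> x \<in> set xs}"
  have mono: "mono (\<lambda>S. Collect (\<Phi> S))"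
    by (rule monoI) (auto intro: enumeration_operator_mono[OF assms])
  have "x \<in> ?T" if "\<Phi> ?T x" for x
  proof -
    obtain D where "finite D" "D \<subseteq> ?T" "\<Phi> D x"
      using enumeration_operator_finite[OF assms \<open>\<Phi> ?T x\<close>] by blast
    from this(1,2) have "\<exists>xs. trace \<Phi> xs \<and> D \<subseteq> set xs"
    proof induction
      case (insert y D)
      then obtain xs ys where "trace \<Phi> xs" "D \<subseteq> set xs" "trace \<Phi> ys" "y \<in> set ys" by auto
      then show ?case using trace_append[OF assms] by (intro exI[of _ "xs @ ys"]) auto
    qed (auto intro: exI[of _ "[]"])
    then obtain xs where "trace \<Phi> xs" "D \<subseteq> set xs" by blast
    then have "trace \<Phi> (x # xs)" using enumeration_operator_mono[OF assms \<open>\<Phi> D x\<close>] by simp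
    then show ?thesis by (blast intro: list.set_intros)
  qed
  then have "?L \<subseteq> ?T" by (intro lfp_lowerbound) blast
  then show "\<exists>xs. trace \<Phi> xs \<and> x \<in> set xs" if "x \<in> ?L" using that by blast
  have "set xs \<subseteq> ?L" if "trace \<Phi> xs" for xs
    using that
  proof (induction xs)
    case (Cons x xs)
    then have "\<Phi> ?L x" using enumeration_operator_mono[OF assms] by auto
    then have "x \<in> ?L" using lfp_unfold[OF mono] by blast
    then show ?case using Cons by simp
  qed simp
  then show "x \<in> ?L" if "\<exists>xs. trace \<Phi> xs \<and> x \<in> set xs" using that by blast
qed

theorem semidecidable_lfp:
  assumes "enumeration_operator \<Phi>"
  shows "semidecidable (\<lambda>x. x \<in> lfp (\<lambda>S. Collect (\<Phi> S)))"
proof -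
  have "semidecidable (\<lambda>x. \<exists>t. trace \<Phi> (list_decode t) \<and> x \<in> set (list_decode t))"
    by (intro semidecidable_intros semidecidable_trace[OF assms] semidecidable_member
        recursive_intros)
  moreover have "x \<in> lfp (\<lambda>S. Collect (\<Phi> S)) \<longleftrightarrow>
    (\<exists>t. trace \<Phi> (list_decode t) \<and> x \<in> set (list_decode t))" for x
    unfolding lfp_enumeration_operator[OF assms] by (metis list_encode_inverse)
  ultimately show ?thesis by simp
qed

subsection \<open>Computable functions on encoded data\<close>

class enc =
  fixes enc :: "'a \<Rightarrow> nat"

instantiation nat :: enc begin
definition enc_nat :: "nat \<Rightarrow> nat" where [simp]: "enc_nat n = n"
instance ..
end

instantiation bool :: enc begin
definition enc_bool :: "bool \<Rightarrow> nat" where [simp]: "enc_bool b = of_bool b"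
instance ..
end

instantiation prod :: (enc, enc) enc begin
definition enc_prod :: "'a \<times> 'b \<Rightarrow> nat" where [simp]: "enc_prod x = \<langle>enc (fst x), enc (snd x)\<rangle>"
instance ..
end

instantiation list :: (enc) enc begin
definition enc_list :: "'a list \<Rightarrow> nat" where [simp]: "enc_list xs = list_encode (map enc xs)"
instance ..
end

definition computable :: "('a::enc \<Rightarrow> 'b::enc) \<Rightarrow> bool" where
  "computable f \<longleftrightarrow> (\<exists>P. semidecidable P \<and> (\<forall>x v. P \<langle>enc x, v\<rangle> \<longleftrightarrow> v = enc (f x)))"

lemma computable_computes: "computable f \<Longrightarrow> \<exists>r. \<forall>x. computes r [enc x] (enc (f x))"
  unfolding computable_def using semidecidable_graph_computes by metis

lemma computableI_code:
  assumes "recursive g" "\<And>x. g (enc x) = enc (f x)"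
  shows "computable f"
  unfolding computable_def
proof (intro exI[of _ "\<lambda>z. psnd z = g (pfst z)"] conjI allI)
  show "semidecidable (\<lambda>z. psnd z = g (pfst z))"
    by (intro semidecidable_eq recursive_comp[OF assms(1)] recursive_intros)
qed (simp add: assms(2))

definition graph_below :: "('a::enc \<Rightarrow> 'b::enc) \<Rightarrow> ('a \<Rightarrow> nat) \<Rightarrow> nat \<Rightarrow> nat set" where
  "graph_below F m n = {\<langle>enc x, enc (F x)\<rangle> | x. m x < n}"

definition correct_pairs :: "('a::enc \<Rightarrow> 'b::enc) \<Rightarrow> nat set" where
  "correct_pairs F = {z. \<forall>x. pfst z = enc x \<longrightarrow> psnd z = enc (F x)}"

text \<open>
  Wherever \<open>A\<close> holds, \<open>h e\<close> is computable from \<open>e\<close> and the values of \<open>F\<close> at arguments of measure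
  less than \<open>b e\<close>.  The encodings need not be surjective, and in soundness the operator is given all
  of \<open>correct_pairs F\<close> because the least fixed point below may contain pairs whose first component
  is not a code.
\<close>

definition computable_from ::
  "('a::enc \<Rightarrow> 'b::enc) \<Rightarrow> ('a \<Rightarrow> nat) \<Rightarrow> ('e::enc \<Rightarrow> nat) \<Rightarrow> ('e \<Rightarrow> bool) \<Rightarrow> ('e \<Rightarrow> 'c::enc) \<Rightarrow> bool"
  where
  "computable_from F m b A h \<longleftrightarrow> (\<exists>\<Phi>. enumeration_operator \<Phi> \<and>
     (\<forall>e. A e \<longrightarrow> \<Phi> (graph_below F m (b e)) \<langle>enc e, enc (h e)\<rangle> \<and>
       (\<forall>v. \<Phi> (correct_pairs F) \<langle>enc e, v\<rangle> \<longrightarrow> v = enc (h e))))"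

lemma computable_fromI:
  assumes "enumeration_operator \<Phi>"
    and "\<And>e. A e \<Longrightarrow> \<Phi> (graph_below F m (b e)) \<langle>enc e, enc (h e)\<rangle>"
    and "\<And>e v. A e \<Longrightarrow> \<Phi> (correct_pairs F) \<langle>enc e, v\<rangle> \<Longrightarrow> v = enc (h e)"
  shows "computable_from F m b A h"
  unfolding computable_from_def using assms by blast

lemma computable_fromE:
  assumes "computable_from F m b A h"
  obtains \<Phi> where "enumeration_operator \<Phi>"
    and "\<And>e. A e \<Longrightarrow> \<Phi> (graph_below F m (b e)) \<langle>enc e, enc (h e)\<rangle>"
    and "\<And>e v. A e \<Longrightarrow> \<Phi> (correct_pairs F) \<langle>enc e, v\<rangle> \<Longrightarrow> v = enc (h e)"
  using assms unfolding computable_from_def by blast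

theorem computable_recursion:
  assumes "computable_from F m m (\<lambda>_. True) F"
  shows "computable F"
proof -
  obtain \<Phi> where \<Phi>: "enumeration_operator \<Phi>"
    and complete: "\<And>x. \<Phi> (graph_below F m (m x)) \<langle>enc x, enc (F x)\<rangle>"
    and correct: "\<And>x v. \<Phi> (correct_pairs F) \<langle>enc x, v\<rangle> \<Longrightarrow> v = enc (F x)"
    using assms unfolding computable_from_def by auto
  let ?L = "lfp (\<lambda>S. Collect (\<Phi> S))"
  have mono: "mono (\<lambda>S. Collect (\<Phi> S))"
    by (rule monoI) (auto intro: enumeration_operator_mono[OF \<Phi>])
  have "Collect (\<Phi> (correct_pairs F)) \<subseteq> correct_pairs F"
  proof
    fix z
    assume "z \<in> Collect (\<Phi> (correct_pairs F))"
    then have z: "\<Phi> (correct_pairs F) \<langle>pfst z, psnd z\<rangle>" by simp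
    have "psnd z = enc (F x)" if "pfst z = enc x" for x
      using z unfolding that by (rule correct)
    then show "z \<in> correct_pairs F" by (simp add: correct_pairs_def)
  qed
  then have "?L \<subseteq> correct_pairs F" by (rule lfp_lowerbound)
  then have "v = enc (F x)" if "\<langle>enc x, v\<rangle> \<in> ?L" for x v
    using that by (auto simp: correct_pairs_def)
  moreover have "\<langle>enc x, enc (F x)\<rangle> \<in> ?L" for x
  proof (induction x rule: measure_induct_rule[of m])
    case (less x)
    then have "graph_below F m (m x) \<subseteq> ?L" by (auto simp: graph_below_def)
    then have "\<Phi> ?L \<langle>enc x, enc (F x)\<rangle>" using enumeration_operator_mono[OF \<Phi> complete] by blast
    then show ?case by (subst lfp_unfold[OF mono]) simp
  qed
  ultimately show ?thesis
    unfolding computable_def using semidecidable_lfp[OF \<Phi>] by blast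
qed

named_theorems computable_intros

lemma computable_from_cong:
  assumes "computable_from F m b A h" "\<And>e. A' e \<Longrightarrow> A e" "\<And>e. A' e \<Longrightarrow> h e = h' e"
  shows "computable_from F m b A' h'"
proof (rule computable_fromE[OF assms(1)])
  fix \<Phi>
  assume \<Phi>: "enumeration_operator \<Phi>"
    "\<And>e. A e \<Longrightarrow> \<Phi> (graph_below F m (b e)) \<langle>enc e, enc (h e)\<rangle>"
    "\<And>e v. A e \<Longrightarrow> \<Phi> (correct_pairs F) \<langle>enc e, v\<rangle> \<Longrightarrow> v = enc (h e)"
  show ?thesis
  proof (rule computable_fromI[OF \<Phi>(1)])
    show "\<Phi> (graph_below F m (b e)) \<langle>enc e, enc (h' e)\<rangle>" if "A' e" for e
      using \<Phi>(2)[OF assms(2)[OF that]] assms(3)[OF that] by simp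
    show "v = enc (h' e)" if "A' e" "\<Phi> (correct_pairs F) \<langle>enc e, v\<rangle>" for e v
      using \<Phi>(3)[OF assms(2)[OF that(1)] that(2)] assms(3)[OF that(1)] by simp
  qed
qed

lemma computable_from_id [computable_intros]: "computable_from F m b A (\<lambda>e. e)"
  by (rule computable_fromI[of "\<lambda>S z. psnd z = pfst z"])
    (simp_all add: enumeration_operator_eq recursive_intros)

lemma computable_from_const [computable_intros]: "computable_from F m b A (\<lambda>e. c)"
  by (rule computable_fromI[of "\<lambda>S z. psnd z = enc c"])
    (simp_all add: enumeration_operator_eq recursive_intros)

lemma computable_from_pair [computable_intros]:
  assumes "computable_from F m b A h1" "computable_from F m b A h2"
  shows "computable_from F m b A (\<lambda>e. (h1 e, h2 e))"
proof (rule computable_fromE[OF assms(1)], rule computable_fromE[OF assms(2)])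
  fix \<Phi> \<Psi>
  assume \<Phi>: "enumeration_operator \<Phi>"
    "\<And>e. A e \<Longrightarrow> \<Phi> (graph_below F m (b e)) \<langle>enc e, enc (h1 e)\<rangle>"
    "\<And>e v. A e \<Longrightarrow> \<Phi> (correct_pairs F) \<langle>enc e, v\<rangle> \<Longrightarrow> v = enc (h1 e)"
    and \<Psi>: "enumeration_operator \<Psi>"
    "\<And>e. A e \<Longrightarrow> \<Psi> (graph_below F m (b e)) \<langle>enc e, enc (h2 e)\<rangle>"
    "\<And>e v. A e \<Longrightarrow> \<Psi> (correct_pairs F) \<langle>enc e, v\<rangle> \<Longrightarrow> v = enc (h2 e)"
  let ?\<Theta> = "\<lambda>S z. \<Phi> S \<langle>pfst z, pfst (psnd z)\<rangle> \<and> \<Psi> S \<langle>pfst z, psnd (psnd z)\<rangle>"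
  show ?thesis
  proof (rule computable_fromI[of ?\<Theta>])
    show "enumeration_operator ?\<Theta>"
      by (intro enumeration_operator_intros enumeration_operator_comp[OF \<Phi>(1)]
          enumeration_operator_comp[OF \<Psi>(1)] recursive_intros)
    show "?\<Theta> (graph_below F m (b e)) \<langle>enc e, enc (h1 e, h2 e)\<rangle>" if "A e" for e
      using \<Phi>(2) \<Psi>(2) that by simp
    show "v = enc (h1 e, h2 e)" if "A e" "?\<Theta> (correct_pairs F) \<langle>enc e, v\<rangle>" for e v
      using \<Phi>(3)[of e "pfst v"] \<Psi>(3)[of e "psnd v"] that by (simp, metis pair_pfst_psnd)
  qed
qed

lemma computable_from_bind:
  assumes "computable_from F m b A g"
    and "computable_from F m (\<lambda>p. b (fst p)) (\<lambda>p. A (fst p) \<and> snd p = g (fst p))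
      (\<lambda>p. h (fst p) (snd p))"
  shows "computable_from F m b A (\<lambda>e. h e (g e))"
proof (rule computable_fromE[OF assms(1)], rule computable_fromE[OF assms(2)])
  fix \<Phi> \<Psi>
  assume \<Phi>: "enumeration_operator \<Phi>"
    "\<And>e. A e \<Longrightarrow> \<Phi> (graph_below F m (b e)) \<langle>enc e, enc (g e)\<rangle>"
    "\<And>e u. A e \<Longrightarrow> \<Phi> (correct_pairs F) \<langle>enc e, u\<rangle> \<Longrightarrow> u = enc (g e)"
    and \<Psi>: "enumeration_operator \<Psi>"
    "\<And>p. A (fst p) \<and> snd p = g (fst p) \<Longrightarrow>
      \<Psi> (graph_below F m (b (fst p))) \<langle>enc p, enc (h (fst p) (snd p))\<rangle>"
    "\<And>p v. A (fst p) \<and> snd p = g (fst p) \<Longrightarrow>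
      \<Psi> (correct_pairs F) \<langle>enc p, v\<rangle> \<Longrightarrow> v = enc (h (fst p) (snd p))"
  let ?\<Theta> = "\<lambda>S z. \<exists>u. \<Phi> S \<langle>pfst z, u\<rangle> \<and> \<Psi> S \<langle>\<langle>pfst z, u\<rangle>, psnd z\<rangle>"
  show ?thesis
  proof (rule computable_fromI[of ?\<Theta>])
    show "enumeration_operator ?\<Theta>"
      by (intro enumeration_operator_intros enumeration_operator_comp[OF \<Phi>(1)]
          enumeration_operator_comp[OF \<Psi>(1)] recursive_intros)
    show "?\<Theta> (graph_below F m (b e)) \<langle>enc e, enc (h e (g e))\<rangle>" if "A e" for e
      using \<Phi>(2)[of e] \<Psi>(2)[of "(e, g e)"] that by auto
    show "v = enc (h e (g e))" if "A e" "?\<Theta> (correct_pairs F) \<langle>enc e, v\<rangle>" for e v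
      using \<Phi>(3)[of e] \<Psi>(3)[of "(e, g e)" v] that by auto
  qed
qed

lemma computable_from_comp:
  assumes "computable f" "computable_from F m b A h"
  shows "computable_from F m b A (\<lambda>e. f (h e))"
proof (rule computable_from_bind[OF assms(2)])
  obtain P where P: "semidecidable P" "\<And>x v. P \<langle>enc x, v\<rangle> \<longleftrightarrow> v = enc (f x)"
    using assms(1) unfolding computable_def by blast
  let ?P = "\<lambda>z. P \<langle>psnd (pfst z), psnd z\<rangle>"
  have "semidecidable ?P" by (intro semidecidable_comp[OF P(1)] recursive_intros)
  then show "computable_from F m (\<lambda>p. b (fst p)) (\<lambda>p. A (fst p) \<and> snd p = h (fst p))
      (\<lambda>p. f (snd p))"
    by (intro computable_fromI[of "\<lambda>S. ?P"] enumeration_operator_const) (simp_all add: P(2))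
qed

lemma computable_from_cases:
  assumes "computable_from F m b A c"
    and "computable_from F m b (\<lambda>e. A e \<and> c e) h" "computable_from F m b (\<lambda>e. A e \<and> \<not> c e) h"
  shows "computable_from F m b A h"
proof (rule computable_fromE[OF assms(1)], rule computable_fromE[OF assms(2)],
    rule computable_fromE[OF assms(3)])
  fix \<Phi> \<Psi> \<Psi>'
  assume \<Phi>: "enumeration_operator \<Phi>"
    "\<And>e. A e \<Longrightarrow> \<Phi> (graph_below F m (b e)) \<langle>enc e, enc (c e)\<rangle>"
    "\<And>e u. A e \<Longrightarrow> \<Phi> (correct_pairs F) \<langle>enc e, u\<rangle> \<Longrightarrow> u = enc (c e)"
    and \<Psi>: "enumeration_operator \<Psi>"
    "\<And>e. A e \<and> c e \<Longrightarrow> \<Psi> (graph_below F m (b e)) \<langle>enc e, enc (h e)\<rangle>"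
    "\<And>e v. A e \<and> c e \<Longrightarrow> \<Psi> (correct_pairs F) \<langle>enc e, v\<rangle> \<Longrightarrow> v = enc (h e)"
    and \<Psi>': "enumeration_operator \<Psi>'"
    "\<And>e. A e \<and> \<not> c e \<Longrightarrow> \<Psi>' (graph_below F m (b e)) \<langle>enc e, enc (h e)\<rangle>"
    "\<And>e v. A e \<and> \<not> c e \<Longrightarrow> \<Psi>' (correct_pairs F) \<langle>enc e, v\<rangle> \<Longrightarrow> v = enc (h e)"
  let ?\<Theta> = "\<lambda>S z. \<Phi> S \<langle>pfst z, 1\<rangle> \<and> \<Psi> S z \<or> \<Phi> S \<langle>pfst z, 0\<rangle> \<and> \<Psi>' S z"
  show ?thesis
  proof (rule computable_fromI[of ?\<Theta>])
    show "enumeration_operator ?\<Theta>"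
      by (intro enumeration_operator_intros enumeration_operator_comp[OF \<Phi>(1)] \<Psi>(1) \<Psi>'(1)
          recursive_intros)
    show "?\<Theta> (graph_below F m (b e)) \<langle>enc e, enc (h e)\<rangle>" if "A e" for e
      using \<Phi>(2)[of e] \<Psi>(2)[of e] \<Psi>'(2)[of e] that by (cases "c e") simp_all
    show "v = enc (h e)" if "A e" "?\<Theta> (correct_pairs F) \<langle>enc e, v\<rangle>" for e v
      using \<Phi>(3)[of e 1] \<Phi>(3)[of e 0] \<Psi>(3)[of e v] \<Psi>'(3)[of e v] that
      by (cases "c e") auto
  qed
qed

lemma computable_from_If [computable_intros]:
  assumes "computable_from F m b A c"
    and "computable_from F m b (\<lambda>e. A e \<and> c e) f" "computable_from F m b (\<lambda>e. A e \<and> \<not> c e) g"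
  shows "computable_from F m b A (\<lambda>e. if c e then f e else g e)"
  using assms(1)
  by (rule computable_from_cases)
    (rule computable_from_cong[OF assms(2)] computable_from_cong[OF assms(3)]; simp)+

lemma computable_from_call:
  assumes "computable_from F m b A h" and "\<And>e. A e \<Longrightarrow> m (h e) < b e"
  shows "computable_from F m b A (\<lambda>e. F (h e))"
proof (rule computable_from_bind[OF assms(1)])
  let ?\<Phi> = "\<lambda>S z. \<langle>psnd (pfst z), psnd z\<rangle> \<in> S"
  show "computable_from F m (\<lambda>p. b (fst p)) (\<lambda>p. A (fst p) \<and> snd p = h (fst p)) (\<lambda>p. F (snd p))"
  proof (rule computable_fromI[of ?\<Phi>])
    show "enumeration_operator ?\<Phi>" by (intro enumeration_operator_member recursive_intros)
    show "?\<Phi> (graph_below F m (b (fst p))) \<langle>enc p, enc (F (snd p))\<rangle>"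
      if "A (fst p) \<and> snd p = h (fst p)" for p
      using that assms(2)[of "fst p"] by (auto simp: graph_below_def)
    show "v = enc (F (snd p))" if "?\<Phi> (correct_pairs F) \<langle>enc p, v\<rangle>" for p v
      using that by (auto simp: correct_pairs_def)
  qed
qed

lemma computable_from_map [computable_intros]:
  assumes "computable_from F m b A xs"
    and "computable_from F m (\<lambda>p. b (fst p)) (\<lambda>p. A (fst p) \<and> snd p \<in> set (xs (fst p)))
      (\<lambda>p. f (fst p) (snd p))"
  shows "computable_from F m b A (\<lambda>e. map (f e) (xs e))"
proof (rule computable_fromE[OF assms(1)], rule computable_fromE[OF assms(2)])
  fix \<Phi> \<Psi>
  assume \<Phi>: "enumeration_operator \<Phi>"
    "\<And>e. A e \<Longrightarrow> \<Phi> (graph_below F m (b e)) \<langle>enc e, enc (xs e)\<rangle>"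
    "\<And>e u. A e \<Longrightarrow> \<Phi> (correct_pairs F) \<langle>enc e, u\<rangle> \<Longrightarrow> u = enc (xs e)"
    and \<Psi>: "enumeration_operator \<Psi>"
    "\<And>p. A (fst p) \<and> snd p \<in> set (xs (fst p)) \<Longrightarrow>
      \<Psi> (graph_below F m (b (fst p))) \<langle>enc p, enc (f (fst p) (snd p))\<rangle>"
    "\<And>p v. A (fst p) \<and> snd p \<in> set (xs (fst p)) \<Longrightarrow>
      \<Psi> (correct_pairs F) \<langle>enc p, v\<rangle> \<Longrightarrow> v = enc (f (fst p) (snd p))"
  let ?all = "\<lambda>S a. list_all2 (\<lambda>x y. \<Psi> S \<langle>\<langle>a, x\<rangle>, y\<rangle>)"
  let ?\<Theta> = "\<lambda>S z. \<exists>u. \<Phi> S \<langle>pfst z, u\<rangle> \<and> ?all S (pfst z) (list_decode u) (list_decode (psnd z))"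
  show ?thesis
  proof (rule computable_fromI[of ?\<Theta>])
    show "enumeration_operator ?\<Theta>"
      by (intro enumeration_operator_intros enumeration_operator_list_all2
          enumeration_operator_comp[OF \<Phi>(1)] enumeration_operator_comp[OF \<Psi>(1)] recursive_intros)
    show "?\<Theta> (graph_below F m (b e)) \<langle>enc e, enc (map (f e) (xs e))\<rangle>" if "A e" for e
    proof -
      have "?all (graph_below F m (b e)) (enc e) (map enc (xs e)) (map enc (map (f e) (xs e)))"
        using \<Psi>(2)[of "(e, _)"] that by (auto simp: list_all2_conv_all_nth)
      then show ?thesis using \<Phi>(2)[OF that] by auto
    qed
    show "v = enc (map (f e) (xs e))"
      if e: "A e" and v: "?\<Theta> (correct_pairs F) \<langle>enc e, v\<rangle>" for e v
    proof -
      obtain u where "\<Phi> (correct_pairs F) \<langle>enc e, u\<rangle>"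
        and all: "?all (correct_pairs F) (enc e) (list_decode u) (list_decode v)"
        using v by auto
      from \<Phi>(3)[OF e this(1)] all
      have "?all (correct_pairs F) (enc e) (map enc (xs e)) (list_decode v)" by simp
      then have "list_decode v = map enc (map (f e) (xs e))"
        using \<Psi>(3)[of "(e, _)"] e by (auto simp: list_all2_conv_all_nth intro!: nth_equalityI)
      then show ?thesis by (metis enc_list_def list_decode_inverse)
    qed
  qed
qed

lemma computable_from_pattern:
  assumes g: "computable_from F m b A g"
    and d: "recursive d" "\<And>a. d (enc (c a)) = enc a"
    and c: "\<And>e. A e \<Longrightarrow> \<exists>a. g e = c a"
    and h: "computable_from F m (\<lambda>p. b (fst p)) A' (\<lambda>p. h (c (snd p)) (fst p))"
    and A': "\<And>e a. A e \<Longrightarrow> g e = c a \<Longrightarrow> A' (e, a)"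
  shows "computable_from F m b A (\<lambda>e. h (g e) e)"
proof -
  obtain k where k: "\<And>e. A e \<Longrightarrow> g e = c (k e)" using c by metis
  have "computable_from F m b A k"
  proof (rule computable_fromE[OF g])
    fix \<Phi>
    assume \<Phi>: "enumeration_operator \<Phi>"
      "\<And>e. A e \<Longrightarrow> \<Phi> (graph_below F m (b e)) \<langle>enc e, enc (g e)\<rangle>"
      "\<And>e u. A e \<Longrightarrow> \<Phi> (correct_pairs F) \<langle>enc e, u\<rangle> \<Longrightarrow> u = enc (g e)"
    let ?\<Theta> = "\<lambda>S z. \<exists>u. \<Phi> S \<langle>pfst z, u\<rangle> \<and> psnd z = d u"
    show ?thesis
    proof (rule computable_fromI[of ?\<Theta>])
      show "enumeration_operator ?\<Theta>"
        by (intro enumeration_operator_intros enumeration_operator_comp[OF \<Phi>(1)]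
            recursive_comp[OF d(1)] recursive_intros)
      show "?\<Theta> (graph_below F m (b e)) \<langle>enc e, enc (k e)\<rangle>" if "A e" for e
        using \<Phi>(2)[OF that] k[OF that] d(2) by auto
      show "v = enc (k e)" if "A e" "?\<Theta> (correct_pairs F) \<langle>enc e, v\<rangle>" for e v
        using \<Phi>(3)[OF that(1)] k[OF that(1)] d(2) that(2) by auto
    qed
  qed
  moreover have "computable_from F m (\<lambda>p. b (fst p)) (\<lambda>p. A (fst p) \<and> snd p = k (fst p))
      (\<lambda>p. h (c (snd p)) (fst p))"
    by (rule computable_from_cong[OF h]) (auto simp: A' k)
  ultimately have "computable_from F m b A (\<lambda>e. h (c (k e)) e)"
    by (rule computable_from_bind)
  then show ?thesis by (rule computable_from_cong) (simp_all add: k)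
qed

abbreviation computable_case ::
  "('a::enc \<Rightarrow> 'b::enc) \<Rightarrow> ('a \<Rightarrow> nat) \<Rightarrow> ('e::enc \<Rightarrow> nat) \<Rightarrow> ('e \<Rightarrow> bool) \<Rightarrow>
    ('e \<Rightarrow> 'd) \<Rightarrow> ('a'::enc \<Rightarrow> 'd) \<Rightarrow> ('d \<Rightarrow> 'e \<Rightarrow> 'c::enc) \<Rightarrow> bool"
  where
  "computable_case F m b A g c h \<equiv> computable_from F m (\<lambda>p. b (fst p))
     (\<lambda>p. A (fst p) \<and> g (fst p) = c (snd p)) (\<lambda>p. h (c (snd p)) (fst p))"

lemma computable_from_list_cases:
  fixes xs :: "'e::enc \<Rightarrow> 'a::enc list"
  assumes xs: "computable_from F m b A xs"
    and "computable_from F m b (\<lambda>e. A e \<and> xs e = []) (\<lambda>e. h [] e)"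
    and "computable_case F m b A xs (\<lambda>a. fst a # snd a) h"
  shows "computable_from F m b A (\<lambda>e. h (xs e) e)"
proof (rule computable_from_cases[where c = "\<lambda>e. xs e = []"])
  have "computable (\<lambda>xs :: 'a list. xs = [])"
  proof (rule computableI_code)
    show "recursive (\<lambda>n. if n = 0 then 1 else 0)"
      by (intro recursive_if decidable_eq recursive_intros)
    show "(if enc xs = 0 then 1 else 0) = enc (xs = [])" for xs :: "'a list"
      by (cases xs) (simp_all add: list_encode.simps)
  qed
  then show "computable_from F m b A (\<lambda>e. xs e = [])" using xs by (rule computable_from_comp)
  show "computable_from F m b (\<lambda>e. A e \<and> xs e = []) (\<lambda>e. h (xs e) e)"
    by (rule computable_from_cong[OF assms(2)]) auto
  show "computable_from F m b (\<lambda>e. A e \<and> xs e \<noteq> []) (\<lambda>e. h (xs e) e)"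
  proof (rule computable_from_pattern[OF computable_from_cong[OF xs], where
        c = "\<lambda>a. fst a # snd a" and d = "\<lambda>n. n - 1"])
    show "computable_case F m b A xs (\<lambda>a. fst a # snd a) h" by fact
    show "recursive (\<lambda>n. n - 1)" by (intro recursive_intros)
    show "\<exists>a. xs e = fst a # snd a" if "A e \<and> xs e \<noteq> []" for e
      using that by (cases "xs e") auto
  qed (auto simp: list_encode.simps)
qed

lemma computable_from_nat_cases:
  assumes n: "computable_from F m b A n"
    and "computable_from F m b (\<lambda>e. A e \<and> n e = 0) (\<lambda>e. h 0 e)"
    and "computable_case F m b A n Suc h"
  shows "computable_from F m b A (\<lambda>e. h (n e) e)"
proof (rule computable_from_cases[where c = "\<lambda>e. n e = 0"])
  have "computable (\<lambda>n :: nat. n = 0)"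
  proof (rule computableI_code)
    show "recursive (\<lambda>n. if n = 0 then 1 else 0)"
      by (intro recursive_if decidable_eq recursive_intros)
  qed simp
  then show "computable_from F m b A (\<lambda>e. n e = 0)" using n by (rule computable_from_comp)
  show "computable_from F m b (\<lambda>e. A e \<and> n e = 0) (\<lambda>e. h (n e) e)"
    by (rule computable_from_cong[OF assms(2)]) auto
  show "computable_from F m b (\<lambda>e. A e \<and> n e \<noteq> 0) (\<lambda>e. h (n e) e)"
  proof (rule computable_from_pattern[OF computable_from_cong[OF n], where
        c = Suc and d = "\<lambda>n. n - 1"])
    show "computable_case F m b A n Suc h" by fact
    show "recursive (\<lambda>n. n - 1)" by (intro recursive_intros)
    show "\<exists>k. n e = Suc k" if "A e \<and> n e \<noteq> 0" for e using that not0_implies_Suc by blast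
  qed auto
qed

lemma computable_eq:
  assumes "inj (enc :: 'a::enc \<Rightarrow> nat)"
  shows "computable (\<lambda>p. fst p = (snd p :: 'a))"
proof (rule computableI_code)
  show "recursive (\<lambda>n. if pfst n = psnd n then 1 else 0)"
    by (intro recursive_if decidable_eq recursive_intros)
qed (simp add: inj_eq[OF assms])

lemma computable_from_split:
  fixes t :: "'e::enc \<Rightarrow> nat"
  assumes t: "computable_from F m b A t"
    and "\<forall>k<n. computable_from F m b (\<lambda>e. A e \<and> t e = k) h"
    and bound: "\<And>e. A e \<Longrightarrow> t e < n"
  shows "computable_from F m b A h"
proof -
  have "computable_from F m b (\<lambda>e. A e \<and> t e < k) h" if "k \<le> n" for k
    using that
  proof (induction k)
    case 0
    show ?case by (rule computable_from_cong[OF computable_from_const]) auto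
  next
    case (Suc k)
    show ?case
    proof (rule computable_from_cases[where c = "\<lambda>e. t e = k"])
      have "computable_from F m b A (\<lambda>e. (t e, k))" by (intro computable_intros t)
      from computable_from_comp[OF computable_eq this]
      show "computable_from F m b (\<lambda>e. A e \<and> t e < Suc k) (\<lambda>e. t e = k)"
        by (rule computable_from_cong) (simp_all add: inj_def)
      show "computable_from F m b (\<lambda>e. (A e \<and> t e < Suc k) \<and> t e = k) h"
        by (rule computable_from_cong[where h = h and A = "\<lambda>e. A e \<and> t e = k"])
          (use assms(2) Suc.prems in auto)
      show "computable_from F m b (\<lambda>e. (A e \<and> t e < Suc k) \<and> t e \<noteq> k) h"
        by (rule computable_from_cong[OF Suc.IH]) (use Suc.prems in auto)
    qed
  qed
  from computable_from_cong[OF this[OF order_refl]] show ?thesis using bound by blast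
qed

lemma computable_from_comp2:
  assumes "computable (\<lambda>p. f (fst p) (snd p))"
    and "computable_from F m b A g" "computable_from F m b A h"
  shows "computable_from F m b A (\<lambda>e. f (g e) (h e))"
  using computable_from_comp[OF assms(1) computable_from_pair[OF assms(2,3)]] by simp

lemma computable_from_comp3:
  assumes "computable (\<lambda>p. f (fst p) (fst (snd p)) (snd (snd p)))"
    and "computable_from F m b A g" "computable_from F m b A h" "computable_from F m b A i"
  shows "computable_from F m b A (\<lambda>e. f (g e) (h e) (i e))"
  using computable_from_comp2[where f = "\<lambda>x y. f x (fst y) (snd y)",
      OF assms(1,2) computable_from_pair[OF assms(3,4)]] by simp

lemma computable_from_comp4:
  assumes "computable (\<lambda>p. f (fst p) (fst (snd p)) (fst (snd (snd p))) (snd (snd (snd p))))"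
    and "computable_from F m b A g" "computable_from F m b A h" "computable_from F m b A i"
      "computable_from F m b A j"
  shows "computable_from F m b A (\<lambda>e. f (g e) (h e) (i e) (j e))"
  using computable_from_comp3[where f = "\<lambda>x y z. f x y (fst z) (snd z)",
      OF assms(1-3) computable_from_pair[OF assms(4,5)]] by simp

lemma computable_from_call2:
  fixes f
  defines "F \<equiv> \<lambda>p. f (fst p) (snd p)"
  assumes "computable_from F m b A g" "computable_from F m b A h"
    and "\<And>e. A e \<Longrightarrow> m (g e, h e) < b e"
  shows "computable_from F m b A (\<lambda>e. f (g e) (h e))"
  using computable_from_call[OF computable_from_pair[OF assms(2,3)] assms(4)] by (simp add: F_def)

lemma computable_from_call3:
  fixes f
  defines "F \<equiv> \<lambda>p. f (fst p) (fst (snd p)) (snd (snd p))"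
  assumes "computable_from F m b A g" "computable_from F m b A h" "computable_from F m b A i"
    and "\<And>e. A e \<Longrightarrow> m (g e, h e, i e) < b e"
  shows "computable_from F m b A (\<lambda>e. f (g e) (h e) (i e))"
  using computable_from_call[OF
      computable_from_pair[OF assms(2) computable_from_pair[OF assms(3,4)]] assms(5)]
  by (simp add: F_def)

lemma computable_from_call4:
  fixes f
  defines "F \<equiv> \<lambda>p. f (fst p) (fst (snd p)) (fst (snd (snd p))) (snd (snd (snd p)))"
  assumes "computable_from F m b A g" "computable_from F m b A h" "computable_from F m b A i"
      "computable_from F m b A j"
    and "\<And>e. A e \<Longrightarrow> m (g e, h e, i e, j e) < b e"
  shows "computable_from F m b A (\<lambda>e. f (g e) (h e) (i e) (j e))"
  using computable_from_call[OF computable_from_pair[OF assms(2) computable_from_pair[OF assms(3)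
        computable_from_pair[OF assms(4,5)]]] assms(6)]
  by (simp add: F_def)

lemma computable_fst: "computable fst"
  by (rule computableI_code[of pfst]) (simp_all add: recursive_intros)

lemma computable_snd: "computable snd"
  by (rule computableI_code[of psnd]) (simp_all add: recursive_intros)

lemma computable_Suc: "computable Suc"
  by (rule computableI_code[of Suc]) (simp_all add: recursive_intros)

lemma computable_pfst: "computable pfst"
  by (rule computableI_code[of pfst]) (simp_all add: recursive_intros)

lemma computable_psnd: "computable psnd"
  by (rule computableI_code[of psnd]) (simp_all add: recursive_intros)

lemma computable_prod_encode: "computable prod_encode"
  by (rule computableI_code[of "\<lambda>n. n"]) (simp_all add: recursive_intros)

lemma map_enc_nat [simp]: "map enc xs = xs" for xs :: "nat list"
  by (induction xs) simp_all

lemma computable_list_encode: "computable list_encode"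
  by (rule computableI_code[of "\<lambda>n. n"]) (simp_all add: recursive_intros)

lemma computable_list_decode: "computable list_decode"
  by (rule computableI_code[of "\<lambda>n. n"]) (simp_all add: recursive_intros)

lemma computable_of_bool: "computable (of_bool :: bool \<Rightarrow> nat)"
  by (rule computableI_code[of "\<lambda>n. n"]) (simp_all add: recursive_intros)

lemma computable_Cons: "computable (\<lambda>p. fst p # (snd p :: 'a::enc list))"
  by (rule computableI_code[of Suc]) (simp_all add: recursive_intros list_encode.simps)

lemma computable_eq_nat: "computable (\<lambda>p. fst p = (snd p :: nat))"
  by (rule computable_eq) (simp add: inj_def)

lemma computable_eq_bool: "computable (\<lambda>p. fst p = (snd p :: bool))"
  by (rule computable_eq) (simp add: inj_def)

lemmas [computable_intros] =
  computable_from_comp[OF computable_fst] computable_from_comp[OF computable_snd]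
  computable_from_comp[OF computable_Suc] computable_from_comp[OF computable_prod_encode]
  computable_from_comp[OF computable_pfst] computable_from_comp[OF computable_psnd]
  computable_from_comp[OF computable_list_encode] computable_from_comp[OF computable_list_decode]
  computable_from_comp[OF computable_of_bool] computable_from_comp2[OF computable_Cons]
  computable_from_comp2[OF computable_eq_nat] computable_from_comp2[OF computable_eq_bool]

lemma computable_from_conj [computable_intros]:
  assumes "computable_from F m b A P" "computable_from F m b (\<lambda>e. A e \<and> P e) Q"
  shows "computable_from F m b A (\<lambda>e. P e \<and> Q e)"
proof -
  have "computable_from F m b A (\<lambda>e. if P e then Q e else False)"
    by (intro computable_intros assms)
  then show ?thesis by (rule computable_from_cong) auto
qed

lemma computable_from_disj [computable_intros]:
  assumes "computable_from F m b A P" "computable_from F m b (\<lambda>e. A e \<and> \<not> P e) Q"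
  shows "computable_from F m b A (\<lambda>e. P e \<or> Q e)"
proof -
  have "computable_from F m b A (\<lambda>e. if P e then True else Q e)"
    by (intro computable_intros assms)
  then show ?thesis by (rule computable_from_cong) auto
qed

lemma computable_from_imp [computable_intros]:
  assumes "computable_from F m b A P" "computable_from F m b (\<lambda>e. A e \<and> P e) Q"
  shows "computable_from F m b A (\<lambda>e. P e \<longrightarrow> Q e)"
proof -
  have "computable_from F m b A (\<lambda>e. if P e then Q e else True)"
    by (intro computable_intros assms)
  then show ?thesis by (rule computable_from_cong) auto
qed

lemma computable_from_not [computable_intros]:
  assumes "computable_from F m b A P"
  shows "computable_from F m b A (\<lambda>e. \<not> P e)"
proof -
  have "computable_from F m b A (\<lambda>e. if P e then False else True)"
    by (intro computable_intros assms)
  then show ?thesis by (rule computable_from_cong) auto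
qed

lemma computable_append: "computable (\<lambda>p. fst p @ (snd p :: 'a::enc list))"
  by (rule computable_recursion[where m = "\<lambda>p. length (fst p)"],
      rule computable_from_list_cases[where xs = fst and h = "\<lambda>xs p. xs @ snd p"],
      unfold append.simps)
    (intro computable_intros computable_from_call2[where f = "(@)"]; simp)+

lemmas [computable_intros] = computable_from_comp2[OF computable_append]

lemma computable_concat: "computable (concat :: 'a::enc list list \<Rightarrow> 'a list)"
  by (rule computable_recursion[where m = length],
      rule computable_from_list_cases[where xs = "\<lambda>xss. xss" and h = "\<lambda>xss e. concat xss"],
      unfold concat.simps)
    (intro computable_intros computable_from_call[where F = concat]; simp)+

lemmas [computable_intros] = computable_from_comp[OF computable_concat]

lemma computable_from_filter [computable_intros]:
  fixes xs :: "'e::enc \<Rightarrow> 'a::enc list"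
  assumes "computable_from F m b A xs"
    and "computable_from F m (\<lambda>p. b (fst p)) (\<lambda>p. A (fst p) \<and> snd p \<in> set (xs (fst p)))
      (\<lambda>p. P (fst p) (snd p))"
  shows "computable_from F m b A (\<lambda>e. filter (P e) (xs e))"
proof -
  have "computable_from F m b A (\<lambda>e. concat (map (\<lambda>x. if P e x then [x] else []) (xs e)))"
    by (intro computable_intros assms)
  moreover have "concat (map (\<lambda>x. if Q x then [x] else []) ys) = filter Q ys"
    for Q and ys :: "'a list"
    by (induction ys) auto
  ultimately show ?thesis by simp
qed

lemma computable_from_Bex [computable_intros]:
  assumes "computable_from F m b A xs"
    and "computable_from F m (\<lambda>p. b (fst p)) (\<lambda>p. A (fst p) \<and> snd p \<in> set (xs (fst p)))
      (\<lambda>p. P (fst p) (snd p))"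
  shows "computable_from F m b A (\<lambda>e. \<exists>x\<in>set (xs e). P e x)"
proof -
  have "computable_from F m b A (\<lambda>e. filter (P e) (xs e) \<noteq> [])"
    by (rule computable_from_list_cases[where xs = "\<lambda>e. filter (P e) (xs e)" and
          h = "\<lambda>ys e. ys \<noteq> []"])
      (simp_all add: computable_from_const computable_from_filter assms)
  then show ?thesis by (rule computable_from_cong) (simp_all add: filter_empty_conv)
qed

lemma computable_subseqs: "computable (subseqs :: 'a::enc list \<Rightarrow> 'a list list)"
  by (rule computable_recursion[where m = length],
      rule computable_from_list_cases[where xs = "\<lambda>xs. xs" and h = "\<lambda>xs e. subseqs xs"],
      unfold subseqs.simps Let_def)
    (intro computable_intros computable_from_call[where F = subseqs]; simp)+

lemma computable_product_lists: "computable (product_lists :: 'a::enc list list \<Rightarrow> 'a list list)"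
  by (rule computable_recursion[where m = length],
      rule computable_from_list_cases[where xs = "\<lambda>xss. xss" and h = "\<lambda>xss e. product_lists xss"],
      unfold product_lists.simps)
    (intro computable_intros computable_from_call[where F = product_lists]; simp)+

lemma computable_replicate: "computable (\<lambda>p. replicate (fst p) (snd p :: 'a::enc))"
  by (rule computable_recursion[where m = fst],
      rule computable_from_nat_cases[where n = fst and h = "\<lambda>n p. replicate n (snd p)"],
      unfold replicate.simps)
    (intro computable_intros computable_from_call2[where f = replicate]; simp)+

section \<open>Realizers\<close>

type_synonym ind_assignment = "nat \<Rightarrow> nat"
type_synonym pred_assignment = "nat \<Rightarrow> nat \<Rightarrow> bool"

primrec realizer :: "form \<Rightarrow> (nat \<Rightarrow> move) \<Rightarrow> ind_assignment \<Rightarrow> pred_assignment \<Rightarrow> bool" where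
  "realizer (Eq x y) R \<kappa> \<sigma> \<longleftrightarrow> R = (\<lambda>n. Star) \<and> \<kappa> x = \<kappa> y"
| "realizer (Le x y) R \<kappa> \<sigma> \<longleftrightarrow> R = (\<lambda>n. Star) \<and> \<kappa> x \<le> \<kappa> y"
| "realizer (Sc x y) R \<kappa> \<sigma> \<longleftrightarrow> R = (\<lambda>n. Star) \<and> \<kappa> y = Suc (\<kappa> x)"
| "realizer (Zero x) R \<kappa> \<sigma> \<longleftrightarrow> R = (\<lambda>n. Star) \<and> \<kappa> x = 0"
| "realizer (Mem x X) R \<kappa> \<sigma> \<longleftrightarrow> R = (\<lambda>n. Star) \<and> \<sigma> X (\<kappa> x)"
| "realizer Top R \<kappa> \<sigma> \<longleftrightarrow> R = (\<lambda>n. Star)"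
| "realizer Bot R \<kappa> \<sigma> \<longleftrightarrow> False"
| "realizer (And \<phi> \<psi>) R \<kappa> \<sigma> \<longleftrightarrow>
     (\<exists>R1 R2. R = (\<lambda>n. MPair (R1 n) (R2 n)) \<and> realizer \<phi> R1 \<kappa> \<sigma> \<and> realizer \<psi> R2 \<kappa> \<sigma>)"
| "realizer (Neg \<phi>) R \<kappa> \<sigma> \<longleftrightarrow> R = (\<lambda>n. Star) \<and> (\<forall>R'. \<not> realizer \<phi> R' \<kappa> \<sigma>)"
| "realizer (ExI \<phi>) R \<kappa> \<sigma> \<longleftrightarrow> (\<exists>k R'. R = (\<lambda>n. MPair (Bit (n = k)) (MPair Star (R' n))) \<and>
     realizer \<phi> R' (case_nat k \<kappa>) \<sigma>)"
| "realizer (ExP \<phi>) R \<kappa> \<sigma> \<longleftrightarrow> (\<exists>S R'. R = (\<lambda>n. MPair (Bit (S n)) (R' n)) \<and>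
     realizer \<phi> R' \<kappa> (case_nat S \<sigma>))"

definition sat :: "form \<Rightarrow> ind_assignment \<Rightarrow> pred_assignment \<Rightarrow> bool" where
  "sat \<phi> \<kappa> \<sigma> \<longleftrightarrow> (\<exists>R. realizer \<phi> R \<kappa> \<sigma>)"

lemma sat_simps [simp]:
  "sat (Eq x y) \<kappa> \<sigma> \<longleftrightarrow> \<kappa> x = \<kappa> y"
  "sat (Le x y) \<kappa> \<sigma> \<longleftrightarrow> \<kappa> x \<le> \<kappa> y"
  "sat (Sc x y) \<kappa> \<sigma> \<longleftrightarrow> \<kappa> y = Suc (\<kappa> x)"
  "sat (Zero x) \<kappa> \<sigma> \<longleftrightarrow> \<kappa> x = 0"
  "sat (Mem x X) \<kappa> \<sigma> \<longleftrightarrow> \<sigma> X (\<kappa> x)"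
  "sat Top \<kappa> \<sigma>"
  "\<not> sat Bot \<kappa> \<sigma>"
  "sat (And \<phi> \<psi>) \<kappa> \<sigma> \<longleftrightarrow> sat \<phi> \<kappa> \<sigma> \<and> sat \<psi> \<kappa> \<sigma>"
  "sat (Neg \<phi>) \<kappa> \<sigma> \<longleftrightarrow> \<not> sat \<phi> \<kappa> \<sigma>"
  "sat (ExI \<phi>) \<kappa> \<sigma> \<longleftrightarrow> (\<exists>k. sat \<phi> (case_nat k \<kappa>) \<sigma>)"
  "sat (ExP \<phi>) \<kappa> \<sigma> \<longleftrightarrow> (\<exists>S. sat \<phi> \<kappa> (case_nat S \<sigma>))"
  unfolding sat_def by auto

lemma realizer_imp_sat: "realizer \<phi> R \<kappa> \<sigma> \<Longrightarrow> sat \<phi> \<kappa> \<sigma>"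
  unfolding sat_def by blast

lemma realizer_cong:
  "(\<And>i. i \<in> fvi \<phi> \<Longrightarrow> \<kappa> i = \<kappa>' i) \<Longrightarrow> (\<And>X. X \<in> fvp \<phi> \<Longrightarrow> \<sigma> X = \<sigma>' X) \<Longrightarrow>
    realizer \<phi> R \<kappa> \<sigma> \<longleftrightarrow> realizer \<phi> R \<kappa>' \<sigma>'"
proof (induction \<phi> arbitrary: R \<kappa> \<kappa>' \<sigma> \<sigma>')
  case (And \<phi> \<psi>)
  have "realizer \<phi> R \<kappa> \<sigma> \<longleftrightarrow> realizer \<phi> R \<kappa>' \<sigma>'" "realizer \<psi> R \<kappa> \<sigma> \<longleftrightarrow> realizer \<psi> R \<kappa>' \<sigma>'" for R
    using And.prems by (auto intro!: And.IH)
  then show ?case by simp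
next
  case (Neg \<phi>)
  have "realizer \<phi> R \<kappa> \<sigma> \<longleftrightarrow> realizer \<phi> R \<kappa>' \<sigma>'" for R
    using Neg.prems by (auto intro!: Neg.IH)
  then show ?case by simp
next
  case (ExI \<phi>)
  have "realizer \<phi> R (case_nat k \<kappa>) \<sigma> \<longleftrightarrow> realizer \<phi> R (case_nat k \<kappa>') \<sigma>'" for k R
    by (rule ExI.IH) (use ExI.prems in \<open>auto split: nat.splits\<close>)
  then show ?case by simp
next
  case (ExP \<phi>)
  have "realizer \<phi> R \<kappa> (case_nat S \<sigma>) \<longleftrightarrow> realizer \<phi> R \<kappa>' (case_nat S \<sigma>')" for S R
    by (rule ExP.IH) (use ExP.prems in \<open>auto split: nat.splits\<close>)
  then show ?case by simp
qed auto

lemma sat_cong: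
  assumes "\<And>i. i \<in> fvi \<phi> \<Longrightarrow> \<kappa> i = \<kappa>' i" "\<And>X. X \<in> fvp \<phi> \<Longrightarrow> \<sigma> X = \<sigma>' X"
  shows "sat \<phi> \<kappa> \<sigma> \<longleftrightarrow> sat \<phi> \<kappa>' \<sigma>'"
  using realizer_cong[of \<phi> \<kappa> \<kappa>' \<sigma> \<sigma>'] assms unfolding sat_def by simp

lemma case_nat_up: "(\<lambda>i. case_nat k \<kappa> (up f i)) = case_nat k (\<lambda>i. \<kappa> (f i))"
  by (auto simp: up_def fun_eq_iff split: nat.splits)

lemma case_nat_case_nat_id: "(\<lambda>i. \<kappa> (case_nat t id i)) = case_nat (\<kappa> t) \<kappa>"
  by (auto simp: fun_eq_iff split: nat.splits)

lemma realizer_ren: "realizer (ren f g \<phi>) R \<kappa> \<sigma> \<longleftrightarrow> realizer \<phi> R (\<lambda>i. \<kappa> (f i)) (\<lambda>i. \<sigma> (g i))"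
  by (induction \<phi> arbitrary: f g R \<kappa> \<sigma>) (auto simp: case_nat_up)

lemma realizer_substi: "realizer (substi x t \<phi>) R \<kappa> \<sigma> \<longleftrightarrow> realizer \<phi> R (\<kappa>(x := \<kappa> t)) \<sigma>"
proof -
  have "(\<lambda>i. \<kappa> ((id(x := t)) i)) = \<kappa>(x := \<kappa> t)" by auto
  then show ?thesis by (simp add: substi_def realizer_ren)
qed

lemma realizer_insti: "realizer (insti t \<phi>) R \<kappa> \<sigma> \<longleftrightarrow> realizer \<phi> R (case_nat (\<kappa> t) \<kappa>) \<sigma>"
  by (simp add: insti_def realizer_ren case_nat_case_nat_id)

lemma realizer_instp: "realizer (instp Y \<phi>) R \<kappa> \<sigma> \<longleftrightarrow> realizer \<phi> R \<kappa> (case_nat (\<sigma> Y) \<sigma>)"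
  by (simp add: instp_def realizer_ren case_nat_case_nat_id)

lemma sat_ren: "sat (ren f g \<phi>) \<kappa> \<sigma> \<longleftrightarrow> sat \<phi> (\<lambda>i. \<kappa> (f i)) (\<lambda>i. \<sigma> (g i))"
  by (simp add: sat_def realizer_ren)

lemma sat_substi: "sat (substi x t \<phi>) \<kappa> \<sigma> \<longleftrightarrow> sat \<phi> (\<kappa>(x := \<kappa> t)) \<sigma>"
  by (simp add: sat_def realizer_substi)

lemma sat_insti: "sat (insti t \<phi>) \<kappa> \<sigma> \<longleftrightarrow> sat \<phi> (case_nat (\<kappa> t) \<kappa>) \<sigma>"
  by (simp add: sat_def realizer_insti)

lemma sat_instp: "sat (instp Y \<phi>) \<kappa> \<sigma> \<longleftrightarrow> sat \<phi> \<kappa> (case_nat (\<sigma> Y) \<sigma>)"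
  by (simp add: sat_def realizer_instp)

text \<open>
  \<open>coerce \<phi>\<close> retracts the moves onto \<open>M \<phi>\<close>.  It makes the outputs of the machine below well typed
  for every tree of sequents, and it forgets the moves of a formula that has been substituted for
  an atom \<open>x \<in> X\<close>.
\<close>

fun move_bit :: "move \<Rightarrow> bool" where
  "move_bit (Bit b) = b"
| "move_bit _ = False"

fun move_fst :: "move \<Rightarrow> move" where
  "move_fst (MPair m m') = m"
| "move_fst _ = Star"

fun move_snd :: "move \<Rightarrow> move" where
  "move_snd (MPair m m') = m'"
| "move_snd _ = Star"

fun coerce :: "form \<Rightarrow> move \<Rightarrow> move" where
  "coerce (And \<phi> \<psi>) m = MPair (coerce \<phi> (move_fst m)) (coerce \<psi> (move_snd m))"
| "coerce (ExI \<phi>) m =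
     MPair (Bit (move_bit (move_fst m))) (MPair Star (coerce \<phi> (move_snd (move_snd m))))"
| "coerce (ExP \<phi>) m = MPair (Bit (move_bit (move_fst m))) (coerce \<phi> (move_snd m))"
| "coerce _ m = Star"

lemma coerce_in_M: "coerce \<phi> m \<in> M \<phi>"
  by (induction \<phi> arbitrary: m) auto

lemma coerce_id_on_M: "m \<in> M \<phi> \<Longrightarrow> coerce \<phi> m = m"
  by (induction \<phi> arbitrary: m) auto

lemma realizer_in_M: "realizer \<phi> R \<kappa> \<sigma> \<Longrightarrow> R n \<in> M \<phi>"
  by (induction \<phi> arbitrary: R \<kappa> \<sigma>) auto

lemma realizer_coerce: "realizer \<phi> R \<kappa> \<sigma> \<Longrightarrow> realizer \<phi> (\<lambda>n. coerce \<phi> (R n)) \<kappa> \<sigma>"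
  by (simp add: coerce_id_on_M[OF realizer_in_M])

lemma deterministic_realizer:
  assumes "deterministic \<delta>" "sat \<delta> \<kappa> \<sigma>" "\<And>n. R n \<in> M \<delta>"
  shows "realizer \<delta> R \<kappa> \<sigma>"
  using assms
proof (induction \<delta> arbitrary: R)
  case (And \<delta>1 \<delta>2)
  have R: "R n = MPair (move_fst (R n)) (move_snd (R n))" "move_fst (R n) \<in> M \<delta>1"
    "move_snd (R n) \<in> M \<delta>2" for n
    using And.prems(3)[of n] by auto
  have "realizer \<delta>1 (\<lambda>n. move_fst (R n)) \<kappa> \<sigma>" "realizer \<delta>2 (\<lambda>n. move_snd (R n)) \<kappa> \<sigma>"
    using And R(2,3) by auto
  moreover have "R = (\<lambda>n. MPair (move_fst (R n)) (move_snd (R n)))" using R(1) by (rule ext)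
  ultimately show ?case unfolding realizer.simps by (intro exI conjI)
qed (auto simp: sat_def)

definition insert_at :: "nat \<Rightarrow> 'a \<Rightarrow> (nat \<Rightarrow> 'a) \<Rightarrow> nat \<Rightarrow> 'a" where
  "insert_at X S \<sigma> i = (if i < X then \<sigma> i else if i = X then S else \<sigma> (i - 1))"

lemma insert_at_0: "insert_at 0 S \<sigma> = case_nat S \<sigma>"
  by (auto simp: insert_at_def fun_eq_iff split: nat.splits)

lemma insert_at_Suc: "insert_at (Suc X) S (case_nat T \<sigma>) = case_nat T (insert_at X S \<sigma>)"
  by (auto simp: insert_at_def fun_eq_iff split: nat.splits)

lemma sat_substp:
  "sat (substp X \<psi> \<phi>) \<kappa> \<sigma> \<longleftrightarrow> sat \<phi> \<kappa> (insert_at X (\<lambda>n. sat \<psi> (case_nat n \<kappa>) \<sigma>) \<sigma>)"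
proof (induction \<phi> arbitrary: X \<psi> \<kappa> \<sigma>)
  case (Mem x Y)
  show ?case by (auto simp: insert_at_def sat_insti)
next
  case (ExI \<phi>)
  then show ?case by (simp add: sat_ren case_nat_up)
next
  case (ExP \<phi>)
  then show ?case by (simp add: sat_ren insert_at_Suc)
qed auto

lemma realizer_substp:
  "realizer (substp X \<psi> \<phi>) R \<kappa> \<sigma> \<Longrightarrow>
    realizer \<phi> (\<lambda>n. coerce \<phi> (R n)) \<kappa> (insert_at X (\<lambda>n. sat \<psi> (case_nat n \<kappa>) \<sigma>) \<sigma>)"
proof (induction \<phi> arbitrary: X \<psi> R \<kappa> \<sigma>)
  case (Mem x Y)
  then show ?case
    by (auto simp: insert_at_def realizer_insti dest: realizer_imp_sat split: if_splits)
next
  case (And \<phi>1 \<phi>2)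
  then show ?case by fastforce
next
  case (Neg \<phi>)
  then show ?case using sat_substp[of X \<psi> \<phi> \<kappa> \<sigma>] by (simp add: sat_def)
next
  case (ExI \<phi>)
  then obtain k R' where R: "R = (\<lambda>n. MPair (Bit (n = k)) (MPair Star (R' n)))"
    and realizer: "realizer (substp X (ren (up Suc) id \<psi>) \<phi>) R' (case_nat k \<kappa>) \<sigma>" by auto
  from ExI.IH[OF realizer] show ?case by (auto simp: R sat_ren case_nat_up)
next
  case (ExP \<phi>)
  then obtain S R' where R: "R = (\<lambda>n. MPair (Bit (S n)) (R' n))"
    and realizer: "realizer (substp (Suc X) (ren id Suc \<psi>) \<phi>) R' \<kappa> (case_nat S \<sigma>)" by auto
  from ExP.IH[OF realizer] show ?case by (auto simp: R sat_ren insert_at_Suc)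
qed auto

subsection \<open>Accepting runs of interpretations\<close>

lemma det_accepting_run:
  assumes "moves A = {Star}" "range w \<subseteq> \<Sigma>"
  shows "accepting_run R A w \<longleftrightarrow> R = (\<lambda>n. Star) \<and> w \<in> language \<Sigma> A"
proof -
  have "range R \<subseteq> {Star} \<longleftrightarrow> R = (\<lambda>n. Star)" for R :: "nat \<Rightarrow> move"
    by (auto simp: fun_eq_iff)
  then show ?thesis using assms by (auto simp: accepting_run_def language_def)
qed

lemma accepting_run_sync_product:
  "accepting_run R (sync_product B C) w \<longleftrightarrow>
    (\<exists>R1 R2. R = (\<lambda>n. MPair (R1 n) (R2 n)) \<and> accepting_run R1 B w \<and> accepting_run R2 C w)"
proof -
  have "state_seq (sync_product B C) w (\<lambda>n. MPair (R1 n) (R2 n)) n =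
      \<langle>state_seq B w R1 n, state_seq C w R2 n\<rangle>" for R1 R2 n
    by (induction n) (auto simp: sync_product_def)
  then have acc: "state_seq (sync_product B C) w (\<lambda>n. MPair (R1 n) (R2 n)) \<in>
      accepting (sync_product B C) \<longleftrightarrow> state_seq B w R1 \<in> accepting B \<and> state_seq C w R2 \<in> accepting C"
    for R1 R2
    by (simp add: sync_product_def)
  have pair: "accepting_run (\<lambda>n. MPair (R1 n) (R2 n)) (sync_product B C) w \<longleftrightarrow>
      accepting_run R1 B w \<and> accepting_run R2 C w" for R1 R2
    unfolding accepting_run_def acc by (auto simp: sync_product_def image_subset_iff)
  have "\<exists>R1 R2. R = (\<lambda>n. MPair (R1 n) (R2 n))" if "accepting_run R (sync_product B C) w"
  proof -
    have "R n \<in> moves (sync_product B C)" for n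
      using that by (simp add: accepting_run_def image_subset_iff)
    then have "\<forall>n. \<exists>m m'. R n = MPair m m'" unfolding sync_product_def by simp metis
    then show ?thesis unfolding choice_iff fun_eq_iff .
  qed
  then show ?thesis using pair by auto
qed

definition project :: "(bool \<Rightarrow> letter \<Rightarrow> letter) \<Rightarrow> letter uaut \<Rightarrow> letter uaut" where
  "project ext A =
     A \<lparr> moves := {MPair (Bit b) m | b m. m \<in> moves A},
         step := (\<lambda>q a m. case m of MPair (Bit b) m' \<Rightarrow> step A q (ext b a) m' | _ \<Rightarrow> q) \<rparr>"

lemma project_ind_eq_project: "project_ind = project (\<lambda>b (xs, Xs). (b # xs, Xs))"
  by (auto simp: project_ind_def project_def fun_eq_iff split: move.splits prod.splits)

lemma project_pred_eq_project: "project_pred = project (\<lambda>b (xs, Xs). (xs, b # Xs))"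
  by (auto simp: project_pred_def project_def fun_eq_iff split: move.splits prod.splits)

lemma accepting_run_project:
  "accepting_run R (project ext A) w \<longleftrightarrow>
    (\<exists>S R'. R = (\<lambda>n. MPair (Bit (S n)) (R' n)) \<and> accepting_run R' A (\<lambda>n. ext (S n) (w n)))"
proof -
  have "state_seq (project ext A) w (\<lambda>n. MPair (Bit (S n)) (R' n)) n =
      state_seq A (\<lambda>n. ext (S n) (w n)) R' n" for S R' n
    by (induction n) (simp_all add: project_def)
  then have state_seq: "state_seq (project ext A) w (\<lambda>n. MPair (Bit (S n)) (R' n)) =
      state_seq A (\<lambda>n. ext (S n) (w n)) R'" for S R' by blast
  have pair: "accepting_run (\<lambda>n. MPair (Bit (S n)) (R' n)) (project ext A) w \<longleftrightarrow>
      accepting_run R' A (\<lambda>n. ext (S n) (w n))" for S R'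
    unfolding accepting_run_def state_seq by (auto simp: project_def image_subset_iff)
  have "\<exists>S R'. R = (\<lambda>n. MPair (Bit (S n)) (R' n))" if "accepting_run R (project ext A) w"
  proof -
    have "R n \<in> moves (project ext A)" for n
      using that by (simp add: accepting_run_def image_subset_iff)
    then have "\<forall>n. \<exists>b m. R n = MPair (Bit b) m" unfolding project_def by simp metis
    then show ?thesis unfolding choice_iff fun_eq_iff .
  qed
  then show ?thesis using pair by auto
qed

lemma range_word: "length ks = l \<Longrightarrow> length \<sigma>s = p \<Longrightarrow> range (word ks \<sigma>s) \<subseteq> alphabet l p"
  by (auto simp: word_def alphabet_def)

lemma nth_Cons_case_nat: "(!) (x # xs) = case_nat x ((!) xs)"
  by (auto simp: fun_eq_iff split: nat.splits)

lemma accepting_run_atom_automaton: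
  assumes "atom_automaton l p P A" "length ks = l" "length \<sigma>s = p"
  shows "accepting_run R A (word ks \<sigma>s) \<longleftrightarrow> R = (\<lambda>n. Star) \<and> P ks \<sigma>s"
  using assms det_accepting_run[of A "word ks \<sigma>s" "alphabet l p" R] range_word[of ks l \<sigma>s p]
  by (auto simp: atom_automaton_def det_automaton_def)

lemma accepting_run_singleton_automaton:
  assumes "singleton_automaton l p A" "range w \<subseteq> alphabet (Suc l) p"
  shows "accepting_run R A w \<longleftrightarrow> R = (\<lambda>n. Star) \<and> (\<exists>k. \<forall>n. hd (fst (w n)) \<longleftrightarrow> n = k)"
  using assms det_accepting_run[OF _ assms(2), of A R]
  by (auto simp: singleton_automaton_def det_automaton_def)

lemma accepting_run_interp_ExI:
  assumes S: "singleton_automaton l p S" and len: "length ks = l" "length \<sigma>s = p"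
  shows "accepting_run R (project_ind (sync_product S B)) (word ks \<sigma>s) \<longleftrightarrow>
    (\<exists>k R'. R = (\<lambda>n. MPair (Bit (n = k)) (MPair Star (R' n))) \<and>
      accepting_run R' B (word (k # ks) \<sigma>s))"
proof -
  let ?ext = "\<lambda>\<beta> n. (\<beta> n # fst (word ks \<sigma>s n), snd (word ks \<sigma>s n))"
  have "range (?ext \<beta>) \<subseteq> alphabet (Suc l) p" for \<beta>
    using len by (auto simp: word_def alphabet_def)
  from accepting_run_singleton_automaton[OF S this]
  have "accepting_run R1 S (?ext \<beta>) \<longleftrightarrow> R1 = (\<lambda>n. Star) \<and> (\<exists>k. \<beta> = (\<lambda>n. n = k))" for R1 \<beta>
    by (simp add: fun_eq_iff)
  moreover have "?ext (\<lambda>n. n = k) = word (k # ks) \<sigma>s" for k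
    by (simp add: word_def fun_eq_iff)
  ultimately show ?thesis
    unfolding project_ind_eq_project accepting_run_project accepting_run_sync_product
    by (auto simp: split_beta) metis+
qed

theorem accepting_run_interp:
  assumes "interp \<phi> l p A" "length ks = l" "length \<sigma>s = p"
  shows "accepting_run R A (word ks \<sigma>s) \<longleftrightarrow> realizer \<phi> R ((!) ks) ((!) \<sigma>s)"
  using assms
proof (induction \<phi> arbitrary: l p A ks \<sigma>s R)
  case (And \<phi> \<psi>)
  then obtain B C where "interp \<phi> l p B" "interp \<psi> l p C" "A = sync_product B C" by auto
  then show ?case using And by (simp add: accepting_run_sync_product)
next
  case (Neg \<phi>)
  then obtain B where B: "interp \<phi> l p B" and A: "moves A = {Star}"
    and lang: "language (alphabet l p) A =
      {w. range w \<subseteq> alphabet l p \<and> w \<notin> language (alphabet l p) B}"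
    by (auto simp: det_automaton_def)
  have w: "range (word ks \<sigma>s) \<subseteq> alphabet l p" using Neg.prems by (simp add: range_word)
  then have "word ks \<sigma>s \<in> language (alphabet l p) B \<longleftrightarrow> (\<exists>R. realizer \<phi> R ((!) ks) ((!) \<sigma>s))"
    using Neg.IH[OF B Neg.prems(2,3)] by (auto simp: language_def)
  then show ?case using det_accepting_run[OF A w] lang w by simp
next
  case (ExI \<phi>)
  then obtain S B where S: "singleton_automaton l p S" and B: "interp \<phi> (Suc l) p B"
    and A: "A = project_ind (sync_product S B)" by auto
  show ?case
    using ExI.IH[OF B, of "_ # ks" \<sigma>s] ExI.prems(2,3)
    by (simp add: A accepting_run_interp_ExI[OF S] nth_Cons_case_nat)
next
  case (ExP \<phi>)
  then obtain B where B: "interp \<phi> l (Suc p) B" and A: "A = project_pred B" by auto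
  have "(\<lambda>n. case word ks \<sigma>s n of (xs, Xs) \<Rightarrow> (xs, S n # Xs)) = word ks (S # \<sigma>s)" for S
    by (simp add: word_def fun_eq_iff)
  then show ?case
    using ExP.IH[OF B, of ks "_ # \<sigma>s"] ExP.prems(2,3)
    by (simp add: A project_pred_eq_project accepting_run_project nth_Cons_case_nat)
qed (simp_all add: accepting_run_atom_automaton)

section \<open>Formulae on initial segments\<close>

abbreviation bit_at :: "bool list \<Rightarrow> nat \<Rightarrow> bool" where
  "bit_at \<equiv> nth_default False"

definition pairs :: "nat list \<Rightarrow> nat list \<Rightarrow> nat list" where
  "pairs xs ys = map prod_encode (List.product xs ys)"

lemma pair_in_pairs [simp]: "\<langle>x, y\<rangle> \<in> set (pairs xs ys) \<longleftrightarrow> x \<in> set xs \<and> y \<in> set ys"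
  by (auto simp: pairs_def)

lemma in_pairs_iff: "s \<in> set (pairs xs ys) \<longleftrightarrow> pfst s \<in> set xs \<and> psnd s \<in> set ys"
  by (metis pair_in_pairs pair_pfst_psnd)

definition subset_step :: "nat list \<Rightarrow> (bool \<Rightarrow> nat \<Rightarrow> nat) \<Rightarrow> nat \<Rightarrow> nat" where
  "subset_step U \<delta> s =
     list_encode (filter (\<lambda>u. \<exists>b\<in>set [False, True]. \<exists>t\<in>set (list_decode s). u = \<delta> b t) U)"

definition succ_capped :: "nat \<Rightarrow> nat" where
  "succ_capped c = (if c = 0 then 1 else 2)"

abbreviation atom_state :: "bool \<Rightarrow> bool \<Rightarrow> nat" where
  "atom_state history ok \<equiv> \<langle>of_bool history, of_bool ok\<rangle>"

text \<open>
  A deterministic automaton deciding a formula on the finite words that encode an initial segment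
  of the natural numbers.  The state of an atom consists of a history bit and a bit saying that
  the atom is not yet refuted.  For quantifiers the subset construction is used; a state of
  \<open>ExI \<phi>\<close> is a set of pairs of the number of ones guessed so far on the new track, where 2 stands
  for "at least 2", and a state of \<open>\<phi>\<close>.  Sets of states are coded as sublists of a fixed list, so
  that each set has one code.
\<close>

fun seg_states :: "form \<Rightarrow> nat list" where
  "seg_states (And \<phi> \<psi>) = pairs (seg_states \<phi>) (seg_states \<psi>)"
| "seg_states (Neg \<phi>) = seg_states \<phi>"
| "seg_states (ExI \<phi>) = map list_encode (subseqs (pairs [0, 1, 2] (seg_states \<phi>)))"
| "seg_states (ExP \<phi>) = map list_encode (subseqs (seg_states \<phi>))"
| "seg_states _ = pairs [0, 1] [0, 1]"

fun seg_init :: "form \<Rightarrow> nat" where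
  "seg_init (And \<phi> \<psi>) = \<langle>seg_init \<phi>, seg_init \<psi>\<rangle>"
| "seg_init (Neg \<phi>) = seg_init \<phi>"
| "seg_init (ExI \<phi>) = list_encode [\<langle>0, seg_init \<phi>\<rangle>]"
| "seg_init (ExP \<phi>) = list_encode [seg_init \<phi>]"
| "seg_init _ = atom_state False True"

primrec seg_step :: "form \<Rightarrow> nat \<Rightarrow> letter \<Rightarrow> nat" where
  "seg_step (Eq x y) s a =
     atom_state False (psnd s = 1 \<and> bit_at (fst a) x = bit_at (fst a) y)"
| "seg_step (Le x y) s a = atom_state (pfst s = 1 \<or> bit_at (fst a) x)
     (psnd s = 1 \<and> (bit_at (fst a) y \<longrightarrow> pfst s = 1 \<or> bit_at (fst a) x))"
| "seg_step (Sc x y) s a =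
     atom_state (bit_at (fst a) x) (psnd s = 1 \<and> bit_at (fst a) y = (pfst s = 1))"
| "seg_step (Zero x) s a =
     atom_state True (psnd s = 1 \<and> (bit_at (fst a) x \<longrightarrow> pfst s \<noteq> 1))"
| "seg_step (Mem x X) s a =
     atom_state False (psnd s = 1 \<and> (bit_at (fst a) x \<longrightarrow> bit_at (snd a) X))"
| "seg_step Top s a = atom_state False True"
| "seg_step Bot s a = atom_state False False"
| "seg_step (And \<phi> \<psi>) s a = \<langle>seg_step \<phi> (pfst s) a, seg_step \<psi> (psnd s) a\<rangle>"
| "seg_step (Neg \<phi>) s a = seg_step \<phi> s a"
| "seg_step (ExI \<phi>) s a = subset_step (pairs [0, 1, 2] (seg_states \<phi>))
     (\<lambda>b t. \<langle>if b then succ_capped (pfst t) else pfst t,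
       seg_step \<phi> (psnd t) (b # fst a, snd a)\<rangle>) s"
| "seg_step (ExP \<phi>) s a =
     subset_step (seg_states \<phi>) (\<lambda>b t. seg_step \<phi> t (fst a, b # snd a)) s"

fun seg_accepting :: "form \<Rightarrow> nat \<Rightarrow> bool" where
  "seg_accepting (And \<phi> \<psi>) s \<longleftrightarrow> seg_accepting \<phi> (pfst s) \<and> seg_accepting \<psi> (psnd s)"
| "seg_accepting (Neg \<phi>) s \<longleftrightarrow> \<not> seg_accepting \<phi> s"
| "seg_accepting (ExI \<phi>) s \<longleftrightarrow>
     (\<exists>t\<in>set (list_decode s). pfst t = 1 \<and> seg_accepting \<phi> (psnd t))"
| "seg_accepting (ExP \<phi>) s \<longleftrightarrow> (\<exists>t\<in>set (list_decode s). seg_accepting \<phi> t)"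
| "seg_accepting _ s \<longleftrightarrow> psnd s = 1"

primrec seg_run :: "form \<Rightarrow> (nat \<Rightarrow> letter) \<Rightarrow> nat \<Rightarrow> nat" where
  "seg_run \<phi> w 0 = seg_init \<phi>"
| "seg_run \<phi> w (Suc n) = seg_step \<phi> (seg_run \<phi> w n) (w n)"

lemma seg_run_cong: "(\<And>i. i < n \<Longrightarrow> w i = w' i) \<Longrightarrow> seg_run \<phi> w n = seg_run \<phi> w' n"
  by (induction n) auto

lemma filter_in_subseqs: "filter P xs \<in> set (subseqs xs)"
  by (induction xs) (auto simp: Let_def)

lemma singleton_in_subseqs: "x \<in> set xs \<Longrightarrow> [x] \<in> set (subseqs xs)"
proof (induction xs)
  case (Cons y ys)
  have "[] \<in> set (subseqs ys)" using filter_in_subseqs[of "\<lambda>_. False" ys] by simp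
  then show ?case using Cons by (auto simp: Let_def)
qed simp

lemma seg_init_in_states: "seg_init \<phi> \<in> set (seg_states \<phi>)"
  by (induction \<phi>) (auto intro!: imageI singleton_in_subseqs)

lemma seg_step_in_states: "s \<in> set (seg_states \<phi>) \<Longrightarrow> seg_step \<phi> s a \<in> set (seg_states \<phi>)"
  by (induction \<phi> arbitrary: s a)
    (auto simp: subset_step_def in_pairs_iff intro!: imageI filter_in_subseqs)

lemma seg_run_in_states: "seg_run \<phi> w n \<in> set (seg_states \<phi>)"
  by (induction n) (auto simp: seg_init_in_states seg_step_in_states)

subsection \<open>The subset construction\<close>

lemma set_subset_step:
  "set (list_decode (subset_step U \<delta> s)) = set U \<inter> (\<Union>b. \<delta> b ` set (list_decode s))"
  by (auto simp: subset_step_def UNIV_bool)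

primrec guess_run :: "(nat \<Rightarrow> bool \<Rightarrow> nat \<Rightarrow> nat) \<Rightarrow> nat \<Rightarrow> (nat \<Rightarrow> bool) \<Rightarrow> nat \<Rightarrow> nat" where
  "guess_run \<delta> q \<beta> 0 = q"
| "guess_run \<delta> q \<beta> (Suc n) = \<delta> n (\<beta> n) (guess_run \<delta> q \<beta> n)"

lemma guess_run_cong:
  "(\<And>i. i < n \<Longrightarrow> \<beta> i = \<beta>' i) \<Longrightarrow> guess_run \<delta> q \<beta> n = guess_run \<delta> q \<beta>' n"
  by (induction n) auto

lemma range_guess_run_Suc:
  "range (\<lambda>\<beta>. guess_run \<delta> q \<beta> (Suc n)) = (\<Union>b. \<delta> n b ` range (\<lambda>\<beta>. guess_run \<delta> q \<beta> n))"
proof (intro equalityI subsetI)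
  fix s
  assume "s \<in> (\<Union>b. \<delta> n b ` range (\<lambda>\<beta>. guess_run \<delta> q \<beta> n))"
  then obtain b \<beta> where s: "s = \<delta> n b (guess_run \<delta> q \<beta> n)" by blast
  have "guess_run \<delta> q \<beta> n = guess_run \<delta> q (\<beta>(n := b)) n" by (rule guess_run_cong) simp
  then have "s = guess_run \<delta> q (\<beta>(n := b)) (Suc n)" using s by simp
  then show "s \<in> range (\<lambda>\<beta>. guess_run \<delta> q \<beta> (Suc n))" by blast
qed auto

lemma set_subset_run:
  assumes "S 0 = list_encode [q]" "\<And>n. S (Suc n) = subset_step U (\<delta> n) (S n)"
    and "\<And>\<beta> n. guess_run \<delta> q \<beta> n \<in> set U"
  shows "set (list_decode (S n)) = range (\<lambda>\<beta>. guess_run \<delta> q \<beta> n)"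
proof (induction n)
  case 0
  show ?case by (simp add: assms(1))
next
  case (Suc n)
  have "set (list_decode (S (Suc n))) = set U \<inter> range (\<lambda>\<beta>. guess_run \<delta> q \<beta> (Suc n))"
    unfolding assms(2) set_subset_step Suc range_guess_run_Suc ..
  then show ?case using assms(3)[of _ "Suc n"] by blast
qed

primrec count_capped :: "(nat \<Rightarrow> bool) \<Rightarrow> nat \<Rightarrow> nat" where
  "count_capped \<beta> 0 = 0"
| "count_capped \<beta> (Suc n) = (if \<beta> n then succ_capped (count_capped \<beta> n) else count_capped \<beta> n)"

lemma count_capped_range: "count_capped \<beta> n \<in> {0, 1, 2}"
  by (induction n) (auto simp: succ_capped_def)

lemma count_capped_eq_0_iff: "count_capped \<beta> n = 0 \<longleftrightarrow> (\<forall>i<n. \<not> \<beta> i)"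
  by (induction n) (auto simp: succ_capped_def less_Suc_eq)

lemma count_capped_eq_1_iff: "count_capped \<beta> n = 1 \<longleftrightarrow> (\<exists>k<n. \<forall>i<n. \<beta> i \<longleftrightarrow> i = k)"
proof (induction n)
  case (Suc n)
  show ?case
  proof (cases "\<beta> n")
    case True
    then have "count_capped \<beta> (Suc n) = 1 \<longleftrightarrow> count_capped \<beta> n = 0" by (simp add: succ_capped_def)
    also have "\<dots> \<longleftrightarrow> (\<exists>k<Suc n. \<forall>i<Suc n. \<beta> i \<longleftrightarrow> i = k)"
      unfolding count_capped_eq_0_iff using True by (auto simp: less_Suc_eq)
    finally show ?thesis .
  next
    case False
    then show ?thesis using Suc by (auto simp: less_Suc_eq)
  qed
qed simp

lemma seg_accepting_ExI:
  "seg_accepting (ExI \<phi>) (seg_run (ExI \<phi>) w (Suc n)) \<longleftrightarrow>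
    (\<exists>k\<le>n. seg_accepting \<phi> (seg_run \<phi> (\<lambda>i. ((i = k) # fst (w i), snd (w i))) (Suc n)))"
proof -
  let ?w = "\<lambda>\<beta> i. (\<beta> i # fst (w i), snd (w i))"
  let ?\<delta> = "\<lambda>n b t. \<langle>if b then succ_capped (pfst t) else pfst t,
    seg_step \<phi> (psnd t) (b # fst (w n), snd (w n))\<rangle>"
  have guess: "guess_run ?\<delta> \<langle>0, seg_init \<phi>\<rangle> \<beta> n = \<langle>count_capped \<beta> n, seg_run \<phi> (?w \<beta>) n\<rangle>" for \<beta> n
    by (induction n) simp_all
  have "set (list_decode (seg_run (ExI \<phi>) w n)) =
    range (\<lambda>\<beta>. guess_run ?\<delta> \<langle>0, seg_init \<phi>\<rangle> \<beta> n)" for n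
  proof (rule set_subset_run)
    show "guess_run ?\<delta> \<langle>0, seg_init \<phi>\<rangle> \<beta> n \<in> set (pairs [0, 1, 2] (seg_states \<phi>))" for \<beta> n
      using count_capped_range[of \<beta> n] by (simp add: guess seg_run_in_states)
  qed simp_all
  then have "seg_accepting (ExI \<phi>) (seg_run (ExI \<phi>) w (Suc n)) \<longleftrightarrow>
    (\<exists>\<beta>. count_capped \<beta> (Suc n) = 1 \<and> seg_accepting \<phi> (seg_run \<phi> (?w \<beta>) (Suc n)))"
    by (simp add: guess del: seg_run.simps count_capped.simps)
  also have "\<dots> \<longleftrightarrow> (\<exists>k\<le>n. \<exists>\<beta>. (\<forall>i<Suc n. \<beta> i \<longleftrightarrow> i = k) \<and>
      seg_accepting \<phi> (seg_run \<phi> (?w \<beta>) (Suc n)))"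
    unfolding count_capped_eq_1_iff less_Suc_eq_le by blast
  also have "\<dots> \<longleftrightarrow> (\<exists>k\<le>n. seg_accepting \<phi> (seg_run \<phi> (?w (\<lambda>i. i = k)) (Suc n)))"
  proof (intro ex_cong1 conj_cong refl iffI)
    fix k
    assume "\<exists>\<beta>. (\<forall>i<Suc n. \<beta> i \<longleftrightarrow> i = k) \<and> seg_accepting \<phi> (seg_run \<phi> (?w \<beta>) (Suc n))"
    then obtain \<beta> where \<beta>: "\<forall>i<Suc n. \<beta> i \<longleftrightarrow> i = k"
      and accepting: "seg_accepting \<phi> (seg_run \<phi> (?w \<beta>) (Suc n))" by blast
    have "seg_run \<phi> (?w \<beta>) (Suc n) = seg_run \<phi> (?w (\<lambda>i. i = k)) (Suc n)"
      by (rule seg_run_cong) (use \<beta> in simp)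
    with accepting show "seg_accepting \<phi> (seg_run \<phi> (?w (\<lambda>i. i = k)) (Suc n))"
      by (rule subst[rotated])
  next
    fix k
    assume "seg_accepting \<phi> (seg_run \<phi> (?w (\<lambda>i. i = k)) (Suc n))"
    then show "\<exists>\<beta>. (\<forall>i<Suc n. \<beta> i \<longleftrightarrow> i = k) \<and> seg_accepting \<phi> (seg_run \<phi> (?w \<beta>) (Suc n))"
      by (intro exI[of _ "\<lambda>i. i = k"]) simp
  qed
  finally show ?thesis .
qed

lemma seg_accepting_ExP:
  "seg_accepting (ExP \<phi>) (seg_run (ExP \<phi>) w n) \<longleftrightarrow>
    (\<exists>S. seg_accepting \<phi> (seg_run \<phi> (\<lambda>i. (fst (w i), S i # snd (w i))) n))"
proof -
  let ?\<delta> = "\<lambda>n b t. seg_step \<phi> t (fst (w n), b # snd (w n))"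
  have guess: "guess_run ?\<delta> (seg_init \<phi>) S n =
      seg_run \<phi> (\<lambda>i. (fst (w i), S i # snd (w i))) n" for S n
    by (induction n) simp_all
  have "set (list_decode (seg_run (ExP \<phi>) w n)) = range (\<lambda>S. guess_run ?\<delta> (seg_init \<phi>) S n)"
    by (rule set_subset_run[where U = "seg_states \<phi>"]) (simp_all add: guess seg_run_in_states)
  then show ?thesis by (simp add: guess)
qed

subsection \<open>The automaton decides the relativized formula\<close>

lemma seg_run_Eq: "psnd (seg_run (Eq x y) w n) =
    of_bool (\<forall>i<n. bit_at (fst (w i)) x = bit_at (fst (w i)) y)"
  by (induction n) (auto simp: less_Suc_eq)

lemma seg_run_Le: "seg_run (Le x y) w n = atom_state (\<exists>i<n. bit_at (fst (w i)) x)
    (\<forall>j<n. bit_at (fst (w j)) y \<longrightarrow> (\<exists>i\<le>j. bit_at (fst (w i)) x))"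
  by (induction n) (auto simp: less_Suc_eq le_less)

lemma seg_run_Sc: "seg_run (Sc x y) w n = atom_state (0 < n \<and> bit_at (fst (w (n - 1))) x)
    (\<forall>j<n. bit_at (fst (w j)) y \<longleftrightarrow> 0 < j \<and> bit_at (fst (w (j - 1))) x)"
  by (induction n) (auto simp: less_Suc_eq)

lemma seg_run_Zero:
  "seg_run (Zero x) w n = atom_state (0 < n) (\<forall>j<n. bit_at (fst (w j)) x \<longrightarrow> j = 0)"
  by (induction n) (auto simp: less_Suc_eq)

lemma seg_run_Mem: "psnd (seg_run (Mem x X) w n) =
    of_bool (\<forall>i<n. bit_at (fst (w i)) x \<longrightarrow> bit_at (snd (w i)) X)"
  by (induction n) (auto simp: less_Suc_eq)

lemma seg_run_And: "seg_run (And \<phi> \<psi>) w n = \<langle>seg_run \<phi> w n, seg_run \<psi> w n\<rangle>"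
  by (induction n) auto

lemma seg_run_Neg: "seg_run (Neg \<phi>) w n = seg_run \<phi> w n"
  by (induction n) auto

definition encodes_segment ::
  "nat \<Rightarrow> form \<Rightarrow> ind_assignment \<Rightarrow> pred_assignment \<Rightarrow> (nat \<Rightarrow> letter) \<Rightarrow> bool" where
  "encodes_segment N \<phi> \<kappa> \<sigma> w \<longleftrightarrow>
     (\<forall>i\<in>fvi \<phi>. \<kappa> i \<le> N \<and> (\<forall>n\<le>N. bit_at (fst (w n)) i \<longleftrightarrow> n = \<kappa> i)) \<and>
     (\<forall>X\<in>fvp \<phi>. \<forall>n\<le>N. bit_at (snd (w n)) X \<longleftrightarrow> \<sigma> X n)"

lemma encodes_segment_ExI:
  assumes "encodes_segment N (ExI \<phi>) \<kappa> \<sigma> w" "k \<le> N"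
  shows "encodes_segment N \<phi> (case_nat k \<kappa>) \<sigma> (\<lambda>i. ((i = k) # fst (w i), snd (w i)))"
  using assms unfolding encodes_segment_def by (auto simp: nth_default_Cons split: nat.splits)

lemma encodes_segment_ExP:
  assumes "encodes_segment N (ExP \<phi>) \<kappa> \<sigma> w"
  shows "encodes_segment N \<phi> \<kappa> (case_nat S \<sigma>) (\<lambda>i. (fst (w i), S i # snd (w i)))"
  using assms unfolding encodes_segment_def by (auto simp: nth_default_Cons split: nat.splits)

lemma seg_accepting_Eq:
  assumes "encodes_segment N (Eq x y) \<kappa> \<sigma> w"
  shows "seg_accepting (Eq x y) (seg_run (Eq x y) w (Suc N)) \<longleftrightarrow> \<kappa> x = \<kappa> y"
  using assms unfolding seg_accepting.simps seg_run_Eq encodes_segment_def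
  by (auto simp: less_Suc_eq_le)

lemma seg_accepting_Le:
  assumes "encodes_segment N (Le x y) \<kappa> \<sigma> w"
  shows "seg_accepting (Le x y) (seg_run (Le x y) w (Suc N)) \<longleftrightarrow> \<kappa> x \<le> \<kappa> y"
proof -
  have "\<kappa> y \<le> N" and bits: "\<And>n. n \<le> N \<Longrightarrow> bit_at (fst (w n)) x \<longleftrightarrow> n = \<kappa> x"
    "\<And>n. n \<le> N \<Longrightarrow> bit_at (fst (w n)) y \<longleftrightarrow> n = \<kappa> y"
    using assms by (simp_all add: encodes_segment_def)
  have "(\<forall>n<Suc N. bit_at (fst (w n)) y \<longrightarrow> (\<exists>i\<le>n. bit_at (fst (w i)) x)) \<longleftrightarrow>
      (\<forall>n<Suc N. n = \<kappa> y \<longrightarrow> (\<exists>i\<le>n. i = \<kappa> x))"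
    using bits by (auto simp: less_Suc_eq_le)
  also have "\<dots> \<longleftrightarrow> \<kappa> x \<le> \<kappa> y"
    using \<open>\<kappa> y \<le> N\<close> by (auto simp: less_Suc_eq_le)
  finally show ?thesis unfolding seg_accepting.simps seg_run_Le by simp
qed

lemma seg_accepting_Sc:
  assumes "encodes_segment N (Sc x y) \<kappa> \<sigma> w"
  shows "seg_accepting (Sc x y) (seg_run (Sc x y) w (Suc N)) \<longleftrightarrow> \<kappa> y = Suc (\<kappa> x)"
proof -
  have "\<kappa> y \<le> N" and bits: "\<And>n. n \<le> N \<Longrightarrow> bit_at (fst (w n)) x \<longleftrightarrow> n = \<kappa> x"
    "\<And>n. n \<le> N \<Longrightarrow> bit_at (fst (w n)) y \<longleftrightarrow> n = \<kappa> y"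
    using assms by (simp_all add: encodes_segment_def)
  have "(\<forall>n<Suc N. bit_at (fst (w n)) y \<longleftrightarrow> 0 < n \<and> bit_at (fst (w (n - 1))) x) \<longleftrightarrow>
      (\<forall>n<Suc N. n = \<kappa> y \<longleftrightarrow> 0 < n \<and> n - 1 = \<kappa> x)"
    using bits by (auto simp: less_Suc_eq_le)
  also have "\<dots> \<longleftrightarrow> \<kappa> y = Suc (\<kappa> x)"
    using \<open>\<kappa> y \<le> N\<close> by (auto simp: less_Suc_eq_le)
  finally show ?thesis unfolding seg_accepting.simps seg_run_Sc by simp
qed

lemma seg_accepting_Zero:
  assumes "encodes_segment N (Zero x) \<kappa> \<sigma> w"
  shows "seg_accepting (Zero x) (seg_run (Zero x) w (Suc N)) \<longleftrightarrow> \<kappa> x = 0"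
  using assms unfolding seg_accepting.simps seg_run_Zero encodes_segment_def
  by (auto simp: less_Suc_eq_le)

lemma seg_accepting_Mem:
  assumes "encodes_segment N (Mem x X) \<kappa> \<sigma> w"
  shows "seg_accepting (Mem x X) (seg_run (Mem x X) w (Suc N)) \<longleftrightarrow> \<sigma> X (\<kappa> x)"
  using assms unfolding seg_accepting.simps seg_run_Mem encodes_segment_def
  by (auto simp: less_Suc_eq_le)

theorem seg_accepting_iff_sat_relativize:
  assumes "encodes_segment (\<kappa> j) \<phi> \<kappa> \<sigma> w"
  shows "seg_accepting \<phi> (seg_run \<phi> w (Suc (\<kappa> j))) \<longleftrightarrow> sat (relativize (Le 0 (Suc j)) \<phi>) \<kappa> \<sigma>"
  using assms
proof (induction \<phi> arbitrary: j \<kappa> \<sigma> w)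
  case (And \<phi> \<psi>)
  then have "encodes_segment (\<kappa> j) \<phi> \<kappa> \<sigma> w" "encodes_segment (\<kappa> j) \<psi> \<kappa> \<sigma> w"
    by (auto simp: encodes_segment_def)
  then show ?case using And.IH by (simp add: seg_run_And del: seg_run.simps)
next
  case (Neg \<phi>)
  then have "encodes_segment (\<kappa> j) \<phi> \<kappa> \<sigma> w" by (simp add: encodes_segment_def)
  then show ?case using Neg.IH by (simp add: seg_run_Neg del: seg_run.simps)
next
  case (ExI \<phi>)
  show ?case
    using ExI.IH[of "case_nat _ \<kappa>" "Suc j"] encodes_segment_ExI[OF ExI.prems]
    unfolding seg_accepting_ExI by (simp add: up_def del: seg_run.simps) blast
next
  case (ExP \<phi>)
  show ?case
    using ExP.IH[OF encodes_segment_ExP[OF ExP.prems]]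
    unfolding seg_accepting_ExP by (simp del: seg_run.simps)
qed (simp_all only: relativize.simps sat_simps seg_accepting_Eq seg_accepting_Le seg_accepting_Sc
    seg_accepting_Zero seg_accepting_Mem, simp_all)

lemma fvi_subset_fvi_relativize: "fvi \<chi> \<subseteq> fvi (relativize \<theta> \<chi>)"
  by (induction \<chi> arbitrary: \<theta>) (auto, (blast+)?)

section \<open>Validity of the rules\<close>

definition valid :: "sequent \<Rightarrow> bool" where
  "valid s \<longleftrightarrow> (\<forall>\<kappa> \<sigma>. (\<forall>\<psi>\<in>set (fst s). sat \<psi> \<kappa> \<sigma>) \<longrightarrow> sat (snd s) \<kappa> \<sigma>)"

lemma validI: "(\<And>\<kappa> \<sigma>. \<forall>\<psi>\<in>set \<Gamma>. sat \<psi> \<kappa> \<sigma> \<Longrightarrow> sat \<phi> \<kappa> \<sigma>) \<Longrightarrow> valid (\<Gamma>, \<phi>)"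
  by (simp add: valid_def)

lemma validD: "valid (\<Gamma>, \<phi>) \<Longrightarrow> \<forall>\<psi>\<in>set \<Gamma>. sat \<psi> \<kappa> \<sigma> \<Longrightarrow> sat \<phi> \<kappa> \<sigma>"
  by (simp add: valid_def)

lemma realizer_fresh_i: "z \<notin> fvi \<phi> \<Longrightarrow> realizer \<phi> R (\<kappa>(z := k)) \<sigma> \<longleftrightarrow> realizer \<phi> R \<kappa> \<sigma>"
  by (rule realizer_cong) auto

lemma realizer_fresh_p: "Z \<notin> fvp \<phi> \<Longrightarrow> realizer \<phi> R \<kappa> (\<sigma>(Z := S)) \<longleftrightarrow> realizer \<phi> R \<kappa> \<sigma>"
  by (rule realizer_cong) auto

lemma realizer_insti_fresh:
  assumes "z \<notin> fvi (ExI \<phi>)"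
  shows "realizer (insti z \<phi>) R (\<kappa>(z := k)) \<sigma> \<longleftrightarrow> realizer \<phi> R (case_nat k \<kappa>) \<sigma>"
  unfolding realizer_insti by (rule realizer_cong) (use assms in \<open>auto split: nat.splits\<close>)

lemma realizer_instp_fresh:
  assumes "Z \<notin> fvp (ExP \<phi>)"
  shows "realizer (instp Z \<phi>) R \<kappa> (\<sigma>(Z := S)) \<longleftrightarrow> realizer \<phi> R \<kappa> (case_nat S \<sigma>)"
  unfolding realizer_instp by (rule realizer_cong) (use assms in \<open>auto split: nat.splits\<close>)

lemma sat_fresh_i: "z \<notin> fvi \<phi> \<Longrightarrow> sat \<phi> (\<kappa>(z := k)) \<sigma> \<longleftrightarrow> sat \<phi> \<kappa> \<sigma>"
  by (simp add: sat_def realizer_fresh_i)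

lemma sat_fresh_p: "Z \<notin> fvp \<phi> \<Longrightarrow> sat \<phi> \<kappa> (\<sigma>(Z := S)) \<longleftrightarrow> sat \<phi> \<kappa> \<sigma>"
  by (simp add: sat_def realizer_fresh_p)

lemma sat_insti_fresh:
  "z \<notin> fvi (ExI \<phi>) \<Longrightarrow> sat (insti z \<phi>) (\<kappa>(z := k)) \<sigma> \<longleftrightarrow> sat \<phi> (case_nat k \<kappa>) \<sigma>"
  using realizer_insti_fresh unfolding sat_def by blast

lemma sat_instp_fresh:
  "Z \<notin> fvp (ExP \<phi>) \<Longrightarrow> sat (instp Z \<phi>) \<kappa> (\<sigma>(Z := S)) \<longleftrightarrow> sat \<phi> \<kappa> (case_nat S \<sigma>)"
  using realizer_instp_fresh unfolding sat_def by blast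

lemma valid_ExIE:
  assumes "fresh_i z (ExI \<phi> # \<psi> # \<Gamma>)" "valid (\<Gamma>, ExI \<phi>)" "valid (\<Gamma> @ [insti z \<phi>], \<psi>)"
  shows "valid (\<Gamma>, \<psi>)"
proof (rule validI)
  fix \<kappa> \<sigma>
  assume hyps: "\<forall>\<chi>\<in>set \<Gamma>. sat \<chi> \<kappa> \<sigma>"
  obtain k where "sat \<phi> (case_nat k \<kappa>) \<sigma>" using validD[OF assms(2) hyps] by auto
  moreover have fresh: "z \<notin> fvi (ExI \<phi>)" "z \<notin> fvi \<psi>" "\<forall>\<chi>\<in>set \<Gamma>. z \<notin> fvi \<chi>"
    using assms(1) unfolding fresh_i_def by (simp_all del: fvi.simps)
  ultimately have "\<forall>\<chi>\<in>set (\<Gamma> @ [insti z \<phi>]). sat \<chi> (\<kappa>(z := k)) \<sigma>"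
    using hyps sat_insti_fresh[OF fresh(1)] sat_fresh_i by auto
  then show "sat \<psi> \<kappa> \<sigma>" using validD[OF assms(3)] sat_fresh_i[OF fresh(2)] by blast
qed

lemma valid_ExPE:
  assumes "fresh_p Z (ExP \<phi> # \<psi> # \<Gamma>)" "valid (\<Gamma>, ExP \<phi>)" "valid (\<Gamma> @ [instp Z \<phi>], \<psi>)"
  shows "valid (\<Gamma>, \<psi>)"
proof (rule validI)
  fix \<kappa> \<sigma>
  assume hyps: "\<forall>\<chi>\<in>set \<Gamma>. sat \<chi> \<kappa> \<sigma>"
  obtain S where "sat \<phi> \<kappa> (case_nat S \<sigma>)" using validD[OF assms(2) hyps] by auto
  moreover have fresh: "Z \<notin> fvp (ExP \<phi>)" "Z \<notin> fvp \<psi>" "\<forall>\<chi>\<in>set \<Gamma>. Z \<notin> fvp \<chi>"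
    using assms(1) unfolding fresh_p_def by (simp_all del: fvp.simps)
  ultimately have "\<forall>\<chi>\<in>set (\<Gamma> @ [instp Z \<phi>]). sat \<chi> \<kappa> (\<sigma>(Z := S))"
    using hyps sat_instp_fresh[OF fresh(1)] sat_fresh_p by auto
  then show "sat \<psi> \<kappa> \<sigma>" using validD[OF assms(3)] sat_fresh_p[OF fresh(2)] by blast
qed

lemma valid_Induct:
  assumes "y \<noteq> z" "fresh_i y (\<delta> # \<Gamma>)" "fresh_i z (\<delta> # \<Gamma>)"
    and base: "valid (\<Gamma> @ [Zero z], substi x z \<delta>)"
    and step: "valid (\<Gamma> @ [Sc y z, substi x y \<delta>], substi x z \<delta>)"
  shows "valid (\<Gamma>, \<delta>)"
proof (rule validI)
  fix \<kappa> \<sigma>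
  assume hyps: "\<forall>\<psi>\<in>set \<Gamma>. sat \<psi> \<kappa> \<sigma>"
  have fresh: "y \<notin> fvi \<delta>" "z \<notin> fvi \<delta>" "\<forall>\<psi>\<in>set \<Gamma>. y \<notin> fvi \<psi> \<and> z \<notin> fvi \<psi>"
    using assms(2,3) by (auto simp: fresh_i_def)
  have \<delta>: "sat \<delta> (\<kappa>(y := i, z := j, x := k)) \<sigma> \<longleftrightarrow> sat \<delta> (\<kappa>(x := k)) \<sigma>" for i j k
    by (rule sat_cong) (use fresh in auto)
  have hyps': "\<forall>\<psi>\<in>set \<Gamma>. sat \<psi> (\<kappa>(y := i, z := j)) \<sigma>" for i j
    using hyps fresh(3) by (simp add: sat_fresh_i)
  have "sat \<delta> (\<kappa>(x := k)) \<sigma>" for k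
  proof (induction k)
    case 0
    let ?\<kappa> = "\<kappa>(y := 0, z := 0)"
    have "\<forall>\<psi>\<in>set (\<Gamma> @ [Zero z]). sat \<psi> ?\<kappa> \<sigma>" using hyps'[of 0 0] by simp
    from validD[OF base this] show ?case by (simp only: sat_substi fun_upd_same \<delta>)
  next
    case (Suc k)
    let ?\<kappa> = "\<kappa>(y := k, z := Suc k)"
    have y: "?\<kappa> y = k" using \<open>y \<noteq> z\<close> by simp
    then have "sat (substi x y \<delta>) ?\<kappa> \<sigma>" using Suc by (simp only: sat_substi \<delta>)
    then have "\<forall>\<psi>\<in>set (\<Gamma> @ [Sc y z, substi x y \<delta>]). sat \<psi> ?\<kappa> \<sigma>"
      using hyps'[of k "Suc k"] y by simp
    from validD[OF step this] show ?case by (simp only: sat_substi fun_upd_same \<delta>)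
  qed
  from this[of "\<kappa> x"] show "sat \<delta> \<kappa> \<sigma>" by simp
qed

lemma valid_pointwise:
  assumes "\<forall>s'\<in>set ss. valid s'"
    and "\<And>\<kappa> \<sigma>. \<forall>s'\<in>set ss. (\<forall>\<psi>\<in>set (fst s'). sat \<psi> \<kappa> \<sigma>) \<longrightarrow> sat (snd s') \<kappa> \<sigma> \<Longrightarrow>
      \<forall>\<psi>\<in>set (fst s). sat \<psi> \<kappa> \<sigma> \<Longrightarrow> sat (snd s) \<kappa> \<sigma>"
  shows "valid s"
  using assms unfolding valid_def by blast

lemma valid_rule_instance:
  assumes "rule_instance r ss s" "\<forall>s'\<in>set ss. valid s'"
  shows "valid s"
  using assms
proof (cases rule: rule_instance.cases)
  case (9 z \<phi> \<psi> \<Gamma>)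
  then show ?thesis using valid_ExIE assms(2) by auto
next
  case (11 Z \<phi> \<psi> \<Gamma>)
  then show ?thesis using valid_ExPE assms(2) by auto
next
  case (26 \<delta> y z \<Gamma> x)
  then show ?thesis using valid_Induct assms(2) by auto
qed (rule valid_pointwise[OF assms(2)];
    auto simp: sat_insti sat_instp sat_substi sat_substp insert_at_0)+

theorem smso_derivation_valid: "smso_derivation D \<Longrightarrow> valid (endsequent D)"
proof (induction rule: smso_derivation.induct)
  case (1 ds r s)
  then show ?case using valid_rule_instance[of r "map endsequent ds" s] by simp
qed

section \<open>The machine of a derivation\<close>

primrec update_default :: "'a \<Rightarrow> 'a list \<Rightarrow> nat \<Rightarrow> 'a \<Rightarrow> 'a list" where
  "update_default d xs 0 b = b # tl xs"
| "update_default d xs (Suc i) b = nth_default d xs 0 # update_default d (tl xs) i b"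

lemma nth_default_update_default:
  "nth_default d (update_default d xs i b) j = (if j = i then b else nth_default d xs j)"
proof (induction i arbitrary: xs j)
  case 0
  show ?case by (cases xs) (simp_all add: nth_default_Cons split: nat.split)
next
  case (Suc i)
  then show ?case by (cases xs) (simp_all add: nth_default_Cons split: nat.split)
qed

text \<open>
  The variables of a derivation need not occur in its conclusion.  Its machine reads environments
  consisting of a default bit for the individual variables beyond the listed ones, the listed bits
  of the individual and of the predicate variables, and the moves of the hypotheses.
\<close>

type_synonym env = "bool \<times> letter \<times> move list"

definition ind_bit :: "env \<Rightarrow> nat \<Rightarrow> bool" where
  "ind_bit a = nth_default (fst a) (fst (fst (snd a)))"

definition pred_bits :: "env \<Rightarrow> bool list" where
  "pred_bits a = snd (fst (snd a))"

definition hyp_moves :: "env \<Rightarrow> move list" where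
  "hyp_moves a = snd (snd a)"

definition set_ind :: "nat \<Rightarrow> bool \<Rightarrow> env \<Rightarrow> env" where
  "set_ind z b a =
     (fst a, (update_default (fst a) (fst (fst (snd a))) z b, pred_bits a), hyp_moves a)"

definition set_pred :: "nat \<Rightarrow> bool \<Rightarrow> env \<Rightarrow> env" where
  "set_pred Z b a =
     (fst a, (fst (fst (snd a)), update_default False (pred_bits a) Z b), hyp_moves a)"

definition add_hyp :: "move \<Rightarrow> env \<Rightarrow> env" where
  "add_hyp m a = (fst a, fst (snd a), hyp_moves a @ [m])"

lemma set_ind_simps [simp]:
  "ind_bit (set_ind z b a) i = (if i = z then b else ind_bit a i)"
  "pred_bits (set_ind z b a) = pred_bits a" "hyp_moves (set_ind z b a) = hyp_moves a"
  by (simp_all add: set_ind_def ind_bit_def pred_bits_def hyp_moves_def nth_default_update_default)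

lemma set_pred_simps [simp]:
  "ind_bit (set_pred Z b a) = ind_bit a"
  "bit_at (pred_bits (set_pred Z b a)) X = (if X = Z then b else bit_at (pred_bits a) X)"
  "hyp_moves (set_pred Z b a) = hyp_moves a"
  by (simp_all add: set_pred_def ind_bit_def pred_bits_def hyp_moves_def nth_default_update_default)

lemma add_hyp_simps [simp]:
  "ind_bit (add_hyp m a) = ind_bit a" "pred_bits (add_hyp m a) = pred_bits a"
  "hyp_moves (add_hyp m a) = hyp_moves a @ [m]"
  by (simp_all add: add_hyp_def ind_bit_def pred_bits_def hyp_moves_def)

text \<open>
  Synchronous comprehension and the existence of 0 and of successors are realized by one local
  automaton: at time \<open>n\<close> it is asked whether its formula holds if the variable 0 has the value
  \<open>n\<close>, and it continues under the assumption that the variable has a later value.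
\<close>

fun local_form :: "rule \<Rightarrow> form" where
  "local_form (SyncCompr \<chi>) = \<chi>"
| "local_form ZeroEx = Zero 0"
| "local_form ScEx = Sc 1 0"
| "local_form _ = Top"

fun pred_var :: "form \<Rightarrow> nat" where
  "pred_var (ExI (Sc x y)) = x - 1"
| "pred_var _ = 0"

definition local_letter :: "sequent \<Rightarrow> bool \<Rightarrow> env \<Rightarrow> letter" where
  "local_letter s b a = ([b, ind_bit a (pred_var (snd s))], pred_bits a)"

fun hyp_move :: "form \<Rightarrow> form list \<Rightarrow> move list \<Rightarrow> move" where
  "hyp_move \<phi> (\<psi> # \<Gamma>) (m # ms) = (if \<psi> = \<phi> then m else hyp_move \<phi> \<Gamma> ms)"
| "hyp_move \<phi> _ _ = Star"

fun second_env :: "rule \<Rightarrow> env \<Rightarrow> move \<Rightarrow> env" where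
  "second_env Cut a m = add_hyp m a"
| "second_env (ExIE z) a m =
     add_hyp (move_snd (move_snd m)) (set_ind z (move_bit (move_fst m)) a)"
| "second_env (ExPE Z) a m = add_hyp (move_snd m) (set_pred Z (move_bit (move_fst m)) a)"
| "second_env _ a m = a"

fun rule_output :: "rule \<Rightarrow> sequent \<Rightarrow> env \<Rightarrow> bool \<Rightarrow> move \<Rightarrow> move \<Rightarrow> move" where
  "rule_output Ax s a w m1 m2 = hyp_move (snd s) (fst s) (hyp_moves a)"
| "rule_output Cut s a w m1 m2 = m2"
| "rule_output AndI s a w m1 m2 = MPair m1 m2"
| "rule_output AndE1 s a w m1 m2 = move_fst m1"
| "rule_output AndE2 s a w m1 m2 = move_snd m1"
| "rule_output (ExII t) s a w m1 m2 = MPair (Bit (ind_bit a t)) (MPair Star m1)"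
| "rule_output (ExIE z) s a w m1 m2 = m2"
| "rule_output (ExPI Y) s a w m1 m2 = MPair (Bit (bit_at (pred_bits a) Y)) m1"
| "rule_output (ExPE Z) s a w m1 m2 = m2"
| "rule_output (EqSubst x y z \<psi>) s a w m1 m2 = m1"
| "rule_output ZeroEx s a w m1 m2 = MPair (Bit w) Star"
| "rule_output ScEx s a w m1 m2 = MPair (Bit w) Star"
| "rule_output (SyncCompr \<chi>) s a w m1 m2 = MPair (Bit w) m1"
| "rule_output _ s a w m1 m2 = Star"

definition infer_step ::
  "rule \<Rightarrow> sequent \<Rightarrow> nat \<Rightarrow> env \<Rightarrow> nat \<times> move \<Rightarrow> nat \<times> move \<Rightarrow> nat \<times> move" where
  "infer_step r s q a o1 o2 =
     (\<langle>seg_step (local_form r) q (local_letter s False a), \<langle>fst o1, fst o2\<rangle>\<rangle>,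
      coerce (snd s) (rule_output r s a
        (seg_accepting (local_form r) (seg_step (local_form r) q (local_letter s True a)))
        (snd o1) (snd o2)))"

text \<open>Only the first two premises matter: the one rule with three has a deterministic conclusion.\<close>

fun deriv_states :: "deriv \<Rightarrow> nat list" where
  "deriv_states (Infer r s []) = pairs (seg_states (local_form r)) (pairs [0] [0])"
| "deriv_states (Infer r s [d]) = pairs (seg_states (local_form r)) (pairs (deriv_states d) [0])"
| "deriv_states (Infer r s (d # d' # ds)) =
     pairs (seg_states (local_form r)) (pairs (deriv_states d) (deriv_states d'))"

fun deriv_init :: "deriv \<Rightarrow> nat" where
  "deriv_init (Infer r s []) = \<langle>seg_init (local_form r), \<langle>0, 0\<rangle>\<rangle>"
| "deriv_init (Infer r s [d]) = \<langle>seg_init (local_form r), \<langle>deriv_init d, 0\<rangle>\<rangle>"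
| "deriv_init (Infer r s (d # d' # ds)) =
     \<langle>seg_init (local_form r), \<langle>deriv_init d, deriv_init d'\<rangle>\<rangle>"

fun deriv_step :: "deriv \<Rightarrow> nat \<Rightarrow> env \<Rightarrow> nat \<times> move" where
  "deriv_step (Infer r s []) q a = infer_step r s (pfst q) a (0, Star) (0, Star)"
| "deriv_step (Infer r s [d]) q a =
     infer_step r s (pfst q) a (deriv_step d (pfst (psnd q)) a) (0, Star)"
| "deriv_step (Infer r s (d # d' # ds)) q a =
     infer_step r s (pfst q) a (deriv_step d (pfst (psnd q)) a)
       (deriv_step d' (psnd (psnd q)) (second_env r a (snd (deriv_step d (pfst (psnd q)) a))))"

lemma deriv_init_in_states: "deriv_init D \<in> set (deriv_states D)"
  by (induction D rule: deriv_init.induct) (simp_all add: seg_init_in_states)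

lemma deriv_step_in_states:
  "q \<in> set (deriv_states D) \<Longrightarrow> fst (deriv_step D q a) \<in> set (deriv_states D)"
  by (induction D q a rule: deriv_step.induct)
    (auto simp: infer_step_def in_pairs_iff seg_step_in_states)

lemma deriv_step_output_in_M: "snd (deriv_step D q a) \<in> M (snd (endsequent D))"
  by (cases "(D, q, a)" rule: deriv_step.cases) (simp_all add: infer_step_def coerce_in_M)

primrec deriv_run :: "deriv \<Rightarrow> (nat \<Rightarrow> env) \<Rightarrow> nat \<Rightarrow> nat" where
  "deriv_run D a 0 = deriv_init D"
| "deriv_run D a (Suc n) = fst (deriv_step D (deriv_run D a n) (a n))"

definition deriv_output :: "deriv \<Rightarrow> (nat \<Rightarrow> env) \<Rightarrow> nat \<Rightarrow> move" where
  "deriv_output D a n = snd (deriv_step D (deriv_run D a n) (a n))"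

definition witness :: "rule \<Rightarrow> sequent \<Rightarrow> (nat \<Rightarrow> env) \<Rightarrow> nat \<Rightarrow> bool" where
  "witness r s a n \<longleftrightarrow> seg_accepting (local_form r)
     (seg_run (local_form r) (\<lambda>i. local_letter s (i = n) (a i)) (Suc n))"

lemma deriv_run_Infer:
  "deriv_run (Infer r s []) a n =
     \<langle>seg_run (local_form r) (\<lambda>i. local_letter s False (a i)) n, \<langle>0, 0\<rangle>\<rangle>"
  "deriv_run (Infer r s [d]) a n =
     \<langle>seg_run (local_form r) (\<lambda>i. local_letter s False (a i)) n, \<langle>deriv_run d a n, 0\<rangle>\<rangle>"
  "deriv_run (Infer r s (d # d' # ds)) a n =
     \<langle>seg_run (local_form r) (\<lambda>i. local_letter s False (a i)) n,
      \<langle>deriv_run d a n, deriv_run d' (\<lambda>i. second_env r (a i) (deriv_output d a i)) n\<rangle>\<rangle>"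
  by (induction n) (simp_all add: infer_step_def deriv_output_def)

lemma deriv_output_Infer:
  "deriv_output (Infer r s []) a =
     (\<lambda>n. coerce (snd s) (rule_output r s (a n) (witness r s a n) Star Star))"
  "deriv_output (Infer r s [d]) a =
     (\<lambda>n. coerce (snd s) (rule_output r s (a n) (witness r s a n) (deriv_output d a n) Star))"
  "deriv_output (Infer r s (d # d' # ds)) a =
     (\<lambda>n. coerce (snd s) (rule_output r s (a n) (witness r s a n) (deriv_output d a n)
       (deriv_output d' (\<lambda>i. second_env r (a i) (deriv_output d a i)) n)))"
proof -
  have "seg_run (local_form r) (\<lambda>i. local_letter s (i = n) (a i)) n =
      seg_run (local_form r) (\<lambda>i. local_letter s False (a i)) n" for n
    by (rule seg_run_cong) simp
  then have "witness r s a n \<longleftrightarrow> seg_accepting (local_form r) (seg_step (local_form r)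
      (seg_run (local_form r) (\<lambda>i. local_letter s False (a i)) n) (local_letter s True (a n)))" for n
    by (simp add: witness_def)
  then show "deriv_output (Infer r s []) a =
      (\<lambda>n. coerce (snd s) (rule_output r s (a n) (witness r s a n) Star Star))"
    "deriv_output (Infer r s [d]) a =
      (\<lambda>n. coerce (snd s) (rule_output r s (a n) (witness r s a n) (deriv_output d a n) Star))"
    "deriv_output (Infer r s (d # d' # ds)) a =
      (\<lambda>n. coerce (snd s) (rule_output r s (a n) (witness r s a n) (deriv_output d a n)
        (deriv_output d' (\<lambda>i. second_env r (a i) (deriv_output d a i)) n)))"
    by (simp_all add: fun_eq_iff deriv_output_def deriv_run_Infer infer_step_def)
qed

section \<open>Soundness\<close>

definition realizing_envs ::
  "ind_assignment \<Rightarrow> pred_assignment \<Rightarrow> form list \<Rightarrow> (nat \<Rightarrow> env) \<Rightarrow> bool" where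
  "realizing_envs \<kappa> \<sigma> \<Gamma> a \<longleftrightarrow>
     (\<forall>n i. ind_bit (a n) i \<longleftrightarrow> n = \<kappa> i) \<and> (\<forall>n X. bit_at (pred_bits (a n)) X \<longleftrightarrow> \<sigma> X n) \<and>
     (\<exists>Rs. list_all2 (\<lambda>\<psi> R. realizer \<psi> R \<kappa> \<sigma>) \<Gamma> Rs \<and>
       (\<forall>n. hyp_moves (a n) = map (\<lambda>R. R n) Rs))"

lemma realizing_envsD:
  assumes "realizing_envs \<kappa> \<sigma> \<Gamma> a"
  shows "ind_bit (a n) i \<longleftrightarrow> n = \<kappa> i" "bit_at (pred_bits (a n)) X \<longleftrightarrow> \<sigma> X n"
  using assms by (simp_all add: realizing_envs_def)

lemma realizing_envs_sat:
  assumes "realizing_envs \<kappa> \<sigma> \<Gamma> a"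
  shows "\<forall>\<psi>\<in>set \<Gamma>. sat \<psi> \<kappa> \<sigma>"
proof -
  obtain Rs where "list_all2 (\<lambda>\<psi> R. realizer \<psi> R \<kappa> \<sigma>) \<Gamma> Rs"
    using assms unfolding realizing_envs_def by blast
  then show ?thesis by (induction rule: list_all2_induct) (auto intro: realizer_imp_sat)
qed

lemma realizing_envs_hyp_move:
  assumes "realizing_envs \<kappa> \<sigma> \<Gamma> a" "\<phi> \<in> set \<Gamma>"
  shows "realizer \<phi> (\<lambda>n. hyp_move \<phi> \<Gamma> (hyp_moves (a n))) \<kappa> \<sigma>"
proof -
  obtain Rs where Rs: "list_all2 (\<lambda>\<psi> R. realizer \<psi> R \<kappa> \<sigma>) \<Gamma> Rs"
    and moves: "\<And>n. hyp_moves (a n) = map (\<lambda>R. R n) Rs"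
    using assms(1) unfolding realizing_envs_def by blast
  from Rs assms(2) have "realizer \<phi> (\<lambda>n. hyp_move \<phi> \<Gamma> (map (\<lambda>R. R n) Rs)) \<kappa> \<sigma>"
  proof (induction rule: list_all2_induct)
    case (Cons \<psi> \<Gamma> R Rs)
    then show ?case by (cases "\<psi> = \<phi>") auto
  qed simp
  then show ?thesis by (simp add: moves)
qed

lemma realizing_envs_add_hyp:
  assumes "realizing_envs \<kappa> \<sigma> \<Gamma> a" "realizer \<phi> R \<kappa> \<sigma>"
  shows "realizing_envs \<kappa> \<sigma> (\<Gamma> @ [\<phi>]) (\<lambda>n. add_hyp (R n) (a n))"
proof -
  obtain Rs where "list_all2 (\<lambda>\<psi> R. realizer \<psi> R \<kappa> \<sigma>) \<Gamma> Rs"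
    and "\<And>n. hyp_moves (a n) = map (\<lambda>R. R n) Rs"
    using assms(1) unfolding realizing_envs_def by blast
  with assms show ?thesis
    unfolding realizing_envs_def by (auto intro!: exI[of _ "Rs @ [R]"] list_all2_appendI)
qed

lemma realizing_envs_set_ind:
  assumes "realizing_envs \<kappa> \<sigma> \<Gamma> a" "\<forall>\<psi>\<in>set \<Gamma>. z \<notin> fvi \<psi>"
  shows "realizing_envs (\<kappa>(z := k)) \<sigma> \<Gamma> (\<lambda>n. set_ind z (n = k) (a n))"
proof -
  have "list_all2 (\<lambda>\<psi> R. realizer \<psi> R (\<kappa>(z := k)) \<sigma>) \<Gamma> Rs \<longleftrightarrow>
      list_all2 (\<lambda>\<psi> R. realizer \<psi> R \<kappa> \<sigma>) \<Gamma> Rs" for Rs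
    by (rule list.rel_cong_simp) (use assms(2) in \<open>auto simp: realizer_fresh_i simp_implies_def\<close>)
  then show ?thesis using assms(1) unfolding realizing_envs_def by simp
qed

lemma realizing_envs_set_pred:
  assumes "realizing_envs \<kappa> \<sigma> \<Gamma> a" "\<forall>\<psi>\<in>set \<Gamma>. Z \<notin> fvp \<psi>"
  shows "realizing_envs \<kappa> (\<sigma>(Z := S)) \<Gamma> (\<lambda>n. set_pred Z (S n) (a n))"
proof -
  have "list_all2 (\<lambda>\<psi> R. realizer \<psi> R \<kappa> (\<sigma>(Z := S))) \<Gamma> Rs \<longleftrightarrow>
      list_all2 (\<lambda>\<psi> R. realizer \<psi> R \<kappa> \<sigma>) \<Gamma> Rs" for Rs
    by (rule list.rel_cong_simp) (use assms(2) in \<open>auto simp: realizer_fresh_p simp_implies_def\<close>)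
  then show ?thesis using assms(1) unfolding realizing_envs_def by simp
qed

definition sound :: "deriv \<Rightarrow> bool" where
  "sound D \<longleftrightarrow> (\<forall>\<kappa> \<sigma> a. realizing_envs \<kappa> \<sigma> (fst (endsequent D)) a \<longrightarrow>
     realizer (snd (endsequent D)) (deriv_output D a) \<kappa> \<sigma>)"

lemma soundI:
  assumes "\<And>\<kappa> \<sigma> a. realizing_envs \<kappa> \<sigma> \<Gamma> a \<Longrightarrow>
    realizer \<phi> (deriv_output (Infer r (\<Gamma>, \<phi>) ds) a) \<kappa> \<sigma>"
  shows "sound (Infer r (\<Gamma>, \<phi>) ds)"
  using assms by (simp add: sound_def)

lemma soundD:
  assumes "sound D" "endsequent D = (\<Gamma>, \<phi>)" "realizing_envs \<kappa> \<sigma> \<Gamma> a"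
  shows "realizer \<phi> (deriv_output D a) \<kappa> \<sigma>"
  using assms by (simp add: sound_def)

lemma sound_deterministic:
  assumes "valid (endsequent D)" "deterministic (snd (endsequent D))"
  shows "sound D"
  unfolding sound_def
proof (intro allI impI)
  fix \<kappa> \<sigma> a
  assume "realizing_envs \<kappa> \<sigma> (fst (endsequent D)) a"
  from realizing_envs_sat[OF this] have "sat (snd (endsequent D)) \<kappa> \<sigma>"
    using assms(1) by (simp add: valid_def)
  then show "realizer (snd (endsequent D)) (deriv_output D a) \<kappa> \<sigma>"
    by (rule deterministic_realizer[OF assms(2)]) (simp add: deriv_output_def deriv_step_output_in_M)
qed

lemma sound_Ax:
  assumes "\<phi> \<in> set \<Gamma>"
  shows "sound (Infer Ax (\<Gamma>, \<phi>) [])"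
proof (rule soundI)
  fix \<kappa> \<sigma> a
  assume "realizing_envs \<kappa> \<sigma> \<Gamma> a"
  from realizing_envs_hyp_move[OF this assms]
  show "realizer \<phi> (deriv_output (Infer Ax (\<Gamma>, \<phi>) []) a) \<kappa> \<sigma>"
    by (simp add: deriv_output_Infer realizer_coerce)
qed

lemma sound_Cut:
  assumes d: "sound d" "endsequent d = (\<Gamma>, \<phi>)" and d': "sound d'" "endsequent d' = (\<Gamma> @ [\<phi>], \<psi>)"
  shows "sound (Infer Cut (\<Gamma>, \<psi>) [d, d'])"
proof (rule soundI)
  fix \<kappa> \<sigma> a
  assume a: "realizing_envs \<kappa> \<sigma> \<Gamma> a"
  from soundD[OF d' realizing_envs_add_hyp[OF a soundD[OF d a]]]
  show "realizer \<psi> (deriv_output (Infer Cut (\<Gamma>, \<psi>) [d, d']) a) \<kappa> \<sigma>"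
    by (simp add: deriv_output_Infer realizer_coerce)
qed

lemma sound_AndI:
  assumes d: "sound d" "endsequent d = (\<Gamma>, \<phi>)" and d': "sound d'" "endsequent d' = (\<Gamma>, \<psi>)"
  shows "sound (Infer AndI (\<Gamma>, And \<phi> \<psi>) [d, d'])"
proof (rule soundI)
  fix \<kappa> \<sigma> a
  assume a: "realizing_envs \<kappa> \<sigma> \<Gamma> a"
  have "realizer (And \<phi> \<psi>) (\<lambda>n. MPair (deriv_output d a n) (deriv_output d' a n)) \<kappa> \<sigma>"
    using soundD[OF d a] soundD[OF d' a] by auto
  from realizer_coerce[OF this]
  show "realizer (And \<phi> \<psi>) (deriv_output (Infer AndI (\<Gamma>, And \<phi> \<psi>) [d, d']) a) \<kappa> \<sigma>"
    by (simp only: deriv_output_Infer rule_output.simps second_env.simps snd_conv)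
qed

lemma sound_AndE:
  assumes "sound d" "endsequent d = (\<Gamma>, And \<phi> \<psi>)"
  shows "sound (Infer AndE1 (\<Gamma>, \<phi>) [d])" "sound (Infer AndE2 (\<Gamma>, \<psi>) [d])"
proof -
  have "realizer \<phi> (\<lambda>n. move_fst (deriv_output d a n)) \<kappa> \<sigma> \<and>
      realizer \<psi> (\<lambda>n. move_snd (deriv_output d a n)) \<kappa> \<sigma>" if "realizing_envs \<kappa> \<sigma> \<Gamma> a" for \<kappa> \<sigma> a
    using soundD[OF assms that] by auto
  then show "sound (Infer AndE1 (\<Gamma>, \<phi>) [d])" "sound (Infer AndE2 (\<Gamma>, \<psi>) [d])"
    by (auto intro!: soundI simp: deriv_output_Infer realizer_coerce)
qed

lemma sound_ExII:
  assumes d: "sound d" "endsequent d = (\<Gamma>, insti t \<phi>)"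
  shows "sound (Infer (ExII t) (\<Gamma>, ExI \<phi>) [d])"
proof (rule soundI)
  fix \<kappa> \<sigma> a
  assume a: "realizing_envs \<kappa> \<sigma> \<Gamma> a"
  have "realizer (ExI \<phi>) (\<lambda>n. MPair (Bit (n = \<kappa> t)) (MPair Star (deriv_output d a n))) \<kappa> \<sigma>"
    using soundD[OF d a] unfolding realizer_insti realizer.simps by blast
  from realizer_coerce[OF this]
  show "realizer (ExI \<phi>) (deriv_output (Infer (ExII t) (\<Gamma>, ExI \<phi>) [d]) a) \<kappa> \<sigma>"
    by (simp only: deriv_output_Infer rule_output.simps snd_conv realizing_envsD[OF a])
qed

lemma sound_ExIE:
  assumes fresh: "fresh_i z (ExI \<phi> # \<psi> # \<Gamma>)" and d: "sound d" "endsequent d = (\<Gamma>, ExI \<phi>)"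
    and d': "sound d'" "endsequent d' = (\<Gamma> @ [insti z \<phi>], \<psi>)"
  shows "sound (Infer (ExIE z) (\<Gamma>, \<psi>) [d, d'])"
proof (rule soundI)
  fix \<kappa> \<sigma> a
  assume a: "realizing_envs \<kappa> \<sigma> \<Gamma> a"
  have z: "z \<notin> fvi (ExI \<phi>)" "z \<notin> fvi \<psi>" "\<forall>\<psi>\<in>set \<Gamma>. z \<notin> fvi \<psi>"
    using fresh unfolding fresh_i_def by (simp_all del: fvi.simps)
  obtain k R where out: "deriv_output d a = (\<lambda>n. MPair (Bit (n = k)) (MPair Star (R n)))"
    and "realizer \<phi> R (case_nat k \<kappa>) \<sigma>"
    using soundD[OF d a] by auto
  then have "realizer (insti z \<phi>) R (\<kappa>(z := k)) \<sigma>" using realizer_insti_fresh[OF z(1)] by blast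
  from soundD[OF d' realizing_envs_add_hyp[OF realizing_envs_set_ind[OF a z(3)] this]]
  have "realizer \<psi> (deriv_output d' (\<lambda>n. second_env (ExIE z) (a n) (deriv_output d a n))) \<kappa> \<sigma>"
    by (simp add: out realizer_fresh_i[OF z(2)])
  then show "realizer \<psi> (deriv_output (Infer (ExIE z) (\<Gamma>, \<psi>) [d, d']) a) \<kappa> \<sigma>"
    unfolding deriv_output_Infer rule_output.simps snd_conv by (rule realizer_coerce)
qed

lemma sound_ExPI:
  assumes d: "sound d" "endsequent d = (\<Gamma>, instp Y \<phi>)"
  shows "sound (Infer (ExPI Y) (\<Gamma>, ExP \<phi>) [d])"
proof (rule soundI)
  fix \<kappa> \<sigma> a
  assume a: "realizing_envs \<kappa> \<sigma> \<Gamma> a"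
  have "realizer (ExP \<phi>) (\<lambda>n. MPair (Bit (\<sigma> Y n)) (deriv_output d a n)) \<kappa> \<sigma>"
    using soundD[OF d a] unfolding realizer_instp realizer.simps by blast
  from realizer_coerce[OF this]
  show "realizer (ExP \<phi>) (deriv_output (Infer (ExPI Y) (\<Gamma>, ExP \<phi>) [d]) a) \<kappa> \<sigma>"
    by (simp only: deriv_output_Infer rule_output.simps snd_conv realizing_envsD[OF a])
qed

lemma sound_ExPE:
  assumes fresh: "fresh_p Z (ExP \<phi> # \<psi> # \<Gamma>)" and d: "sound d" "endsequent d = (\<Gamma>, ExP \<phi>)"
    and d': "sound d'" "endsequent d' = (\<Gamma> @ [instp Z \<phi>], \<psi>)"
  shows "sound (Infer (ExPE Z) (\<Gamma>, \<psi>) [d, d'])"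
proof (rule soundI)
  fix \<kappa> \<sigma> a
  assume a: "realizing_envs \<kappa> \<sigma> \<Gamma> a"
  have Z: "Z \<notin> fvp (ExP \<phi>)" "Z \<notin> fvp \<psi>" "\<forall>\<psi>\<in>set \<Gamma>. Z \<notin> fvp \<psi>"
    using fresh unfolding fresh_p_def by (simp_all del: fvp.simps)
  obtain S R where out: "deriv_output d a = (\<lambda>n. MPair (Bit (S n)) (R n))"
    and "realizer \<phi> R \<kappa> (case_nat S \<sigma>)"
    using soundD[OF d a] by auto
  then have "realizer (instp Z \<phi>) R \<kappa> (\<sigma>(Z := S))" using realizer_instp_fresh[OF Z(1)] by blast
  from soundD[OF d' realizing_envs_add_hyp[OF realizing_envs_set_pred[OF a Z(3)] this]]
  have "realizer \<psi> (deriv_output d' (\<lambda>n. second_env (ExPE Z) (a n) (deriv_output d a n))) \<kappa> \<sigma>"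
    by (simp add: out realizer_fresh_p[OF Z(2)])
  then show "realizer \<psi> (deriv_output (Infer (ExPE Z) (\<Gamma>, \<psi>) [d, d']) a) \<kappa> \<sigma>"
    unfolding deriv_output_Infer rule_output.simps snd_conv by (rule realizer_coerce)
qed

lemma sound_EqSubst:
  assumes d: "sound d" "endsequent d = (\<Gamma>, substi x y \<phi>)" and d': "valid (\<Gamma>, Eq y z)"
  shows "sound (Infer (EqSubst x y z \<phi>) (\<Gamma>, substi x z \<phi>) [d, d'])"
proof (rule soundI)
  fix \<kappa> \<sigma> a
  assume a: "realizing_envs \<kappa> \<sigma> \<Gamma> a"
  have "\<kappa> y = \<kappa> z" using validD[OF d' realizing_envs_sat[OF a]] by simp
  with soundD[OF d a] have "realizer (substi x z \<phi>) (deriv_output d a) \<kappa> \<sigma>"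
    by (simp add: realizer_substi)
  from realizer_coerce[OF this]
  show "realizer (substi x z \<phi>)
      (deriv_output (Infer (EqSubst x y z \<phi>) (\<Gamma>, substi x z \<phi>) [d, d']) a) \<kappa> \<sigma>"
    by (simp only: deriv_output_Infer rule_output.simps snd_conv)
qed

lemma witness_ZeroEx: "witness ZeroEx s a n \<longleftrightarrow> n = 0"
  unfolding witness_def local_form.simps seg_accepting.simps seg_run_Zero
  by (auto simp: local_letter_def less_Suc_eq)

lemma sound_ZeroEx: "sound (Infer ZeroEx (\<Gamma>, ExI (Zero 0)) [])"
proof (rule soundI)
  fix \<kappa> \<sigma> a
  have "realizer (ExI (Zero 0)) (\<lambda>n. MPair (Bit (n = 0)) (MPair Star Star)) \<kappa> \<sigma>" by auto
  then show "realizer (ExI (Zero 0)) (deriv_output (Infer ZeroEx (\<Gamma>, ExI (Zero 0)) []) a) \<kappa> \<sigma>"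
    by (simp add: deriv_output_Infer witness_ZeroEx)
qed

lemma witness_ScEx:
  assumes "realizing_envs \<kappa> \<sigma> \<Gamma> a"
  shows "witness ScEx (\<Gamma>, ExI (Sc (Suc x) 0)) a n \<longleftrightarrow> n = Suc (\<kappa> x)"
proof -
  let ?w = "\<lambda>i. local_letter (\<Gamma>, ExI (Sc (Suc x) 0)) (i = n) (a i)"
  have bits: "bit_at (fst (?w i)) 0 \<longleftrightarrow> i = n" "bit_at (fst (?w i)) 1 \<longleftrightarrow> i = \<kappa> x" for i
    by (simp_all add: local_letter_def realizing_envsD[OF assms])
  have "(\<forall>j<Suc n. j = n \<longleftrightarrow> 0 < j \<and> j - 1 = \<kappa> x) \<longleftrightarrow> n = Suc (\<kappa> x)" by auto
  then show ?thesis
    unfolding witness_def local_form.simps seg_accepting.simps seg_run_Sc psnd_pair bits by simp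
qed

lemma sound_ScEx: "sound (Infer ScEx (\<Gamma>, ExI (Sc (Suc x) 0)) [])"
proof (rule soundI)
  fix \<kappa> \<sigma> a
  assume "realizing_envs \<kappa> \<sigma> \<Gamma> a"
  note witness = witness_ScEx[OF this]
  have "realizer (ExI (Sc (Suc x) 0)) (\<lambda>n. MPair (Bit (n = Suc (\<kappa> x))) (MPair Star Star)) \<kappa> \<sigma>"
    by auto
  then show "realizer (ExI (Sc (Suc x) 0))
      (deriv_output (Infer ScEx (\<Gamma>, ExI (Sc (Suc x) 0)) []) a) \<kappa> \<sigma>"
    by (simp add: deriv_output_Infer witness)
qed

lemma witness_SyncCompr:
  assumes "fvi (relativize (Le 0 1) \<chi>) \<subseteq> {0}" "realizing_envs \<kappa> \<sigma> \<Gamma> a"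
  shows "witness (SyncCompr \<chi>) s a n \<longleftrightarrow> sat (relativize (Le 0 1) \<chi>) (case_nat n \<kappa>) \<sigma>"
proof -
  have "fvi \<chi> \<subseteq> {0}" using fvi_subset_fvi_relativize assms(1) by blast
  then have "encodes_segment (case_nat n \<kappa> 0) \<chi> (case_nat n \<kappa>) \<sigma>
      (\<lambda>i. local_letter s (i = n) (a i))"
    by (auto simp: encodes_segment_def local_letter_def realizing_envsD[OF assms(2)])
  from seg_accepting_iff_sat_relativize[OF this] show ?thesis
    by (simp add: witness_def del: seg_run.simps)
qed

lemma sound_SyncCompr:
  assumes fv: "fvi (relativize (Le 0 1) \<chi>) \<subseteq> {0}"
    and d: "sound d" "endsequent d = (\<Gamma>, substp 0 (relativize (Le 0 1) \<chi>) \<psi>)"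
  shows "sound (Infer (SyncCompr \<chi>) (\<Gamma>, ExP \<psi>) [d])"
proof (rule soundI)
  fix \<kappa> \<sigma> a
  assume a: "realizing_envs \<kappa> \<sigma> \<Gamma> a"
  let ?S = "\<lambda>n. sat (relativize (Le 0 1) \<chi>) (case_nat n \<kappa>) \<sigma>"
  have "realizer \<psi> (\<lambda>n. coerce \<psi> (deriv_output d a n)) \<kappa> (case_nat ?S \<sigma>)"
    using realizer_substp[OF soundD[OF d a]] by (simp only: insert_at_0)
  then have "realizer (ExP \<psi>) (\<lambda>n. MPair (Bit (?S n)) (coerce \<psi> (deriv_output d a n))) \<kappa> \<sigma>"
    unfolding realizer.simps
    by (intro exI[of _ ?S] exI[of _ "\<lambda>n. coerce \<psi> (deriv_output d a n)"] conjI refl)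
  then show "realizer (ExP \<psi>) (deriv_output (Infer (SyncCompr \<chi>) (\<Gamma>, ExP \<psi>) [d]) a) \<kappa> \<sigma>"
    by (simp add: deriv_output_Infer witness_SyncCompr[OF fv a])
qed

lemma sound_rule_instance:
  assumes "rule_instance r (map endsequent ds) s" "\<forall>d\<in>set ds. sound d \<and> valid (endsequent d)"
  shows "sound (Infer r s ds)"
proof (cases "deterministic (snd s)")
  case True
  have "valid s" using valid_rule_instance[OF assms(1)] assms(2) by simp
  with True show ?thesis by (simp add: sound_deterministic)
next
  case False
  from assms(1) show ?thesis
    by (cases rule: rule_instance.cases)
      (use False assms(2) in \<open>auto simp: map_eq_Cons_conv simp del: One_nat_def
        intro: sound_Ax sound_Cut sound_AndI
        sound_AndE sound_ExII sound_ExIE sound_ExPI sound_ExPE sound_EqSubst sound_ZeroEx sound_ScEx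
        sound_SyncCompr\<close>)
qed

theorem smso_derivation_sound: "smso_derivation D \<Longrightarrow> sound D"
proof (induction rule: smso_derivation.induct)
  case (1 ds r s)
  then show ?case by (intro sound_rule_instance) (auto intro: smso_derivation_valid)
qed

section \<open>The Mealy machine\<close>

definition table_machine ::
  "nat list \<Rightarrow> nat \<Rightarrow> 'a list \<Rightarrow> (nat \<Rightarrow> 'a \<Rightarrow> nat \<times> 'b) \<Rightarrow> ('a, 'b) mealy" where
  "table_machine Q q\<^sub>0 as f = \<lparr> mstates = Q, minit = q\<^sub>0,
     mtable = concat (map (\<lambda>q. map (\<lambda>a. ((q, a), f q a)) as) Q) \<rparr>"

lemma map_of_table_machine:
  assumes "q \<in> set Q" "a \<in> set as"
  shows "map_of (mtable (table_machine Q q\<^sub>0 as f)) (q, a) = Some (f q a)"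
proof -
  have "mtable (table_machine Q q\<^sub>0 as f) =
      map (\<lambda>x. (x, case x of (q, a) \<Rightarrow> f q a)) (List.product Q as)"
    by (simp add: table_machine_def product_concat_map map_concat comp_def)
  then show ?thesis using assms by (simp add: map_of_map_restrict restrict_map_def)
qed

lemma mealy_machine_table_machine:
  assumes "q\<^sub>0 \<in> set Q" "\<And>q a. q \<in> set Q \<Longrightarrow> a \<in> set as \<Longrightarrow> f q a \<in> set Q \<times> \<Gamma>"
  shows "mealy_machine (set as) \<Gamma> (table_machine Q q\<^sub>0 as f)"
  unfolding mealy_machine_def
proof (intro conjI ballI)
  fix q a
  assume "q \<in> set (mstates (table_machine Q q\<^sub>0 as f))" "a \<in> set as"
  then show "\<exists>q'\<in>set (mstates (table_machine Q q\<^sub>0 as f)). \<exists>b\<in>\<Gamma>.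
      map_of (mtable (table_machine Q q\<^sub>0 as f)) (q, a) = Some (q', b)"
    using map_of_table_machine[of q Q a as q\<^sub>0 f] assms(2)[of q a]
    by (cases "f q a") (auto simp: table_machine_def)
qed (simp add: assms(1) table_machine_def)

lemma mealy_fun_table_machine:
  assumes "q\<^sub>0 \<in> set Q" "\<And>q a. q \<in> set Q \<Longrightarrow> a \<in> set as \<Longrightarrow> fst (f q a) \<in> set Q"
    and "\<And>n. w n \<in> set as"
    and "\<rho> 0 = q\<^sub>0" "\<And>n. \<rho> (Suc n) = fst (f (\<rho> n) (w n))"
  shows "mealy_fun (table_machine Q q\<^sub>0 as f) w n = snd (f (\<rho> n) (w n))"
proof -
  let ?m = "table_machine Q q\<^sub>0 as f"
  have trans: "mtrans ?m q (w n) = f q (w n)" if "q \<in> set Q" for q n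
    using map_of_table_machine[OF that assms(3), of q\<^sub>0 f n] by (simp add: mtrans_def)
  have "mstate_seq ?m w n = \<rho> n \<and> \<rho> n \<in> set Q" for n
  proof (induction n)
    case 0
    show ?case using assms(1,4) by (simp add: table_machine_def)
  next
    case (Suc n)
    then show ?case using assms(2)[OF _ assms(3)] by (simp add: trans assms(5))
  qed
  then show ?thesis by (simp add: mealy_fun_def trans)
qed

fun move_list :: "form \<Rightarrow> move list" where
  "move_list (And \<phi> \<psi>) =
     concat (map (\<lambda>m. map (\<lambda>m'. MPair m m') (move_list \<psi>)) (move_list \<phi>))"
| "move_list (ExI \<phi>) =
     concat (map (\<lambda>b. map (\<lambda>m. MPair (Bit b) (MPair Star m)) (move_list \<phi>)) [False, True])"
| "move_list (ExP \<phi>) =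
     concat (map (\<lambda>b. map (\<lambda>m. MPair (Bit b) m) (move_list \<phi>)) [False, True])"
| "move_list _ = [Star]"

lemma set_move_list: "set (move_list \<phi>) = M \<phi>"
  by (induction \<phi>) auto

definition bool_lists :: "nat \<Rightarrow> bool list list" where
  "bool_lists n = product_lists (replicate n [False, True])"

lemma set_bool_lists: "set (bool_lists n) = {xs. length xs = n}"
  by (auto simp: bool_lists_def product_lists_set list_all2_conv_all_nth)

definition input_list :: "nat \<Rightarrow> nat \<Rightarrow> form list \<Rightarrow> input list" where
  "input_list l p \<Gamma> = concat (map (\<lambda>xs. concat (map (\<lambda>Xs. map (\<lambda>ms. (xs, Xs, replicate l Star, ms))
     (product_lists (map (\<lambda>\<phi>. move_list \<phi>) \<Gamma>))) (bool_lists p))) (bool_lists l))"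

lemma set_input_list: "set (input_list l p \<Gamma>) = inputs l p \<Gamma>"
  by (auto simp: input_list_def inputs_def set_bool_lists product_lists_set list_all2_map2
      set_move_list)

text \<open>
  The variables that are not listed have the value 0, so their default bit is set exactly at
  time 0; the machine has to know whether it is in its first step.
\<close>

definition input_env :: "bool \<Rightarrow> input \<Rightarrow> env" where
  "input_env first a = (first, (fst a, fst (snd a)), snd (snd (snd a)))"

definition machine_step :: "deriv \<Rightarrow> nat \<Rightarrow> input \<Rightarrow> nat \<times> move" where
  "machine_step D q a =
     (\<langle>1, fst (deriv_step D (psnd q) (input_env (pfst q = 0) a))\<rangle>,
      snd (deriv_step D (psnd q) (input_env (pfst q = 0) a)))"

definition machine :: "deriv \<Rightarrow> nat \<Rightarrow> nat \<Rightarrow> (input, move) mealy" where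
  "machine D l p = table_machine (pairs [0, 1] (deriv_states D)) \<langle>0, deriv_init D\<rangle>
     (input_list l p (fst (endsequent D))) (machine_step D)"

lemma machine_step_in_states:
  "q \<in> set (pairs [0, 1] (deriv_states D)) \<Longrightarrow>
    machine_step D q a \<in> set (pairs [0, 1] (deriv_states D)) \<times> M (snd (endsequent D))"
  by (simp add: machine_step_def in_pairs_iff deriv_step_in_states deriv_step_output_in_M)

lemma mealy_machine_machine:
  "mealy_machine (inputs l p (fst (endsequent D))) (M (snd (endsequent D))) (machine D l p)"
  unfolding machine_def set_input_list[symmetric]
  by (intro mealy_machine_table_machine machine_step_in_states) (simp add: deriv_init_in_states)

lemma mealy_fun_machine:
  assumes "\<And>n. w n \<in> inputs l p (fst (endsequent D))"
  shows "mealy_fun (machine D l p) w = deriv_output D (\<lambda>n. input_env (n = 0) (w n))"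
proof
  fix n
  let ?a = "\<lambda>n. input_env (n = 0) (w n)"
  let ?\<rho> = "\<lambda>n. \<langle>of_bool (0 < n), deriv_run D ?a n\<rangle>"
  have "mealy_fun (machine D l p) w n = snd (machine_step D (?\<rho> n) (w n))"
    unfolding machine_def
  proof (rule mealy_fun_table_machine)
    show "?\<rho> (Suc n) = fst (machine_step D (?\<rho> n) (w n))" for n by (simp add: machine_step_def)
  qed (use assms machine_step_in_states in
      \<open>simp_all add: deriv_init_in_states set_input_list mem_Times_iff\<close>)
  then show "mealy_fun (machine D l p) w n = deriv_output D ?a n"
    by (simp add: machine_step_def deriv_output_def)
qed

lemma accepting_run_interp_default:
  assumes "interp \<phi> l p A" "fvi \<phi> \<subseteq> {..<l}" "fvp \<phi> \<subseteq> {..<p}" "length ks = l" "length \<sigma>s = p"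
  shows "accepting_run R A (word ks \<sigma>s) \<longleftrightarrow>
    realizer \<phi> R (nth_default 0 ks) (nth_default (\<lambda>_. False) \<sigma>s)"
proof -
  have "realizer \<phi> R ((!) ks) ((!) \<sigma>s) \<longleftrightarrow>
      realizer \<phi> R (nth_default 0 ks) (nth_default (\<lambda>_. False) \<sigma>s)"
    by (rule realizer_cong) (use assms in \<open>auto simp: nth_default_nth subset_iff\<close>)
  then show ?thesis using accepting_run_interp[OF assms(1,4,5)] by simp
qed

lemma realizing_envs_input_stream:
  assumes "list_all2 (\<lambda>\<psi> R. realizer \<psi> R (nth_default 0 ks) (nth_default (\<lambda>_. False) \<sigma>s)) \<Gamma> Rs"
  shows "realizing_envs (nth_default 0 ks) (nth_default (\<lambda>_. False) \<sigma>s) \<Gamma>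
    (\<lambda>n. input_env (n = 0) (input_stream ks \<sigma>s Rs n))"
proof -
  have "nth_default (n = 0) (map (\<lambda>k. n = k) ks) i \<longleftrightarrow> n = nth_default 0 ks i" for n i
    by (rule nth_default_map_eq) simp
  moreover have "bit_at (map (\<lambda>\<sigma>. \<sigma> n) \<sigma>s) X \<longleftrightarrow> nth_default (\<lambda>_. False) \<sigma>s X n" for n X
    by (rule nth_default_map_eq) simp
  ultimately show ?thesis
    using assms unfolding realizing_envs_def
    by (auto simp: input_env_def input_stream_def ind_bit_def pred_bits_def hyp_moves_def)
qed

lemma input_stream_in_inputs:
  assumes "list_all2 (\<lambda>\<psi> R. realizer \<psi> R \<kappa> \<sigma>) \<Gamma> Rs" "length ks = l" "length \<sigma>s = p"
  shows "input_stream ks \<sigma>s Rs n \<in> inputs l p \<Gamma>"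
proof -
  have "list_all2 (\<lambda>m \<phi>. m \<in> M \<phi>) (map (\<lambda>R. R n) Rs) \<Gamma>"
    using assms(1) by (induction rule: list_all2_induct) (auto intro: realizer_in_M)
  then show ?thesis using assms(2,3) by (simp add: input_stream_def inputs_def)
qed

lemma realizes_machine:
  assumes "smso_derivation D" "endsequent D = (\<Gamma>, \<phi>)"
    and fv: "\<forall>\<psi>\<in>set (\<phi> # \<Gamma>). fvi \<psi> \<subseteq> {..<l} \<and> fvp \<psi> \<subseteq> {..<p}"
  shows "realizes l p \<Gamma> (mealy_fun (machine D l p)) \<phi>"
  unfolding realizes_def
proof (intro allI impI; elim conjE)
  fix As A ks \<sigma>s Rs
  assume As: "list_all2 (\<lambda>\<psi> B. interp \<psi> l p B) \<Gamma> As" and A: "interp \<phi> l p A"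
    and len: "length ks = l" "length \<sigma>s = p"
    and runs: "list_all2 (\<lambda>R B. accepting_run R B (word ks \<sigma>s)) Rs As"
  let ?\<kappa> = "nth_default 0 ks" and ?\<sigma> = "nth_default (\<lambda>_. False) \<sigma>s"
  have run_iff: "accepting_run R B (word ks \<sigma>s) \<longleftrightarrow> realizer \<psi> R ?\<kappa> ?\<sigma>"
    if "interp \<psi> l p B" "\<psi> \<in> set (\<phi> # \<Gamma>)" for \<psi> B R
    using accepting_run_interp_default[OF that(1) _ _ len] fv that(2) by blast
  have hyps: "list_all2 (\<lambda>\<psi> R. realizer \<psi> R ?\<kappa> ?\<sigma>) \<Gamma> Rs"
  proof -
    have "realizer (\<Gamma> ! i) (Rs ! i) ?\<kappa> ?\<sigma>" if "i < length \<Gamma>" for i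
      using run_iff[of "\<Gamma> ! i" "As ! i" "Rs ! i"] As runs that
      by (simp add: list_all2_conv_all_nth)
    then show ?thesis using As runs by (simp add: list_all2_conv_all_nth)
  qed
  have "realizer \<phi> (deriv_output D (\<lambda>n. input_env (n = 0) (input_stream ks \<sigma>s Rs n))) ?\<kappa> ?\<sigma>"
    using soundD[OF smso_derivation_sound[OF assms(1)] assms(2)
        realizing_envs_input_stream[OF hyps]] .
  moreover have "mealy_fun (machine D l p) (input_stream ks \<sigma>s Rs) =
      deriv_output D (\<lambda>n. input_env (n = 0) (input_stream ks \<sigma>s Rs n))"
    using input_stream_in_inputs[OF hyps len] by (intro mealy_fun_machine) (simp add: assms(2))
  ultimately show "accepting_run (mealy_fun (machine D l p) (input_stream ks \<sigma>s Rs)) A (word ks \<sigma>s)"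
    using run_iff[OF A] by simp
qed

section \<open>Computability of the machine\<close>

instantiation form :: enc begin
definition enc_form :: "form \<Rightarrow> nat" where [simp]: "enc_form = code_form"
instance ..
end

instantiation move :: enc begin
definition enc_move :: "move \<Rightarrow> nat" where [simp]: "enc_move = code_move"
instance ..
end

instantiation rule :: enc begin
definition enc_rule :: "rule \<Rightarrow> nat" where [simp]: "enc_rule = code_rule"
instance ..
end

instantiation deriv :: enc begin
definition enc_deriv :: "deriv \<Rightarrow> nat" where [simp]: "enc_deriv = code_deriv"
instance ..
end

subsection \<open>Case analysis on codes\<close>

abbreviation code_arg1 :: "nat \<Rightarrow> nat" where
  "code_arg1 n \<equiv> code_hd (code_tl n)"

abbreviation code_arg2 :: "nat \<Rightarrow> nat" where
  "code_arg2 n \<equiv> code_hd (code_tl (code_tl n))"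

definition tag :: "'a::enc \<Rightarrow> nat" where
  "tag x = code_hd (enc x)"

lemma computable_tag: "computable tag"
  by (rule computableI_code[of code_hd])
    (simp_all add: tag_def recursive_intros recursive_code_intros)

lemma tag_form [simp]:
  "tag (Eq x y) = 0" "tag (Le x y) = 1" "tag (Sc x y) = 2" "tag (Zero x) = 3" "tag (Mem x X) = 4"
  "tag Top = 5" "tag Bot = 6" "tag (And \<phi> \<psi>) = 7" "tag (Neg \<phi>) = 8" "tag (ExI \<phi>) = 9"
  "tag (ExP \<phi>) = 10"
  by (simp_all add: tag_def)

lemma tag_form_eq_iff:
  "tag \<phi> = 0 \<longleftrightarrow> (\<exists>a. \<phi> = Eq (fst a) (snd a))" "tag \<phi> = 1 \<longleftrightarrow> (\<exists>a. \<phi> = Le (fst a) (snd a))"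
  "tag \<phi> = 2 \<longleftrightarrow> (\<exists>a. \<phi> = Sc (fst a) (snd a))" "tag \<phi> = 3 \<longleftrightarrow> (\<exists>x. \<phi> = Zero x)"
  "tag \<phi> = 4 \<longleftrightarrow> (\<exists>a. \<phi> = Mem (fst a) (snd a))" "tag \<phi> = 5 \<longleftrightarrow> \<phi> = Top"
  "tag \<phi> = 6 \<longleftrightarrow> \<phi> = Bot" "tag \<phi> = 7 \<longleftrightarrow> (\<exists>a. \<phi> = And (fst a) (snd a))"
  "tag \<phi> = 8 \<longleftrightarrow> (\<exists>\<psi>. \<phi> = Neg \<psi>)" "tag \<phi> = 9 \<longleftrightarrow> (\<exists>\<psi>. \<phi> = ExI \<psi>)"
  "tag \<phi> = 10 \<longleftrightarrow> (\<exists>\<psi>. \<phi> = ExP \<psi>)"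
  by (cases \<phi>; simp)+

lemma computable_from_form_cases:
  assumes \<phi>: "computable_from F m b A \<phi>"
    and Eq: "computable_case F m b A \<phi> (\<lambda>a. Eq (fst a) (snd a)) h"
    and Le: "computable_case F m b A \<phi> (\<lambda>a. Le (fst a) (snd a)) h"
    and Sc: "computable_case F m b A \<phi> (\<lambda>a. Sc (fst a) (snd a)) h"
    and Zero: "computable_case F m b A \<phi> Zero h"
    and Mem: "computable_case F m b A \<phi> (\<lambda>a. Mem (fst a) (snd a)) h"
    and Top: "computable_from F m b (\<lambda>e. A e \<and> \<phi> e = Top) (\<lambda>e. h Top e)"
    and Bot: "computable_from F m b (\<lambda>e. A e \<and> \<phi> e = Bot) (\<lambda>e. h Bot e)"
    and And: "computable_case F m b A \<phi> (\<lambda>a. And (fst a) (snd a)) h"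
    and Neg: "computable_case F m b A \<phi> Neg h"
    and ExI: "computable_case F m b A \<phi> ExI h"
    and ExP: "computable_case F m b A \<phi> ExP h"
  shows "computable_from F m b A (\<lambda>e. h (\<phi> e) e)"
proof (rule computable_from_split)
  show "computable_from F m b A (\<lambda>e. tag (\<phi> e))"
    using computable_tag \<phi> by (rule computable_from_comp)
  show "tag (\<phi> e) < 11" for e by (cases "\<phi> e") simp_all
  let ?args = "\<lambda>n. \<langle>code_arg1 n, code_arg2 n\<rangle>"
  have args: "recursive ?args" "recursive (\<lambda>n. code_arg1 n)"
    by (intro recursive_intros recursive_code_intros)+
  note pattern = computable_from_pattern[where g = \<phi> and h = h, OF computable_from_cong[OF \<phi>]]
  have "computable_from F m b (\<lambda>e. A e \<and> tag (\<phi> e) = 0) (\<lambda>e. h (\<phi> e) e)"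
    by (rule pattern[OF _ _ args(1) _ _ Eq]) (auto simp: tag_form_eq_iff)
  moreover have "computable_from F m b (\<lambda>e. A e \<and> tag (\<phi> e) = 1) (\<lambda>e. h (\<phi> e) e)"
    by (rule pattern[OF _ _ args(1) _ _ Le]) (auto simp: tag_form_eq_iff simp del: One_nat_def)
  moreover have "computable_from F m b (\<lambda>e. A e \<and> tag (\<phi> e) = 2) (\<lambda>e. h (\<phi> e) e)"
    by (rule pattern[OF _ _ args(1) _ _ Sc]) (auto simp: tag_form_eq_iff)
  moreover have "computable_from F m b (\<lambda>e. A e \<and> tag (\<phi> e) = 3) (\<lambda>e. h (\<phi> e) e)"
    by (rule pattern[where c = Zero, OF _ _ args(2) _ _ Zero]) (auto simp: tag_form_eq_iff)
  moreover have "computable_from F m b (\<lambda>e. A e \<and> tag (\<phi> e) = 4) (\<lambda>e. h (\<phi> e) e)"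
    by (rule pattern[OF _ _ args(1) _ _ Mem]) (auto simp: tag_form_eq_iff)
  moreover have "computable_from F m b (\<lambda>e. A e \<and> tag (\<phi> e) = 5) (\<lambda>e. h (\<phi> e) e)"
    by (rule computable_from_cong[OF Top]) (auto simp: tag_form_eq_iff)
  moreover have "computable_from F m b (\<lambda>e. A e \<and> tag (\<phi> e) = 6) (\<lambda>e. h (\<phi> e) e)"
    by (rule computable_from_cong[OF Bot]) (auto simp: tag_form_eq_iff)
  moreover have "computable_from F m b (\<lambda>e. A e \<and> tag (\<phi> e) = 7) (\<lambda>e. h (\<phi> e) e)"
    by (rule pattern[OF _ _ args(1) _ _ And]) (auto simp: tag_form_eq_iff)
  moreover have "computable_from F m b (\<lambda>e. A e \<and> tag (\<phi> e) = 8) (\<lambda>e. h (\<phi> e) e)"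
    by (rule pattern[where c = Neg, OF _ _ args(2) _ _ Neg]) (auto simp: tag_form_eq_iff)
  moreover have "computable_from F m b (\<lambda>e. A e \<and> tag (\<phi> e) = 9) (\<lambda>e. h (\<phi> e) e)"
    by (rule pattern[where c = ExI, OF _ _ args(2) _ _ ExI]) (auto simp: tag_form_eq_iff)
  moreover have "computable_from F m b (\<lambda>e. A e \<and> tag (\<phi> e) = 10) (\<lambda>e. h (\<phi> e) e)"
    by (rule pattern[where c = ExP, OF _ _ args(2) _ _ ExP]) (auto simp: tag_form_eq_iff)
  ultimately show "\<forall>k<11. computable_from F m b (\<lambda>e. A e \<and> tag (\<phi> e) = k) (\<lambda>e. h (\<phi> e) e)"
    by (simp add: numeral_eq_Suc All_less_Suc)
qed

subsection \<open>The automata of formulae\<close>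

lemma computable_move_bit: "computable move_bit"
proof (rule computableI_code)
  let ?g = "\<lambda>n. if code_hd n = tag (Bit True) then code_arg1 n else 0"
  show "recursive ?g" by (intro recursive_if decidable_eq recursive_intros recursive_code_intros)
  show "?g (enc m) = enc (move_bit m)" for m by (cases m) (simp_all add: tag_def)
qed

lemma computable_move_fst: "computable move_fst"
proof (rule computableI_code)
  let ?g = "\<lambda>n. if code_hd n = tag (MPair Star Star) then code_arg1 n else code_move Star"
  show "recursive ?g" by (intro recursive_if decidable_eq recursive_intros recursive_code_intros)
  show "?g (enc m) = enc (move_fst m)" for m by (cases m) (simp_all add: tag_def)
qed

lemma computable_move_snd: "computable move_snd"
proof (rule computableI_code)
  let ?g = "\<lambda>n. if code_hd n = tag (MPair Star Star) then code_arg2 n else code_move Star"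
  show "recursive ?g" by (intro recursive_if decidable_eq recursive_intros recursive_code_intros)
  show "?g (enc m) = enc (move_snd m)" for m by (cases m) (simp_all add: tag_def)
qed

lemma computable_Bit: "computable Bit"
  by (rule computableI_code[of "\<lambda>n. Suc \<langle>1, Suc \<langle>n, 0\<rangle>\<rangle>"])
    (simp_all add: recursive_intros list_encode.simps)

lemma computable_MPair: "computable (\<lambda>p. MPair (fst p) (snd p))"
  by (rule computableI_code[of "\<lambda>n. Suc \<langle>2, Suc \<langle>pfst n, Suc \<langle>psnd n, 0\<rangle>\<rangle>\<rangle>"])
    (simp_all add: recursive_intros list_encode.simps)

lemmas [computable_intros] =
  computable_from_comp[OF computable_move_bit] computable_from_comp[OF computable_move_fst]
  computable_from_comp[OF computable_move_snd] computable_from_comp[OF computable_Bit]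
  computable_from_comp2[OF computable_MPair]

lemma computable_coerce: "computable (\<lambda>p. coerce (fst p) (snd p))"
  by (rule computable_recursion[where m = "\<lambda>p. size (fst p)"],
      rule computable_from_form_cases[where \<phi> = fst and h = "\<lambda>\<phi> p. coerce \<phi> (snd p)"],
      unfold coerce.simps)
    (intro computable_intros computable_from_call2[where f = coerce]; simp)+

lemma computable_nth_default:
  "computable (\<lambda>p. nth_default (fst p) (fst (snd p)) (snd (snd p)) :: 'a::enc)"
  by (rule computable_recursion[where m = "\<lambda>p. snd (snd p)"],
      rule computable_from_list_cases[where xs = "\<lambda>p. fst (snd p)" and
        h = "\<lambda>xs p. nth_default (fst p) xs (snd (snd p))"],
      unfold nth_default_Nil, intro computable_intros, intro computable_intros,
      rule computable_from_nat_cases[where n = "\<lambda>p. snd (snd (fst p))" and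
        h = "\<lambda>n p. nth_default (fst (fst p)) (fst (snd p) # snd (snd p)) n"],
      unfold nth_default_Cons_0 nth_default_Cons_Suc)
    (intro computable_intros computable_from_call3[where f = nth_default]; simp)+

lemma computable_pairs: "computable (\<lambda>p. pairs (fst p) (snd p))"
  unfolding pairs_def product_concat_map map_concat
  by (rule computable_recursion) (intro computable_intros)

lemmas [computable_intros] = computable_from_comp2[OF computable_pairs]
  computable_from_comp[OF computable_subseqs]
  computable_from_comp3[where f = nth_default, OF computable_nth_default]

lemma computable_seg_states: "computable seg_states"
  by (rule computable_recursion[where m = size],
      rule computable_from_form_cases[where \<phi> = "\<lambda>\<phi>. \<phi>" and h = "\<lambda>\<phi> e. seg_states \<phi>"],
      unfold seg_states.simps)
    (intro computable_intros computable_from_call[where F = seg_states]; simp)+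

lemma computable_seg_init: "computable seg_init"
  by (rule computable_recursion[where m = size],
      rule computable_from_form_cases[where \<phi> = "\<lambda>\<phi>. \<phi>" and h = "\<lambda>\<phi> e. seg_init \<phi>"],
      unfold seg_init.simps)
    (intro computable_intros computable_from_call[where F = seg_init]; simp)+

lemmas [computable_intros] = computable_from_comp[OF computable_seg_states]
  computable_from_comp[OF computable_seg_init]

lemma computable_seg_step:
  "computable (\<lambda>p. seg_step (fst p) (fst (snd p)) (snd (snd p)))"
  by (rule computable_recursion[where m = "\<lambda>p. size (fst p)"],
      rule computable_from_form_cases[where \<phi> = fst and
        h = "\<lambda>\<phi> p. seg_step \<phi> (fst (snd p)) (snd (snd p))"],
      unfold seg_step.simps subset_step_def succ_capped_def)
    (intro computable_intros computable_from_call3[where f = seg_step]; simp)+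

lemma computable_seg_accepting: "computable (\<lambda>p. seg_accepting (fst p) (snd p))"
  by (rule computable_recursion[where m = "\<lambda>p. size (fst p)"],
      rule computable_from_form_cases[where \<phi> = fst and h = "\<lambda>\<phi> p. seg_accepting \<phi> (snd p)"],
      unfold seg_accepting.simps)
    (intro computable_intros computable_from_call2[where f = seg_accepting]; simp)+

lemmas [computable_intros] = computable_from_comp2[where f = coerce, OF computable_coerce]
  computable_from_comp3[where f = seg_step, OF computable_seg_step]
  computable_from_comp2[where f = seg_accepting, OF computable_seg_accepting]

subsection \<open>The transition function of the machine\<close>

lemma computable_tl: "computable (tl :: 'a::enc list \<Rightarrow> 'a list)"
  by (rule computableI_code[of code_tl])
    (simp_all add: recursive_intros recursive_code_intros map_tl)

lemmas [computable_intros] = computable_from_comp[OF computable_tl]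

lemma computable_update_default:
  "computable (\<lambda>p. update_default (fst p) (fst (snd p)) (fst (snd (snd p))) (snd (snd (snd p)))
    :: 'a::enc list)"
  by (rule computable_recursion[where m = "\<lambda>p. fst (snd (snd p))"],
      rule computable_from_nat_cases[where n = "\<lambda>p. fst (snd (snd p))" and
        h = "\<lambda>i p. update_default (fst p) (fst (snd p)) i (snd (snd (snd p)))"],
      unfold update_default.simps)
    (intro computable_intros computable_from_call4[where f = update_default]; simp)+

lemma inj_code_form: "inj code_form"
proof (rule injI)
  show "code_form \<phi> = code_form \<psi> \<Longrightarrow> \<phi> = \<psi>" for \<phi> \<psi>
    by (induction \<phi> arbitrary: \<psi>; case_tac \<psi>) (simp_all add: list_encode_eq)
qed

lemma computable_eq_form: "computable (\<lambda>p. fst p = (snd p :: form))"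
  by (rule computable_eq) (simp add: inj_code_form)

lemmas [computable_intros] = computable_from_comp2[OF computable_eq_form]
  computable_from_comp4[where f = update_default, OF computable_update_default]

lemma computable_hyp_move: "computable (\<lambda>p. hyp_move (fst p) (fst (snd p)) (snd (snd p)))"
  by (rule computable_recursion[where m = "\<lambda>p. length (fst (snd p))"],
      rule computable_from_list_cases[where xs = "\<lambda>p. fst (snd p)" and
        h = "\<lambda>\<Gamma> p. hyp_move (fst p) \<Gamma> (snd (snd p))"],
      unfold hyp_move.simps, intro computable_intros, intro computable_intros,
      rule computable_from_list_cases[where xs = "\<lambda>p. snd (snd (fst p))" and
        h = "\<lambda>ms p. hyp_move (fst (fst p)) (fst (snd p) # snd (snd p)) ms"],
      unfold hyp_move.simps)
    (intro computable_intros computable_from_call3[where f = hyp_move]; simp)+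

lemmas [computable_intros] = computable_from_comp3[where f = hyp_move, OF computable_hyp_move]

lemma computable_pred_var: "computable pred_var"
proof (rule computableI_code)
  let ?g = "\<lambda>n. if code_hd n = tag (ExI Top) \<and> code_hd (code_arg1 n) = tag (Sc 0 0)
    then code_arg1 (code_arg1 n) - 1 else 0"
  show "recursive ?g"
    by (intro recursive_if decidable_conj decidable_eq recursive_intros recursive_code_intros)
  show "?g (enc \<phi>) = enc (pred_var \<phi>)" for \<phi> by (cases \<phi> rule: pred_var.cases) simp_all
qed

lemma computable_local_form: "computable local_form"
proof (rule computableI_code)
  let ?g = "\<lambda>n. if code_hd n = tag (SyncCompr Top) then code_arg1 n
    else if code_hd n = tag ZeroEx then code_form (Zero 0)
    else if code_hd n = tag ScEx then code_form (Sc 1 0) else code_form Top"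
  show "recursive ?g" by (intro recursive_if decidable_eq recursive_intros recursive_code_intros)
  show "?g (enc r) = enc (local_form r)" for r by (cases r) (simp_all add: tag_def)
qed

definition rule_var :: "rule \<Rightarrow> nat" where
  "rule_var r = code_arg1 (code_rule r)"

lemma computable_rule_var: "computable rule_var"
  by (rule computableI_code[of "\<lambda>n. code_arg1 n"])
    (simp_all add: rule_var_def recursive_intros recursive_code_intros)

lemmas [computable_intros] =
  computable_from_comp[OF computable_pred_var] computable_from_comp[OF computable_local_form]
  computable_from_comp[OF computable_rule_var]
  computable_from_comp[where f = "tag :: rule \<Rightarrow> nat", OF computable_tag]

lemma second_env_conv_if: "second_env r a m =
  (if tag r = tag Cut then add_hyp m a
   else if tag r = tag (ExIE 0) then
     add_hyp (move_snd (move_snd m)) (set_ind (rule_var r) (move_bit (move_fst m)) a)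
   else if tag r = tag (ExPE 0) then
     add_hyp (move_snd m) (set_pred (rule_var r) (move_bit (move_fst m)) a)
   else a)"
  by (cases r) (simp_all add: tag_def rule_var_def)

lemma rule_output_conv_if: "rule_output r s a w m1 m2 =
  (if tag r = tag Ax then hyp_move (snd s) (fst s) (hyp_moves a)
   else if tag r = tag Cut \<or> tag r = tag (ExIE 0) \<or> tag r = tag (ExPE 0) then m2
   else if tag r = tag AndI then MPair m1 m2
   else if tag r = tag AndE1 then move_fst m1
   else if tag r = tag AndE2 then move_snd m1
   else if tag r = tag (ExII 0) then MPair (Bit (ind_bit a (rule_var r))) (MPair Star m1)
   else if tag r = tag (ExPI 0) then MPair (Bit (bit_at (pred_bits a) (rule_var r))) m1
   else if tag r = tag (EqSubst 0 0 0 Top) then m1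
   else if tag r = tag ZeroEx \<or> tag r = tag ScEx then MPair (Bit w) Star
   else if tag r = tag (SyncCompr Top) then MPair (Bit w) m1
   else Star)"
  by (cases r) (simp_all add: tag_def rule_var_def)

lemmas env_defs = set_ind_def set_pred_def add_hyp_def ind_bit_def pred_bits_def hyp_moves_def

lemma computable_second_env:
  "computable (\<lambda>p. second_env (fst p) (fst (snd p)) (snd (snd p)))"
  unfolding second_env_conv_if env_defs by (rule computable_recursion) (intro computable_intros)

lemma computable_infer_step: "computable (\<lambda>p. infer_step (fst p) (fst (snd p))
    (fst (snd (snd p))) (fst (snd (snd (snd p)))) (fst (snd (snd (snd (snd p)))))
    (snd (snd (snd (snd (snd p))))))"
  unfolding infer_step_def local_letter_def rule_output_conv_if env_defs
  by (rule computable_recursion) (intro computable_intros)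

lemma computable_from_infer_step [computable_intros]:
  assumes "computable_from F m b A r" "computable_from F m b A s" "computable_from F m b A q"
    "computable_from F m b A a" "computable_from F m b A o1" "computable_from F m b A o2"
  shows "computable_from F m b A (\<lambda>e. infer_step (r e) (s e) (q e) (a e) (o1 e) (o2 e))"
proof -
  have "computable_from F m b A (\<lambda>e. (r e, s e, q e, a e, o1 e, o2 e))"
    by (intro computable_intros assms)
  from computable_from_comp[OF computable_infer_step this] show ?thesis by simp
qed

lemmas [computable_intros] = computable_from_comp3[where f = second_env, OF computable_second_env]

abbreviation infer :: "rule \<times> sequent \<Rightarrow> deriv list \<Rightarrow> deriv" where
  "infer rs \<equiv> Infer (fst rs) (snd rs)"

lemma computable_from_Infer_cases:
  assumes D: "computable_from F m b A D"
    and h: "computable_case F m b A D (\<lambda>a. infer (fst a) (snd a)) h"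
  shows "computable_from F m b A (\<lambda>e. h (D e) e)"
proof (rule computable_from_pattern[OF D _ _ _ h])
  let ?d = "\<lambda>n. \<langle>\<langle>code_hd n, \<langle>code_hd (code_arg1 n), code_arg1 (code_arg1 n)\<rangle>\<rangle>, code_arg2 n\<rangle>"
  show "recursive ?d" by (intro recursive_intros recursive_code_intros)
  show "?d (enc (infer (fst a) (snd a))) = enc a"
    for a :: "(rule \<times> sequent) \<times> deriv list"
    by (simp add: code_sequent_def)
  show "\<exists>a. D e = infer (fst a) (snd a)" for e by (cases "D e") auto
qed simp

lemma computable_from_premises_cases:
  assumes D: "computable_from F m b A D"
    and none: "computable_case F m b A D (\<lambda>a :: _ \<times> deriv list. infer (fst a) []) h"
    and one: "computable_from F m (\<lambda>p. b (fst (fst p)))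
      (\<lambda>p. A (fst (fst p)) \<and> D (fst (fst p)) = infer (fst (snd (fst p))) [fst (snd p)])
      (\<lambda>p :: (_ \<times> _ \<times> deriv list) \<times> _ \<times> deriv list.
        h (infer (fst (snd (fst p))) [fst (snd p)]) (fst (fst p)))"
    and many: "computable_from F m (\<lambda>p. b (fst (fst (fst p))))
      (\<lambda>p. A (fst (fst (fst p))) \<and> D (fst (fst (fst p))) =
        infer (fst (snd (fst (fst p)))) (fst (snd (fst p)) # fst (snd p) # snd (snd p)))
      (\<lambda>p :: ((_ \<times> _ \<times> deriv list) \<times> _ \<times> deriv list) \<times> _ \<times> _.
        h (infer (fst (snd (fst (fst p)))) (fst (snd (fst p)) # fst (snd p) # snd (snd p)))
          (fst (fst (fst p))))"
  shows "computable_from F m b A (\<lambda>e. h (D e) e)"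
proof (rule computable_from_Infer_cases[OF D])
  show "computable_case F m b A D (\<lambda>a. infer (fst a) (snd a)) h"
  proof (rule computable_from_list_cases[where xs = "\<lambda>p. snd (snd p)" and
        h = "\<lambda>ds p. h (infer (fst (snd p)) ds) (fst p)"], goal_cases list Nil Cons)
    case list
    show ?case by (intro computable_intros)
  next
    case Nil
    show ?case by (rule computable_from_cong[OF none]) auto
  next
    case Cons
    show ?case
    proof (rule computable_from_list_cases[where xs = "\<lambda>p. snd (snd p)" and
          h = "\<lambda>ds p. h (infer (fst (snd (fst p))) (fst (snd p) # ds)) (fst (fst p))"],
        goal_cases list Nil Cons)
      case list
      show ?case by (intro computable_intros)
    next
      case Nil
      show ?case by (rule computable_from_cong[OF one]) auto
    next
      case Cons
      show ?case by (rule computable_from_cong[OF many]) auto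
    qed
  qed
qed

lemma size_premise_less:
  "D = Infer r s (d # ds) \<Longrightarrow> size d < size D" "D = Infer r s (d # d' # ds) \<Longrightarrow> size d' < size D"
  by simp_all

lemma computable_deriv_states: "computable deriv_states"
  by (rule computable_recursion[where m = size],
      rule computable_from_premises_cases[where D = "\<lambda>D. D" and h = "\<lambda>D e. deriv_states D"],
      unfold deriv_states.simps)
    (intro computable_intros computable_from_call[where F = deriv_states]; simp;
      (erule size_premise_less)?)+

lemma computable_deriv_init: "computable deriv_init"
  by (rule computable_recursion[where m = size],
      rule computable_from_premises_cases[where D = "\<lambda>D. D" and h = "\<lambda>D e. deriv_init D"],
      unfold deriv_init.simps)
    (intro computable_intros computable_from_call[where F = deriv_init]; simp;
      (erule size_premise_less)?)+

lemma computable_deriv_step: "computable (\<lambda>p. deriv_step (fst p) (fst (snd p)) (snd (snd p)))"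
  by (rule computable_recursion[where m = "\<lambda>p. size (fst p)"],
      rule computable_from_premises_cases[where D = fst and
        h = "\<lambda>D p. deriv_step D (fst (snd p)) (snd (snd p))"],
      unfold deriv_step.simps)
    (intro computable_intros computable_from_call3[where f = deriv_step]; simp;
      (erule size_premise_less)?)+

lemma computable_endsequent: "computable endsequent"
proof (rule computableI_code)
  let ?g = "\<lambda>n. \<langle>code_hd (code_arg1 n), code_arg1 (code_arg1 n)\<rangle>"
  show "recursive ?g" by (intro recursive_intros recursive_code_intros)
  show "?g (enc D) = enc (endsequent D)" for D by (cases D) (simp add: code_sequent_def)
qed

lemmas [computable_intros] = computable_from_comp[OF computable_deriv_states]
  computable_from_comp[OF computable_deriv_init] computable_from_comp[OF computable_endsequent]
  computable_from_comp3[where f = deriv_step, OF computable_deriv_step]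

lemma computable_move_list: "computable move_list"
  by (rule computable_recursion[where m = size],
      rule computable_from_form_cases[where \<phi> = "\<lambda>\<phi>. \<phi>" and h = "\<lambda>\<phi> e. move_list \<phi>"],
      unfold move_list.simps)
    (intro computable_intros computable_from_call[where F = move_list]; simp)+

lemmas [computable_intros] = computable_from_comp[OF computable_move_list]
  computable_from_comp[OF computable_product_lists] computable_from_comp2[OF computable_replicate]

lemma computable_input_list:
  "computable (\<lambda>p. input_list (fst p) (fst (snd p)) (snd (snd p)))"
  unfolding input_list_def bool_lists_def by (rule computable_recursion) (intro computable_intros)

lemma computable_machine_step:
  "computable (\<lambda>p. machine_step (fst p) (fst (snd p)) (snd (snd p)))"
  unfolding machine_step_def input_env_def by (rule computable_recursion) (intro computable_intros)

lemma computable_code_move: "computable code_move"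
  by (rule computableI_code[of "\<lambda>n. n"]) (simp_all add: recursive_intros)

lemmas [computable_intros] = computable_from_comp3[where f = input_list, OF computable_input_list]
  computable_from_comp3[where f = machine_step, OF computable_machine_step]
  computable_from_comp[OF computable_code_move]

lemma code_input_conv: "code_input a = list_encode [list_encode (map (\<lambda>b. of_bool b) (fst a)),
    list_encode (map (\<lambda>b. of_bool b) (fst (snd a))),
    list_encode (map (\<lambda>m. code_move m) (fst (snd (snd a)))),
    list_encode (map (\<lambda>m. code_move m) (snd (snd (snd a))))]"
  by (cases a) simp

lemma code_mealy_machine:
  "code_mealy (machine D l p) =
    list_encode [list_encode (pairs [0, 1] (deriv_states D)), \<langle>0, deriv_init D\<rangle>,
      list_encode (concat (map (\<lambda>q. map (\<lambda>a. list_encode [q, code_input a,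
          fst (machine_step D q a), code_move (snd (machine_step D q a))])
        (input_list l p (fst (endsequent D)))) (pairs [0, 1] (deriv_states D))))]"
  by (simp add: code_mealy_def machine_def table_machine_def map_concat comp_def split_beta)

lemma computable_machine:
  "computable (\<lambda>x. code_mealy (machine (fst x) (fst (snd x)) (snd (snd x))))"
  unfolding code_mealy_machine code_input_conv
  by (rule computable_recursion) (intro computable_intros)

theorem machine_recursive:
  "\<exists>r. \<forall>D l p. computes r [code_deriv D, l, p] (code_mealy (machine D l p))"
proof -
  obtain r where r: "\<And>x. computes r [enc x]
      (enc (code_mealy (machine (fst x) (fst (snd x)) (snd (snd x)))))"
    using computable_computes[OF computable_machine] by blast
  have "recursive_nary 3 (\<lambda>xs. \<langle>xs ! 0, \<langle>xs ! 1, xs ! 2\<rangle>\<rangle>)"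
    by (intro recursive_nary_pair recursive_nary_nth) simp_all
  then obtain s where s: "\<And>xs. length xs = 3 \<Longrightarrow> computes s xs \<langle>xs ! 0, \<langle>xs ! 1, xs ! 2\<rangle>\<rangle>"
    by (elim recursive_naryE) blast
  have "computes (Comp r [s]) [code_deriv D, l, p] (code_mealy (machine D l p))" for D l p
    using r[of "(D, l, p)"] s[of "[code_deriv D, l, p]"]
    by (intro computes.intros(4)[of "[\<langle>code_deriv D, \<langle>l, p\<rangle>\<rangle>]"]) simp_all
  then show ?thesis by blast
qed

theorem theorem5p10:
  shows "\<exists>extract :: recf.
    \<forall>(D :: deriv) (\<Gamma> :: form list) (\<phi> :: form) (l :: nat) (p :: nat).
      smso_derivation D \<and> endsequent D = (\<Gamma>, \<phi>) \<and>
      (\<forall>\<psi>\<in>set (\<phi> # \<Gamma>). fvi \<psi> \<subseteq> {..<l} \<and> fvp \<psi> \<subseteq> {..<p}) \<longrightarrow>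
      (\<exists>m :: (input, move) mealy.
         computes extract [code_deriv D, l, p] (code_mealy m) \<and>
         mealy_machine (inputs l p \<Gamma>) (M \<phi>) m \<and>
         realizes l p \<Gamma> (mealy_fun m) \<phi>)"
proof -
  obtain r where "\<And>D l p. computes r [code_deriv D, l, p] (code_mealy (machine D l p))"
    using machine_recursive by blast
  moreover have "mealy_machine (inputs l p \<Gamma>) (M \<phi>) (machine D l p)"
    if "endsequent D = (\<Gamma>, \<phi>)" for D \<Gamma> \<phi> l p
    using mealy_machine_machine[of l p D] that by simp
  ultimately show ?thesis using realizes_machine by blast
qed

end
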